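(* Let $r>0$ be real, $q=e^{-\pi\sqrt r}$, $w=\sqrt{k_rk_{25r}}$, $k^*_r=k_r/w$, $$c_r=\frac{(k'_r)^2\,(k^*_r)^5}{(k^*_r)^4-k_r^2},\qquad G(q)=\left(R(q)^{-5}-11-R(q)^5\right)^{1/3}.$$ Then: (i) $$3125c_r^2-6250c_r^{5/3}G(q)+4375c_r^{4/3}G(q)^2-1500c_rG(q)^3+275c_r^{2/3}G(q)^4+2c_r^{1/3}\left(-13+128(k'_r)^2k_r^2\right)G(q)^5+G(q)^6=0.$$ (ii) $$k_r^6+k_r^3(-16+10k_r^2)w+15k_r^4w^2-20k_r^3w^3+15k_r^2w^4+k_r(10-16k_r^2)w^5+w^6=0.$$
   Context: $K(x)=\int_0^{\pi/2}\frac{dt}{\sqrt{1-x^2\sin^2 t}}$ for $0\le x<1$. For real $r>0$, $k_r\in(0,1)$ is the unique solution $k$ of $K(\sqrt{1-k^2})/K(k)=\sqrt r$, and $k'_r=\sqrt{1-k_r^2}$. The Rogers-Ramanujan continued fraction is, for $0<q<1$, $$R(q)=\cfrac{q^{1/5}}{1+\cfrac{q}{1+\cfrac{q^2}{1+\cfrac{q^3}{1+\cdots}}}}.$$ All roots and fractional powers are the positive real ones. *)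

theory Defs
  imports "HOL-Analysis.Analysis"
begin

text \<open>Complete elliptic integral of the first kind, as a function of the modulus
  \<open>0 \<le> x < 1\<close> (not of the parameter \<open>x\<^sup>2\<close>).\<close>

definition ellK :: "real \<Rightarrow> real" where
  "ellK x = integral {0..pi/2} (\<lambda>t. 1 / sqrt (1 - x\<^sup>2 * (sin t)\<^sup>2))"

definition singular_modulus :: "real \<Rightarrow> real" where
  "singular_modulus r =
     (THE k. 0 < k \<and> k < 1 \<and> ellK (sqrt (1 - k\<^sup>2)) / ellK k = sqrt r)"

definition compl_singular_modulus :: "real \<Rightarrow> real" where
  "compl_singular_modulus r = sqrt (1 - (singular_modulus r)\<^sup>2)"

text \<open>\<open>RR_denom q m n\<close> is the finite continued fraction
  \<open>1 + q^m/(1 + q^(m+1)/(1 + \<dots> + q^(m+n-1)/1))\<close> with \<open>n\<close> partial quotients; the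
  infinite continued fraction is the limit of its convergents.\<close>

primrec RR_denom :: "real \<Rightarrow> nat \<Rightarrow> nat \<Rightarrow> real" where
  "RR_denom q m 0 = 1"
| "RR_denom q m (Suc n) = 1 + q ^ m / RR_denom q (Suc m) n"

definition rogers_ramanujan :: "real \<Rightarrow> real" where
  "rogers_ramanujan q = lim (\<lambda>n. q powr (1/5) / RR_denom q 1 n)"

definition RR_G :: "real \<Rightarrow> real" where
  "RR_G q =
     (rogers_ramanujan q powi (-5) - 11 - rogers_ramanujan q ^ 5) powr (1/3)"

definition modulus_w :: "real \<Rightarrow> real" where
  "modulus_w r = sqrt (singular_modulus r * singular_modulus (25 * r))"

definition modulus_star :: "real \<Rightarrow> real" where
  "modulus_star r = singular_modulus r / modulus_w r"

definition modulus_c :: "real \<Rightarrow> real" where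
  "modulus_c r = (compl_singular_modulus r)\<^sup>2 * modulus_star r ^ 5 /
     (modulus_star r ^ 4 - (singular_modulus r)\<^sup>2)"

end

(*
With q = exp(-pi sqrt r), the arithmetic-geometric mean evaluates the two elliptic integrals in
theta constants, so that k_r = theta_2(q)^2 / theta_3(q)^2; the same formula at q^5 gives k_{25r}.
Let lambda, mu, nu be the quotients theta_j(q) / theta_j(q^5) for j = 2, 3, 4 and m = mu^2. Splitting
theta_3^2 and psi^2 along an ideal of norm 5 in the Gaussian integers gives
(m - 1)(1 + lambda nu) = 4 and (nu^2 - 1)(1 - lambda mu) = 4, whence the modular equation (ii).
The product formulas give 256 k^2 k'^2 m^5 = (5 - m)^5 (m - 1) and
m^3 c = f(q)^6 / (q f(q^5)^6) with f the Euler product. By Ramanujan's identity the last quantity is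
R^{-5} - 11 - R^5 = G^3, so G = m c^{1/3}, and (i) is the equation for m multiplied by c^2.
*)

theory Submission
  imports Defs "HOL-Library.Nat_Bijection"
begin

section \<open>Infinite products\<close>

text \<open>One device yields all the theta identities: a product of two theta series is a sum over
  Z^2, and a sublattice on which the exponent again has no mixed term turns every coset sum back
  into a product of two theta series. The second relation between \<lambda>, \<mu>, \<nu> is the
  first at \<open>-q\<close>, which exchanges \<mu> and \<nu> and negates \<lambda>; the degree 5
  identities are therefore kept for |q| < 1. Scalars may be complex because Ramanujan's identity is
  a product over the complex fifth roots of q.

  Gauss's transformation squares the nome of (\<theta>_3^2, \<theta>_4^2) but undoes a squaring for
  (\<theta>_3^2, \<theta>_2^2). So K is the limit of a constant sequence, while K' is reached by
  running backwards into a logarithmic singularity; this is where ln q = - pi sqrt r enters.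

  The ratio \<lambda>/\<mu> is k*_r itself. It lies with \<nu>/\<mu> on a plane curve, over which
  Jacobi's quartic identity determines k_{25r}^2; hence (ii). The continued fraction is tied to
  theta functions by a positive solution of its three-term recurrence, the Rogers-Selberg
  series.\<close>

definition qp :: "'a \<Rightarrow> 'a \<Rightarrow> 'a::{real_normed_field,banach}" where
  "qp a q = (\<Prod>n. 1 - a * q ^ n)"

lemma convergent_qp:
  fixes q :: "'a::{real_normed_field,banach}"
  assumes "norm q < 1"
  shows "convergent_prod (\<lambda>n. 1 - a * q ^ n)"
proof (rule abs_convergent_prod_imp_convergent_prod)
  show "abs_convergent_prod (\<lambda>n. 1 - a * q ^ n)"
    unfolding abs_convergent_prod_conv_summable
    using assms by (simp add: norm_mult norm_power summable_mult summable_geometric)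
qed

lemma tendsto_qp:
  fixes q :: "'a::{real_normed_field,banach}"
  assumes "norm q < 1"
  shows "(\<lambda>N. \<Prod>n<N. 1 - a * q ^ n) \<longlonglongrightarrow> qp a q"
proof -
  have "(\<lambda>N. \<Prod>n\<le>N. 1 - a * q ^ n) \<longlonglongrightarrow> qp a q"
    unfolding qp_def by (rule convergent_prod_LIMSEQ[OF convergent_qp[OF assms]])
  then have "(\<lambda>N. \<Prod>n<Suc N. 1 - a * q ^ n) \<longlonglongrightarrow> qp a q"
    by (simp add: lessThan_Suc_atMost)
  then show ?thesis
    by (rule LIMSEQ_imp_Suc)
qed

lemma qp_nonzero:
  fixes q :: "'a::{real_normed_field,banach}"
  assumes "norm q < 1" "\<And>n. a * q ^ n \<noteq> 1"
  shows "qp a q \<noteq> 0"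
  unfolding qp_def using assms by (intro prodinf_nonzero convergent_qp) auto

lemma qp_nonzero':
  fixes q :: "'a::{real_normed_field,banach}"
  assumes "norm q < 1" "norm a < 1"
  shows "qp a q \<noteq> 0"
proof (rule qp_nonzero[OF assms(1)])
  fix n
  have "norm (a * q ^ n) \<le> norm a * 1"
    unfolding norm_mult norm_power using assms(1)
    by (intro mult_left_mono power_le_one) auto
  then show "a * q ^ n \<noteq> 1"
    using assms(2) by auto
qed

lemma qp_pos:
  fixes q :: real
  assumes "\<bar>q\<bar> < 1" "\<bar>a\<bar> < 1"
  shows "qp a q > 0"
proof -
  have "qp a q \<ge> 0"
  proof (rule LIMSEQ_le_const[OF tendsto_qp], use assms in simp, intro exI[of _ 0] allI impI prod_nonneg ballI)
    fix n
    have "\<bar>a * q ^ n\<bar> \<le> 1 * 1"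
      unfolding abs_mult power_abs using assms by (intro mult_mono power_le_one) auto
    then show "0 \<le> 1 - a * q ^ n" by simp
  qed
  with qp_nonzero'[of q a] assms show ?thesis by simp
qed

lemma prod_lessThan_add:
  fixes f :: "nat \<Rightarrow> 'a::comm_monoid_mult"
  shows "(\<Prod>n<M + k. f n) = (\<Prod>n<M. f n) * (\<Prod>j<k. f (M + j))"
  by (induction k) (auto simp: mult.assoc)

text \<open>The factors are sorted by their index modulo k; along partial products of length
  \<open>N * k\<close> the regrouping is exact.\<close>

lemma qp_split:
  fixes q :: "'a::{real_normed_field,banach}"
  assumes "norm q < 1" "k > 0"
  shows "qp a q = (\<Prod>j<k. qp (a * q ^ j) (q ^ k))"
proof (rule LIMSEQ_unique)
  show "(\<lambda>N. \<Prod>n<N*k. 1 - a * q ^ n) \<longlonglongrightarrow> qp a q"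
    using assms by (intro filterlim_compose[OF tendsto_qp] mult_nat_right_at_top) auto
  have qk: "norm (q ^ k) < 1"
    using assms by (simp add: norm_power power_less_one_iff)
  have "(\<Prod>n<N*k. 1 - a * q ^ n) = (\<Prod>j<k. \<Prod>n<N. 1 - a * q ^ j * (q ^ k) ^ n)" for N
  proof (induction N)
    case (Suc N)
    have "(\<Prod>n<Suc N * k. 1 - a * q ^ n) = (\<Prod>n<N*k + k. 1 - a * q ^ n)"
      by (simp add: algebra_simps)
    also have "\<dots> = (\<Prod>n<N*k. 1 - a * q ^ n) * (\<Prod>j<k. 1 - a * q ^ (N*k + j))"
      by (rule prod_lessThan_add)
    finally show ?case
      by (simp add: Suc prod.distrib power_add power_mult ac_simps)
         (simp add: power_mult[symmetric] mult.commute)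
  qed simp
  then show "(\<lambda>N. \<Prod>n<N*k. 1 - a * q ^ n) \<longlonglongrightarrow> (\<Prod>j<k. qp (a * q ^ j) (q ^ k))"
    by (simp add: tendsto_prod tendsto_qp[OF qk])
qed

lemma qp_mult_minus:
  fixes q :: "'a::{real_normed_field,banach}"
  assumes "norm q < 1"
  shows "qp a q * qp (- a) q = qp (a^2) (q^2)"
proof (rule LIMSEQ_unique)
  have q2: "norm (q ^ 2) < 1"
    using assms by (simp add: norm_power power_less_one_iff)
  show "(\<lambda>N. \<Prod>n<N. 1 - a^2 * (q^2) ^ n) \<longlonglongrightarrow> qp (a^2) (q^2)"
    by (rule tendsto_qp[OF q2])
  have "(\<Prod>n<N. 1 - a^2 * (q^2) ^ n) = (\<Prod>n<N. 1 - a * q ^ n) * (\<Prod>n<N. 1 - (-a) * q ^ n)" for N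
    unfolding prod.distrib[symmetric]
    by (intro prod.cong) (auto simp: power2_eq_square power_mult_distrib algebra_simps)
  then show "(\<lambda>N. \<Prod>n<N. 1 - a^2 * (q^2) ^ n) \<longlonglongrightarrow> qp a q * qp (- a) q"
    using tendsto_mult[OF tendsto_qp[OF assms, of a] tendsto_qp[OF assms, of "- a"]] by simp
qed

section \<open>The Jacobi triple product\<close>

text \<open>Integer argument, natural value: n(n+1)/2 is nonnegative for negative n too, so theta
  terms are defined without inverting either parameter.\<close>

definition tri :: "int \<Rightarrow> nat" where
  "tri n = nat (n * (n + 1) div 2)"

lemma tri_int: "int (tri n) = n * (n + 1) div 2"
proof -
  have "n * (n + 1) \<ge> 0"
    by (cases "n \<ge> 0") (auto simp: zero_le_mult_iff)
  then show ?thesis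
    unfolding tri_def by (intro nat_0_le) (simp add: pos_imp_zdiv_nonneg_iff)
qed

lemma tri_double: "2 * int (tri n) = n * (n + 1)"
proof -
  have "even (n * (n + 1))" by auto
  then show ?thesis unfolding tri_int by (rule dvd_mult_div_cancel)
qed

lemma tri_eqI: "2 * int m = 2 * int n \<Longrightarrow> m = n"
  by simp

lemma tri_0 [simp]: "tri 0 = 0" "tri (-1) = 0"
  by (simp_all add: tri_def)

lemma tri_step: "k \<le> int m \<Longrightarrow> tri (k + 1) + nat (int m - k) = tri k + m + 1"
proof -
  assume "k \<le> int m"
  then have "2 * int (tri (k + 1) + nat (int m - k)) = 2 * int (tri k + m + 1)"
    using tri_double[of k] tri_double[of "k + 1"] by (simp add: algebra_simps)
  then show ?thesis by (rule tri_eqI)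
qed

lemma tri_minus: "tri (- n) = tri (n - 1)"
proof -
  have "2 * int (tri (- n)) = 2 * int (tri (n - 1))"
    unfolding tri_double by (simp add: algebra_simps)
  then show ?thesis by (rule tri_eqI)
qed

definition theta_term :: "'a::{real_normed_field,banach} \<Rightarrow> 'a \<Rightarrow> int \<Rightarrow> 'a" where
  "theta_term a b n = a ^ tri n * b ^ tri (n - 1)"

text \<open>Ramanujan's general theta function \<open>f(a,b)\<close>.\<close>

definition theta :: "'a::{real_normed_field,banach} \<Rightarrow> 'a \<Rightarrow> 'a" where
  "theta a b = (\<Sum>\<^sub>\<infinity>n. theta_term a b n)"

lemma theta_term_minus: "theta_term a b (- n) = theta_term b a n"
proof -
  have "tri (- n - 1) = tri n"
    using tri_minus[of "n + 1"] by simp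
  then show ?thesis
    by (simp add: theta_term_def tri_minus mult.commute)
qed

lemma theta_commute: "theta a b = theta b a"
  unfolding theta_def
  by (rule infsum_reindex_bij_witness[of _ uminus uminus]) (auto simp: theta_term_minus)

text \<open>The ratio of the terms at \<open>k + 1\<close> and \<open>k\<close> is
  \<open>a * (a * b) ^ k\<close> with an integer exponent; the extra power of \<open>a * b\<close>
  keeps all exponents natural.\<close>

lemma theta_term_up:
  assumes "k \<le> int m"
  shows "a * (a * b) ^ m * theta_term a b k = (a * b) ^ nat (int m - k) * theta_term a b (k + 1)"
proof -
  have 1: "tri (k + 1) + nat (int m - k) = tri k + m + 1"
    by (rule tri_step[OF assms])
  have "2 * int (tri k + nat (int m - k)) = 2 * int (tri (k - 1) + m)"
    using assms tri_double[of k] tri_double[of "k - 1"] by (simp add: algebra_simps)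
  then have 2: "tri k + nat (int m - k) = tri (k - 1) + m"
    by (rule tri_eqI)
  have "a * (a * b) ^ m * theta_term a b k = a ^ (tri k + m + 1) * b ^ (tri (k - 1) + m)"
    by (simp add: theta_term_def power_mult_distrib power_add)
  also have "\<dots> = a ^ (tri (k + 1) + nat (int m - k)) * b ^ (tri k + nat (int m - k))"
    by (simp only: 1 2)
  also have "\<dots> = (a * b) ^ nat (int m - k) * theta_term a b (k + 1)"
    by (simp add: theta_term_def power_mult_distrib power_add)
  finally show ?thesis .
qed

lemma theta_term_down:
  assumes "- k \<le> int n"
  shows "b * (a * b) ^ n * theta_term a b k = (a * b) ^ nat (int n + k) * theta_term a b (k - 1)"
  using theta_term_up[of "- k" n b a] assms
  by (simp add: theta_term_minus mult.commute[of b a])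
     (metis add.commute minus_diff_eq theta_term_minus uminus_add_conv_diff)

section \<open>Gaussian binomials and the finite triple product\<close>

context
  fixes Q :: "'a::{real_normed_field,banach}"
  assumes Q: "norm Q < 1"
begin

text \<open>The q-Pochhammer symbol (Q;Q)_n. The quotient \<open>gbinom\<close> is the Gaussian
  binomial coefficient; |Q| < 1 keeps its denominators nonzero.\<close>

definition poch :: "nat \<Rightarrow> 'a" where
  "poch n = (\<Prod>i<n. 1 - Q * Q ^ i)"

definition gbinom :: "nat \<Rightarrow> nat \<Rightarrow> 'a" where
  "gbinom n k = (if k \<le> n then poch n / (poch k * poch (n - k)) else 0)"

lemma poch_nonzero: "poch n \<noteq> 0"
proof -
  have "Q * Q ^ i \<noteq> 1" for i
    using Q power_less_one_iff[of "norm Q" "Suc i"] norm_power[of Q "Suc i"] by auto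
  then show ?thesis by (auto simp: poch_def)
qed

lemma gbinom_0 [simp]: "gbinom n 0 = 1"
  by (simp add: gbinom_def poch_nonzero) (simp add: poch_def)

lemma gbinom_Suc_Suc:
  assumes "k \<le> n"
  shows "gbinom (Suc n) (Suc k) = gbinom n (Suc k) + Q ^ (n - k) * gbinom n k"
    and "gbinom (Suc n) (Suc k) = Q ^ Suc k * gbinom n (Suc k) + gbinom n k"
proof -
  have P: "poch (Suc j) = poch j * (1 - Q * Q ^ j)" for j
    by (simp add: poch_def)
  have nz: "1 - Q * Q ^ j \<noteq> 0" for j
    using poch_nonzero[of "Suc j"] by (auto simp: P)
  have "gbinom (Suc n) (Suc k) = gbinom n (Suc k) + Q ^ (n - k) * gbinom n k \<and>
    gbinom (Suc n) (Suc k) = Q ^ Suc k * gbinom n (Suc k) + gbinom n k"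
  proof (cases "k = n")
    case True
    then show ?thesis by (simp add: gbinom_def poch_nonzero poch_def[of 0])
  next
    case False
    with assms obtain d where n: "n = Suc (k + d)"
      by (metis le_neq_implies_less less_imp_Suc_add)
    have e: "gbinom n k = poch n / (poch k * (poch d * (1 - Q * Q ^ d)))"
      "gbinom n (Suc k) = poch n / (poch k * (1 - Q * Q ^ k) * poch d)"
      "gbinom (Suc n) (Suc k) = poch n * (1 - Q * Q ^ n) / (poch k * (1 - Q * Q ^ k) * (poch d * (1 - Q * Q ^ d)))"
      by (simp_all add: gbinom_def n P)
    show ?thesis unfolding e using poch_nonzero[of k] poch_nonzero[of d] nz[of k] nz[of d]
      by (simp add: n divide_simps) (simp add: power_add algebra_simps)
  qed
  then show "gbinom (Suc n) (Suc k) = gbinom n (Suc k) + Q ^ (n - k) * gbinom n k"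
    and "gbinom (Suc n) (Suc k) = Q ^ Suc k * gbinom n (Suc k) + gbinom n k" by auto
qed

text \<open>Summed forms of the two q-Pascal rules: the first fits the factor
  \<open>1 + a * Q ^ m\<close> of the finite triple product, the second the factor
  \<open>1 + b * Q ^ n\<close>.\<close>

lemma sum_gbinom_Suc:
  "(\<Sum>j\<le>Suc n. gbinom (Suc n) j * u j) = (\<Sum>j\<le>n. gbinom n j * (u j + Q ^ (n - j) * u (Suc j)))"
  "(\<Sum>j\<le>Suc n. gbinom (Suc n) j * u j) = (\<Sum>j\<le>n. gbinom n j * (Q ^ j * u j + u (Suc j)))"
proof -
  have z: "gbinom n (Suc n) = 0" by (simp add: gbinom_def)
  have "(\<Sum>j\<le>Suc n. gbinom (Suc n) j * u j) = u 0 + (\<Sum>j\<le>n. gbinom (Suc n) (Suc j) * u (Suc j))"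
    by (simp add: sum.atMost_Suc_shift del: sum.atMost_Suc)
  also have "\<dots> = u 0 + (\<Sum>j\<le>n. gbinom n (Suc j) * u (Suc j)) + (\<Sum>j\<le>n. Q ^ (n - j) * gbinom n j * u (Suc j))"
    by (simp add: gbinom_Suc_Suc(1) distrib_right sum.distrib)
  also have "u 0 + (\<Sum>j\<le>n. gbinom n (Suc j) * u (Suc j)) = (\<Sum>j\<le>Suc n. gbinom n j * u j)"
    by (simp add: sum.atMost_Suc_shift del: sum.atMost_Suc)
  finally show "(\<Sum>j\<le>Suc n. gbinom (Suc n) j * u j) = (\<Sum>j\<le>n. gbinom n j * (u j + Q ^ (n - j) * u (Suc j)))"
    by (simp add: z distrib_left sum.distrib ac_simps)
  have "(\<Sum>j\<le>Suc n. gbinom (Suc n) j * u j) = u 0 + (\<Sum>j\<le>n. gbinom (Suc n) (Suc j) * u (Suc j))"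
    by (simp add: sum.atMost_Suc_shift del: sum.atMost_Suc)
  also have "\<dots> = u 0 + (\<Sum>j\<le>n. gbinom n (Suc j) * (Q ^ Suc j * u (Suc j))) + (\<Sum>j\<le>n. gbinom n j * u (Suc j))"
    by (simp add: gbinom_Suc_Suc(2) distrib_right distrib_left sum.distrib ac_simps)
  also have "u 0 + (\<Sum>j\<le>n. gbinom n (Suc j) * (Q ^ Suc j * u (Suc j))) = (\<Sum>j\<le>Suc n. gbinom n j * (Q ^ j * u j))"
    by (simp add: sum.atMost_Suc_shift del: sum.atMost_Suc power_Suc)
  finally show "(\<Sum>j\<le>Suc n. gbinom (Suc n) j * u j) = (\<Sum>j\<le>n. gbinom n j * (Q ^ j * u j + u (Suc j)))"
    by (simp add: z distrib_left sum.distrib)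
qed

text \<open>Cauchy's finite form of the triple product. The two kinds of factors are added by
  separate inductions, since each needs its own q-Pascal rule; the sums then agree term by
  term.\<close>

lemma finite_triple_product:
  assumes "a * b = Q"
  shows "(\<Prod>i<n. 1 + b * Q ^ i) * (\<Prod>i<m. 1 + a * Q ^ i) =
    (\<Sum>j\<le>n + m. gbinom (n + m) j * theta_term a b (int j - int n))"
proof (induction m)
  case 0
  show ?case
  proof (induction n)
    case 0
    then show ?case by (simp add: theta_term_def)
  next
    case (Suc n)
    have "(\<Sum>j\<le>Suc n. gbinom (Suc n) j * theta_term a b (int j - int (Suc n)))
      = (\<Sum>j\<le>n. gbinom n j * (Q ^ j * theta_term a b (int j - int (Suc n)) + theta_term a b (int j - int n)))"
      by (simp only: sum_gbinom_Suc(2)) (simp add: algebra_simps)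
    also have "\<dots> = (\<Sum>j\<le>n. gbinom n j * theta_term a b (int j - int n)) * (1 + b * Q ^ n)"
      unfolding sum_distrib_right
    proof (intro sum.cong refl)
      fix j assume "j \<in> {..n}"
      with theta_term_down[of "int j - int n" n b a] assms
      have "Q ^ j * theta_term a b (int j - int (Suc n)) = b * Q ^ n * theta_term a b (int j - int n)"
        by (simp add: algebra_simps)
      then show "gbinom n j * (Q ^ j * theta_term a b (int j - int (Suc n)) + theta_term a b (int j - int n)) =
        gbinom n j * theta_term a b (int j - int n) * (1 + b * Q ^ n)"
        by (simp add: algebra_simps)
    qed
    finally show ?case using Suc by simp
  qed
next
  case (Suc m)
  have "(\<Sum>j\<le>n + Suc m. gbinom (n + Suc m) j * theta_term a b (int j - int n))
      = (\<Sum>j\<le>n + m. gbinom (n + m) j * (theta_term a b (int j - int n) + Q ^ (n + m - j) * theta_term a b (int j - int n + 1)))"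
    by (simp only: add_Suc_right sum_gbinom_Suc(1)) (simp add: algebra_simps)
  also have "\<dots> = (\<Sum>j\<le>n + m. gbinom (n + m) j * theta_term a b (int j - int n)) * (1 + a * Q ^ m)"
      unfolding sum_distrib_right
  proof (intro sum.cong refl)
    fix j assume j: "j \<in> {..n + m}"
    then have "nat (int m - (int j - int n)) = n + m - j" by auto
    with theta_term_up[of "int j - int n" m a b] assms j
    have "Q ^ (n + m - j) * theta_term a b (int j - int n + 1) = a * Q ^ m * theta_term a b (int j - int n)"
      by (simp add: algebra_simps)
    then show "gbinom (n + m) j * (theta_term a b (int j - int n) + Q ^ (n + m - j) * theta_term a b (int j - int n + 1)) =
        gbinom (n + m) j * theta_term a b (int j - int n) * (1 + a * Q ^ m)"
      by (simp add: algebra_simps)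
  qed
  finally show ?case using Suc by simp
qed

lemma tendsto_poch: "poch \<longlonglongrightarrow> qp Q Q"
  using tendsto_qp[OF Q, of Q] by (simp add: poch_def[abs_def])

lemma qp_self_nonzero: "qp Q Q \<noteq> 0"
  by (rule qp_nonzero'[OF Q Q])

text \<open>Supplies the majorant for the passage to the limit: numerators and inverse denominators
  converge, hence are bounded.\<close>

lemma gbinom_bounded: "\<exists>C. \<forall>n k. norm (gbinom n k) \<le> C"
proof -
  have "Bseq poch"
    using tendsto_poch by (intro convergent_imp_Bseq) (auto simp: convergent_def)
  then obtain B where B: "\<And>n. norm (poch n) \<le> B" and "B > 0"
    by (auto simp: Bseq_def)
  have "Bseq (\<lambda>n. inverse (poch n))"
    using tendsto_inverse[OF tendsto_poch qp_self_nonzero]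
    by (intro convergent_imp_Bseq) (auto simp: convergent_def)
  then obtain D where D: "\<And>n. norm (inverse (poch n)) \<le> D" and "D > 0"
    by (auto simp: Bseq_def)
  have "norm (gbinom n k) \<le> B * (D * D)" for n k
  proof (cases "k \<le> n")
    case True
    have "gbinom n k = poch n * (inverse (poch k) * inverse (poch (n - k)))"
      using True by (simp add: gbinom_def divide_inverse)
    then show ?thesis
      using B[of n] D[of k] D[of "n - k"] \<open>B > 0\<close> \<open>D > 0\<close>
      by (simp only: norm_mult) (intro mult_mono; simp)
  qed (use \<open>B > 0\<close> \<open>D > 0\<close> in \<open>simp add: gbinom_def\<close>)
  then show ?thesis by blast
qed

lemma tendsto_gbinom:
  "(\<lambda>n. gbinom (n + n) (nat (int n + k))) \<longlonglongrightarrow> inverse (qp Q Q)"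
proof -
  have t1: "filterlim (\<lambda>n. nat (int n + k)) at_top sequentially"
    unfolding filterlim_at_top
  proof
    fix Z
    show "\<forall>\<^sub>F n in sequentially. Z \<le> nat (int n + k)"
      by (rule eventually_sequentiallyI[of "Z + nat \<bar>k\<bar>"]) linarith
  qed
  have t2: "filterlim (\<lambda>n. n + n - nat (int n + k)) at_top sequentially"
    unfolding filterlim_at_top
  proof
    fix Z
    show "\<forall>\<^sub>F n in sequentially. Z \<le> n + n - nat (int n + k)"
      by (rule eventually_sequentiallyI[of "Z + nat \<bar>k\<bar>"]) linarith
  qed
  have t3: "filterlim (\<lambda>n::nat. n + n) at_top sequentially"
    unfolding filterlim_at_top
  proof
    fix Z
    show "\<forall>\<^sub>F n in sequentially. Z \<le> n + n"
      by (rule eventually_sequentiallyI[of "Z"]) linarith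
  qed
  note T = filterlim_compose[OF tendsto_poch]
  have "(\<lambda>n. poch (n + n) / (poch (nat (int n + k)) * poch (n + n - nat (int n + k)))) \<longlonglongrightarrow> qp Q Q / (qp Q Q * qp Q Q)"
    by (intro tendsto_intros T t1 t2 t3) (use qp_self_nonzero in auto)
  also have "qp Q Q / (qp Q Q * qp Q Q) = inverse (qp Q Q)"
    using qp_self_nonzero by (simp add: divide_simps)
  finally show ?thesis
  proof (rule Lim_transform_eventually)
    show "\<forall>\<^sub>F n in sequentially. poch (n + n) / (poch (nat (int n + k)) * poch (n + n - nat (int n + k))) = gbinom (n + n) (nat (int n + k))"
      by (rule eventually_sequentiallyI[of "nat \<bar>k\<bar>"]) (auto simp: gbinom_def)
  qed
qed

end

section \<open>Convergence of bilateral theta series and the infinite triple product\<close>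

lemma summable_on_power_int:
  fixes r :: real
  assumes "0 \<le> r" "r < 1"
  shows "(\<lambda>n::int. r ^ (nat \<bar>n\<bar> - 1)) summable_on UNIV"
proof -
  have geo: "(\<lambda>n. r ^ n) summable_on (UNIV :: nat set)"
    using assms by (intro norm_summable_imp_summable_on) (simp add: summable_geometric)
  have s: "(\<lambda>n. r ^ (n - 1)) summable_on (UNIV :: nat set)"
    using assms by (intro norm_summable_imp_summable_on) (subst summable_Suc_iff[symmetric], simp add: summable_geometric)
  have 1: "(\<lambda>n::int. r ^ (nat \<bar>n\<bar> - 1)) summable_on range int"
    by (subst summable_on_reindex) (auto simp: o_def s[simplified])
  have 2: "(\<lambda>n::int. r ^ (nat \<bar>n\<bar> - 1)) summable_on range (\<lambda>n. - int n - 1)"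
  proof (subst summable_on_reindex)
    show "inj (\<lambda>n. - int n - 1)" by (auto intro: injI)
    have "nat \<bar>- int n - 1\<bar> - 1 = n" for n by auto
    then show "(\<lambda>n. r ^ (nat \<bar>n\<bar> - 1)) \<circ> (\<lambda>n. - int n - 1) summable_on UNIV"
      by (simp add: o_def geo)
  qed
  have "x \<in> range int \<union> range (\<lambda>n. - int n - 1)" for x
    by (cases x rule: int_cases) (auto simp: image_iff)
  then have "UNIV = range int \<union> range (\<lambda>n. - int n - 1)"
    by blast
  then show ?thesis
    using summable_on_Un_disjoint[OF 1 2] by fastforce
qed

text \<open>One parameter may have norm 1, so the decay has to come from the product: the smaller of
  the two exponents is |n|(|n| - 1)/2, which is at least |n| - 1. The truncated
  \<open>nat \<bar>n\<bar> - 1\<close> is 0 at n = 0.\<close>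

lemma abs_summable_theta:
  fixes a b :: "'a::{real_normed_field,banach}"
  assumes "norm a \<le> 1" "norm b \<le> 1" "norm (a * b) < 1"
  shows "(\<lambda>n. norm (theta_term a b n)) summable_on UNIV"
proof (rule Infinite_Sum.abs_summable_on_comparison_test'[where g = "\<lambda>n::int. norm (a * b) ^ (nat \<bar>n\<bar> - 1)"])
  show "(\<lambda>n::int. norm (a * b) ^ (nat \<bar>n\<bar> - 1)) summable_on UNIV"
    using assms by (intro summable_on_power_int) auto
  fix n :: int
  define m where "m = min (tri n) (tri (n - 1))"
  have "norm a ^ tri n \<le> norm a ^ m" "norm b ^ tri (n - 1) \<le> norm b ^ m"
    using assms by (auto intro!: power_decreasing simp: m_def)
  then have "norm (theta_term a b n) \<le> norm (a * b) ^ m"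
    unfolding theta_term_def norm_mult norm_power power_mult_distrib by (intro mult_mono) auto
  also have "\<dots> \<le> norm (a * b) ^ (nat \<bar>n\<bar> - 1)"
  proof (rule power_decreasing)
    have "2 * (\<bar>n\<bar> - 1) \<le> \<bar>n\<bar> * (\<bar>n\<bar> - 1)"
    proof (cases "\<bar>n\<bar> \<le> 1")
      case True
      then have "\<bar>n\<bar> = 0 \<or> \<bar>n\<bar> = 1" by linarith
      then show ?thesis by auto
    qed (intro mult_right_mono; linarith)
    moreover have "\<bar>n\<bar> * (\<bar>n\<bar> - 1) \<le> n * (n + 1)" "\<bar>n\<bar> * (\<bar>n\<bar> - 1) \<le> (n - 1) * n"
      by (cases "n \<ge> 0"; simp add: algebra_simps)+
    ultimately have "2 * (\<bar>n\<bar> - 1) \<le> 2 * int (tri n)" "2 * (\<bar>n\<bar> - 1) \<le> 2 * int (tri (n - 1))"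
      unfolding tri_double by auto
    moreover have "nat \<bar>n\<bar> - 1 \<le> l" if "2 * (\<bar>n\<bar> - 1) \<le> 2 * int l" for l
      using that by (simp add: le_diff_conv nat_le_iff)
    ultimately have "nat \<bar>n\<bar> - 1 \<le> tri n" "nat \<bar>n\<bar> - 1 \<le> tri (n - 1)"
      by blast+
    then show "nat \<bar>n\<bar> - 1 \<le> m"
      by (simp add: m_def)
  qed (use assms in auto)
  finally show "norm (theta_term a b n) \<le> norm (a * b) ^ (nat \<bar>n\<bar> - 1)" .
qed

theorem jacobi_triple_product:
  fixes a b :: "'a::{real_normed_field,banach}"
  assumes "norm a \<le> 1" "norm b \<le> 1" "norm (a * b) < 1"
  shows "theta a b = qp (- a) (a * b) * qp (- b) (a * b) * qp (a * b) (a * b)"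
proof -
  define Q where "Q = a * b"
  have Q: "norm Q < 1" using assms by (simp add: Q_def)
  \<comment> \<open>Enumerating the integers by the naturals makes the bilateral sum an ordinary
    series, as Tannery's theorem requires.\<close>
  define t where "t = (\<lambda>j. theta_term a b (int_decode j))"
  have sumt: "summable (\<lambda>j. norm (t j))"
  proof -
    have "(\<lambda>n. norm (theta_term a b n)) summable_on range int_decode"
      using abs_summable_theta[OF assms] by (simp add: surj_int_decode)
    then have "(\<lambda>j. norm (t j)) summable_on UNIV"
      by (subst (asm) summable_on_reindex) (auto simp: o_def t_def inj_int_decode)
    then show ?thesis by (rule summable_on_imp_summable)
  qed
  have theta: "theta a b = suminf t"
  proof -
    have "theta a b = infsum (theta_term a b) (range int_decode)"
      by (simp add: theta_def surj_int_decode)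
    also have "\<dots> = infsum t UNIV"
      by (subst infsum_reindex) (auto simp: o_def t_def inj_int_decode)
    also have "\<dots> = suminf t"
      using norm_summable_imp_has_sum[OF sumt] sumt
      by (metis infsumI summable_norm_cancel summable_sums)
    finally show ?thesis .
  qed
  obtain C where C: "\<And>n k. norm (gbinom Q n k) \<le> C"
    using gbinom_bounded[OF Q] by blast
  have C0: "C \<ge> 0" using C[of 0 0] norm_ge_zero order_trans by blast
  \<comment> \<open>The terms of the finite identity with n factors of each kind, extended by 0 to a
    full series for every n.\<close>
  define A where "A = (\<lambda>j n. if \<bar>int_decode j\<bar> \<le> int n then gbinom Q (n + n) (nat (int n + int_decode j)) * t j else 0)"
  have "(\<lambda>n. suminf (\<lambda>j. A j n)) \<longlonglongrightarrow> suminf (\<lambda>j. inverse (qp Q Q) * t j)"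
  proof (rule tannerys_theorem[THEN conjunct2, THEN conjunct2])
    show "summable (\<lambda>j. C * norm (t j))" by (intro summable_mult sumt)
    have "norm (A j n) \<le> C * norm (t j)" for j n
      using C C0 by (auto simp: A_def norm_mult intro!: mult_right_mono)
    then show "\<forall>\<^sub>F (j, n) in sequentially \<times>\<^sub>F sequentially. norm (A j n) \<le> C * norm (t j)"
      by (intro always_eventually) auto
    fix j
    have "(\<lambda>n. gbinom Q (n + n) (nat (int n + int_decode j)) * t j) \<longlonglongrightarrow> inverse (qp Q Q) * t j"
      by (intro tendsto_intros tendsto_gbinom Q)
    then show "A j \<longlonglongrightarrow> inverse (qp Q Q) * t j"
    proof (rule Lim_transform_eventually)
      show "\<forall>\<^sub>F n in sequentially. gbinom Q (n + n) (nat (int n + int_decode j)) * t j = A j n"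
        by (rule eventually_sequentiallyI[of "nat \<bar>int_decode j\<bar>"]) (auto simp: A_def)
    qed
  qed auto
  moreover have "suminf (\<lambda>j. A j n) = (\<Prod>i<n. 1 - (- b) * Q ^ i) * (\<Prod>i<n. 1 - (- a) * Q ^ i)" for n
  proof -
    define S where "S = int_encode ` {- int n..int n}"
    have "suminf (\<lambda>j. A j n) = (\<Sum>j\<in>S. A j n)"
    proof (rule suminf_finite)
      fix j assume "j \<notin> S"
      then have "int_decode j \<notin> {- int n..int n}"
        unfolding S_def by (metis image_eqI int_decode_inverse)
      then show "A j n = 0" by (auto simp: A_def)
    qed (auto simp: S_def)
    also have "\<dots> = (\<Sum>k\<in>{- int n..int n}. gbinom Q (n + n) (nat (int n + k)) * theta_term a b k)"
      unfolding S_def by (subst sum.reindex) (auto simp: inj_int_encode A_def t_def intro!: sum.cong)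
    also have "\<dots> = (\<Sum>j\<le>n + n. gbinom Q (n + n) j * theta_term a b (int j - int n))"
      by (rule sum.reindex_bij_witness[of _ "\<lambda>j. int j - int n" "\<lambda>k. nat (int n + k)"]) auto
    also have "\<dots> = (\<Prod>i<n. 1 + b * Q ^ i) * (\<Prod>i<n. 1 + a * Q ^ i)"
      by (rule finite_triple_product[OF Q, symmetric]) (simp add: Q_def)
    finally show ?thesis by simp
  qed
  ultimately have "(\<lambda>n. (\<Prod>i<n. 1 - (- b) * Q ^ i) * (\<Prod>i<n. 1 - (- a) * Q ^ i)) \<longlonglongrightarrow> suminf (\<lambda>j. inverse (qp Q Q) * t j)"
    by simp
  moreover have "(\<lambda>n. (\<Prod>i<n. 1 - (- b) * Q ^ i) * (\<Prod>i<n. 1 - (- a) * Q ^ i)) \<longlonglongrightarrow> qp (- b) Q * qp (- a) Q"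
    by (intro tendsto_mult tendsto_qp Q)
  ultimately have "suminf (\<lambda>j. inverse (qp Q Q) * t j) = qp (- b) Q * qp (- a) Q"
    by (rule LIMSEQ_unique)
  also have "suminf (\<lambda>j. inverse (qp Q Q) * t j) = inverse (qp Q Q) * theta a b"
    unfolding theta by (rule suminf_mult[OF summable_norm_cancel[OF sumt]])
  finally show ?thesis
    using qp_self_nonzero[OF Q] by (simp add: field_simps Q_def)
qed

section \<open>Double series over quadratic lattices\<close>

definition expo :: "nat \<Rightarrow> nat \<Rightarrow> int \<Rightarrow> nat" where
  "expo a b n = a * tri n + b * tri (n - 1)"

text \<open>Doubling clears the denominators of the triangular numbers, so equality of exponents
  becomes a polynomial identity over the integers.\<close>

lemma expo_double: "2 * int (expo a b n) = (int a + int b) * (n * n) + (int a - int b) * n"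
proof -
  have "2 * int (expo a b n) = int a * (2 * int (tri n)) + int b * (2 * int (tri (n - 1)))"
    by (simp add: expo_def)
  then show ?thesis
    unfolding tri_double by (simp add: algebra_simps)
qed

definition sg :: "int \<Rightarrow> 'a::ring_1" where
  "sg n = (if even n then 1 else - 1)"

lemma theta_term_power: "theta_term (q ^ a) (q ^ b) n = q ^ expo a b n"
  by (simp add: theta_term_def expo_def power_add power_mult)

text \<open>\<open>tri n + tri (n - 1)\<close> is n^2, which has the parity of n, so the signs of
  the two parameters combine to (-1)^n.\<close>

lemma theta_term_minus_power: "theta_term (- (q ^ a)) (- (q ^ b)) n = sg n * q ^ expo a b n"
proof -
  have "tri n + tri (n - 1) = nat (n * n)"
  proof (rule tri_eqI)
    show "2 * int (tri n + tri (n - 1)) = 2 * int (nat (n * n))"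
      unfolding of_nat_add distrib_left tri_double by (simp add: algebra_simps)
  qed
  then have "even (tri n + tri (n - 1)) \<longleftrightarrow> even n"
    by (simp add: even_nat_iff)
  then have "(-1) ^ tri n * (-1) ^ tri (n - 1) = (sg n :: 'a)"
    unfolding power_add[symmetric] by (simp only: sg_def minus_one_power_iff)
  moreover have "theta_term (- (q ^ a)) (- (q ^ b)) n =
      ((-1) ^ tri n * (-1) ^ tri (n - 1)) * ((q ^ a) ^ tri n * (q ^ b) ^ tri (n - 1))"
    unfolding theta_term_def power_minus[of "q ^ a"] power_minus[of "q ^ b"] by (simp only: mult_ac)
  ultimately show ?thesis
    by (simp only: expo_def power_add power_mult)
qed

lemma pow_eqI: "2 * int m = 2 * int n \<Longrightarrow> q ^ m = q ^ n"
  by simp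

context
  fixes f g :: "int \<Rightarrow> 'a::{real_normed_field,banach}"
  assumes f: "(\<lambda>n. norm (f n)) summable_on UNIV" and g: "(\<lambda>n. norm (g n)) summable_on UNIV"
begin

lemma summable_on_product_int: "(\<lambda>(m, n). f m * g n) summable_on UNIV"
proof -
  have "(\<lambda>(m, n). f m * g n) abs_summable_on (UNIV \<times> UNIV)"
    unfolding Infinite_Sum.abs_summable_on_Sigma_iff
  proof (intro conjI ballI)
    fix x :: int
    show "(\<lambda>y. norm (case (x, y) of (m, n) \<Rightarrow> f m * g n)) summable_on UNIV"
      using summable_on_cmult_right[OF g, of "norm (f x)"] by (simp add: norm_mult)
    show "(\<lambda>x. norm (\<Sum>\<^sub>\<infinity>y. norm (case (x, y) of (m, n) \<Rightarrow> f m * g n))) summable_on UNIV"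
      using summable_on_cmult_left[OF f, of "\<Sum>\<^sub>\<infinity>y. norm (g y)"]
      by (simp add: norm_mult infsum_cmult_right' abs_mult infsum_nonneg)
  qed
  then show ?thesis
    by (simp add: abs_summable_summable)
qed

lemma infsum_product_int: "(\<Sum>\<^sub>\<infinity>(m, n). f m * g n) = infsum f UNIV * infsum g UNIV"
proof -
  have "(\<Sum>\<^sub>\<infinity>(m, n)\<in>UNIV \<times> UNIV. f m * g n) = (\<Sum>\<^sub>\<infinity>m. \<Sum>\<^sub>\<infinity>n. f m * g n)"
    using summable_on_product_int by (intro infsum_Sigma'_banach[symmetric]) simp
  then show ?thesis
    by (simp add: infsum_cmult_right' infsum_cmult_left')
qed

end

lemma infsum_partition:
  fixes G :: "'i \<Rightarrow> 'a::banach"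
  assumes "finite E" "bij_betw (\<lambda>(e, p). h e p) (E \<times> UNIV) UNIV" "G summable_on UNIV"
  shows "infsum G UNIV = (\<Sum>e\<in>E. \<Sum>\<^sub>\<infinity>p. G (h e p))"
proof -
  have "(\<lambda>x. G (case x of (e, p) \<Rightarrow> h e p)) summable_on (E \<times> UNIV)"
    using assms(2,3) summable_on_reindex_bij_betw by blast
  then have s: "(\<lambda>(e, p). G (h e p)) summable_on (E \<times> UNIV)"
    by (simp add: case_prod_unfold)
  have "infsum G UNIV = (\<Sum>\<^sub>\<infinity>x\<in>E \<times> UNIV. G (case x of (e, p) \<Rightarrow> h e p))"
    using infsum_reindex_bij_betw[OF assms(2), of G] by simp
  also have "\<dots> = (\<Sum>\<^sub>\<infinity>(e, p)\<in>E \<times> UNIV. G (h e p))"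
    by (simp add: case_prod_unfold)
  also have "\<dots> = (\<Sum>e\<in>E. \<Sum>\<^sub>\<infinity>p. G (h e p))"
    using infsum_Sigma'_banach[OF s] assms(1) by simp
  finally show ?thesis .
qed

text \<open>E may be any complete residue system: representatives near 0, such as -1 and -2 modulo
  5, keep the exponents of the resulting theta series natural.\<close>

lemma infsum_residues:
  fixes G :: "int \<Rightarrow> 'a::banach"
  assumes "k > 0" "bij_betw (\<lambda>r. r mod k) E {0..<k}" "G summable_on UNIV"
  shows "infsum G UNIV = (\<Sum>r\<in>E. \<Sum>\<^sub>\<infinity>j. G (k * j + r))"
proof (rule infsum_partition[OF _ _ assms(3)])
  show "finite E"
    using bij_betw_finite[OF assms(2)] by simp
  let ?i = "inv_into E (\<lambda>r. r mod k)"
  have i: "?i (x mod k) \<in> E" "?i (x mod k) mod k = x mod k" for x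
    using assms(1) bij_betw_imp_surj_on[OF assms(2)]
    by (auto intro!: inv_into_into f_inv_into_f simp: image_iff)
  have i': "?i (r mod k) = r" if "r \<in> E" for r
    using that assms(2) by (intro inv_into_f_f) (auto simp: bij_betw_def)
  show "bij_betw (\<lambda>(r, j). k * j + r) (E \<times> UNIV) UNIV"
  proof (rule bij_betw_byWitness[where f' = "\<lambda>x. (?i (x mod k), (x - ?i (x mod k)) div k)"])
    show "\<forall>a\<in>E \<times> UNIV. (\<lambda>x. (?i (x mod k), (x - ?i (x mod k)) div k)) ((\<lambda>(r, j). k * j + r) a) = a"
      using assms(1) by (auto simp: i')
    show "\<forall>x\<in>UNIV. (\<lambda>(r, j). k * j + r) (?i (x mod k), (x - ?i (x mod k)) div k) = x"
    proof
      fix x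
      have "k dvd x - ?i (x mod k)"
        using i(2)[of x] by (simp flip: mod_eq_dvd_iff)
      then show "(\<lambda>(r, j). k * j + r) (?i (x mod k), (x - ?i (x mod k)) div k) = x"
        by simp
    qed
  qed (use i in auto)
qed

text \<open>The form \<open>l\<close> modulo k identifies the quotient of Z^2 by the range of \<Phi>
  with Z/k; hence E represents every coset once as soon as \<open>l\<close> takes every residue once
  on it.\<close>

lemma infsum_lattice:
  fixes G :: "int \<times> int \<Rightarrow> 'a::banach" and \<Phi> :: "int \<times> int \<Rightarrow> int \<times> int" and l :: "int \<times> int \<Rightarrow> int"
  assumes k: "bij_betw (\<lambda>r. l r mod k) E {0..<k}" "k > 0" "G summable_on UNIV"
  assumes lin: "\<And>p q. l (p - q) = l p - l q" "inj \<Phi>" "range \<Phi> = {p. k dvd l p}"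
  shows "infsum G UNIV = (\<Sum>r\<in>E. \<Sum>\<^sub>\<infinity>p. G (\<Phi> p + r))"
proof (rule infsum_partition[OF _ _ assms(3)])
  show "finite E"
    using bij_betw_finite[OF assms(1)] by simp
  show "bij_betw (\<lambda>(r, p). \<Phi> p + r) (E \<times> UNIV) UNIV"
    unfolding bij_betw_def
  proof (intro conjI inj_onI set_eqI iffI UNIV_I)
    fix a b assume ab: "a \<in> E \<times> UNIV" "b \<in> E \<times> UNIV" "(case a of (r, p) \<Rightarrow> \<Phi> p + r) = (case b of (r, p) \<Rightarrow> \<Phi> p + r)"
    obtain r p r' p' where e: "a = (r, p)" "b = (r', p')" by (cases a, cases b)
    have eq: "\<Phi> p + r = \<Phi> p' + r'" using ab e by simp
    have "k dvd l (\<Phi> p)" "k dvd l (\<Phi> p')" using lin(3) by auto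
    moreover have "r - r' = \<Phi> p' - \<Phi> p"
      using eq by (simp add: algebra_simps)
    then have "l r - l r' = l (\<Phi> p') - l (\<Phi> p)"
      by (simp flip: lin(1))
    ultimately have "k dvd l r - l r'" by simp
    then have "l r mod k = l r' mod k" by (simp add: mod_eq_dvd_iff)
    then have "r = r'" using k(1) ab e by (auto simp: bij_betw_def inj_on_def)
    then show "a = b" using eq e injD[OF lin(2), of p p'] by simp
  next
    fix x :: "int \<times> int"
    have "l x mod k \<in> (\<lambda>r. l r mod k) ` E"
      using k(2) by (simp add: bij_betw_imp_surj_on[OF k(1)])
    then obtain r where r: "r \<in> E" "l x mod k = l r mod k"
      by (elim imageE)
    have "k dvd l (x - r)"
      using r(2) by (simp add: lin(1) mod_eq_dvd_iff)
    then have "x - r \<in> range \<Phi>" by (simp add: lin(3))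
    then obtain p where "x - r = \<Phi> p" by (elim imageE)
    then have "x = \<Phi> p + r" by (simp add: algebra_simps)
    then show "x \<in> (\<lambda>(r, p). \<Phi> p + r) ` (E \<times> UNIV)"
      using r(1) by (intro image_eqI[of _ _ "(r, p)"]) auto
  qed
qed

text \<open>On m + ni the map is multiplication by 2 - i, which multiplies the norm by 5.\<close>

lemma infsum_lattice_5:
  fixes G :: "int \<times> int \<Rightarrow> 'a::banach"
  assumes "bij_betw (\<lambda>(u, v). (u + 2 * v) mod 5) E {0..<5}" "G summable_on UNIV"
  shows "infsum G UNIV = (\<Sum>(u, v)\<in>E. \<Sum>\<^sub>\<infinity>(m, n). G (2 * m + n + u, 2 * n - m + v))"
proof -
  have "infsum G UNIV = (\<Sum>r\<in>E. \<Sum>\<^sub>\<infinity>p. G ((\<lambda>(m, n). (2 * m + n, 2 * n - m)) p + r))"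
  proof (rule infsum_lattice[where k = 5 and l = "\<lambda>(x, y). x + 2 * y"])
    show "range (\<lambda>(m, n). (2 * m + n, 2 * n - m)) = {p. (5::int) dvd (case p of (x, y) \<Rightarrow> x + 2 * y)}"
    proof (intro set_eqI iffI)
      fix p :: "int \<times> int"
      assume "p \<in> {p. (5::int) dvd (case p of (x, y) \<Rightarrow> x + 2 * y)}"
      then obtain x y where p: "p = (x, y)" "5 dvd x + 2 * y"
        by (cases p) simp
      then obtain n where "x + 2 * y = 5 * n"
        by (elim dvdE)
      with p show "p \<in> range (\<lambda>(m, n). (2 * m + n, 2 * n - m))"
        by (intro image_eqI[of _ _ "(2 * n - y, n)"]) auto
    next
      fix p :: "int \<times> int"
      assume "p \<in> range (\<lambda>(m, n). (2 * m + n, 2 * n - m))"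
      then obtain m n where "p = (2 * m + n, 2 * n - m)"
        by auto
      then show "p \<in> {p. (5::int) dvd (case p of (x, y) \<Rightarrow> x + 2 * y)}"
        by (auto intro!: dvdI[of _ _ n])
    qed
    show "inj (\<lambda>(m :: int, n). (2 * m + n, 2 * n - m))"
      by (rule injI) (auto split: prod.splits)
    show "(case p - q of (x, y) \<Rightarrow> x + 2 * y) = (case p of (x, y) \<Rightarrow> x + 2 * y) - (case q of (x, y) \<Rightarrow> x + 2 * y)"
      for p q :: "int \<times> int"
      by (cases p; cases q) simp
    show "bij_betw (\<lambda>r. (case r of (x, y) \<Rightarrow> x + 2 * y) mod 5) E {0..<5}"
      using assms(1) by (simp add: case_prod_unfold)
  qed (use assms in simp_all)
  then show ?thesis
    by (simp add: case_prod_unfold plus_prod_def)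
qed

text \<open>The map multiplies s - t sqrt(-2) by 1 + sqrt(-2), an element of norm 3.\<close>

lemma infsum_lattice_3:
  fixes G :: "int \<times> int \<Rightarrow> 'a::banach"
  assumes "bij_betw (\<lambda>(u, v). (u - v) mod 3) E {0..<3}" "G summable_on UNIV"
  shows "infsum G UNIV = (\<Sum>(u, v)\<in>E. \<Sum>\<^sub>\<infinity>(s, t). G (s + 2 * t + u, s - t + v))"
proof -
  have "infsum G UNIV = (\<Sum>r\<in>E. \<Sum>\<^sub>\<infinity>p. G ((\<lambda>(s, t). (s + 2 * t, s - t)) p + r))"
  proof (rule infsum_lattice[where k = 3 and l = "\<lambda>(x, y). x - y"])
    show "range (\<lambda>(s, t). (s + 2 * t, s - t)) = {p. (3::int) dvd (case p of (x, y) \<Rightarrow> x - y)}"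
    proof (intro set_eqI iffI)
      fix p :: "int \<times> int"
      assume "p \<in> {p. (3::int) dvd (case p of (x, y) \<Rightarrow> x - y)}"
      then obtain x y where p: "p = (x, y)" "3 dvd x - y"
        by (cases p) simp
      then obtain n where "x - y = 3 * n"
        by (elim dvdE)
      with p show "p \<in> range (\<lambda>(s, t). (s + 2 * t, s - t))"
        by (intro image_eqI[of _ _ "(y + n, n)"]) auto
    next
      fix p :: "int \<times> int"
      assume "p \<in> range (\<lambda>(s, t). (s + 2 * t, s - t))"
      then obtain s t where "p = (s + 2 * t, s - t)"
        by auto
      then show "p \<in> {p. (3::int) dvd (case p of (x, y) \<Rightarrow> x - y)}"
        by (auto intro!: dvdI[of _ _ t])
    qed
    show "inj (\<lambda>(s :: int, t). (s + 2 * t, s - t))"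
      by (rule injI) (auto split: prod.splits)
    show "(case p - q of (x, y) \<Rightarrow> x - y) = (case p of (x, y) \<Rightarrow> x - y) - (case q of (x, y) \<Rightarrow> x - y)"
      for p q :: "int \<times> int"
      by (cases p; cases q) simp
    show "bij_betw (\<lambda>r. (case r of (x, y) \<Rightarrow> x - y) mod 3) E {0..<3}"
      using assms(1) by (simp add: case_prod_unfold)
  qed (use assms in simp_all)
  then show ?thesis
    by (simp add: case_prod_unfold plus_prod_def)
qed

text \<open>The map multiplies m - ni by 1 + i; the two cosets are given by the parity of x -
  y.\<close>

lemma infsum_lattice_2:
  fixes G :: "int \<times> int \<Rightarrow> 'a::banach"
  assumes "G summable_on UNIV"
  shows "infsum G UNIV = (\<Sum>\<^sub>\<infinity>(m, n). G (m + n, m - n)) + (\<Sum>\<^sub>\<infinity>(m, n). G (m + n + 1, m - n))"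
proof -
  have "infsum G UNIV = (\<Sum>r\<in>{(0, 0), (1, 0)}. \<Sum>\<^sub>\<infinity>p. G ((\<lambda>(m, n). (m + n, m - n)) p + r))"
  proof (rule infsum_lattice[where k = 2 and l = "\<lambda>(x, y). x - y"])
    show "range (\<lambda>(m, n). (m + n, m - n)) = {p. (2::int) dvd (case p of (x, y) \<Rightarrow> x - y)}"
    proof (intro set_eqI iffI)
      fix p :: "int \<times> int"
      assume "p \<in> {p. (2::int) dvd (case p of (x, y) \<Rightarrow> x - y)}"
      then obtain x y where p: "p = (x, y)" "2 dvd x - y"
        by (cases p) simp
      then obtain n where "x - y = 2 * n"
        by (elim dvdE)
      with p show "p \<in> range (\<lambda>(m, n). (m + n, m - n))"
        by (intro image_eqI[of _ _ "(y + n, n)"]) auto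
    next
      fix p :: "int \<times> int"
      assume "p \<in> range (\<lambda>(m, n). (m + n, m - n))"
      then obtain m n where "p = (m + n, m - n)"
        by auto
      then show "p \<in> {p. (2::int) dvd (case p of (x, y) \<Rightarrow> x - y)}"
        by (auto intro!: dvdI[of _ _ n])
    qed
    show "bij_betw (\<lambda>r. (case r of (x, y) \<Rightarrow> x - y) mod 2) {(0, 0), (1, 0)} {0..<2 :: int}"
      by (auto simp: bij_betw_def)
    show "inj (\<lambda>(m :: int, n). (m + n, m - n))"
      by (rule injI) (auto split: prod.splits)
    show "(case p - q of (x, y) \<Rightarrow> x - y) = (case p of (x, y) \<Rightarrow> x - y) - (case q of (x, y) \<Rightarrow> x - y)"
      for p q :: "int \<times> int"
      by (cases p; cases q) simp
  qed (use assms in simp_all)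
  then show ?thesis
    by (simp add: case_prod_unfold plus_prod_def)
qed

section \<open>Theta function identities\<close>

context
  fixes q :: "'a::{real_normed_field,banach}"
  assumes q: "norm q < 1"
begin

lemma summable_theta_power:
  assumes "a + b > 0"
  shows "(\<lambda>n. norm (theta_term (q ^ a) (q ^ b) n)) summable_on UNIV"
    and "(\<lambda>n. norm (theta_term (- (q ^ a)) (- (q ^ b)) n)) summable_on UNIV"
  using q assms
  by (auto intro!: abs_summable_theta simp: norm_mult norm_power power_le_one power_less_one_iff
      simp flip: power_add)

lemma infsum_theta_product:
  assumes "a + b > 0" "c + d > 0"
  shows "(\<Sum>\<^sub>\<infinity>(m, n). z * (theta_term (q ^ a) (q ^ b) m * theta_term (q ^ c) (q ^ d) n)) =
      z * (theta (q ^ a) (q ^ b) * theta (q ^ c) (q ^ d))"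
    and "(\<Sum>\<^sub>\<infinity>(m, n). z * (theta_term (- (q ^ a)) (- (q ^ b)) m * theta_term (- (q ^ c)) (- (q ^ d)) n)) =
      z * (theta (- (q ^ a)) (- (q ^ b)) * theta (- (q ^ c)) (- (q ^ d)))"
  unfolding case_prod_unfold infsum_cmult_right' theta_def
  using assms by (simp_all add: infsum_product_int[unfolded case_prod_unfold] summable_theta_power)

lemma theta_product_expand:
  assumes "a + b > 0" "c + d > 0"
  defines "G \<equiv> \<lambda>(x, y). theta_term (q ^ a) (q ^ b) x * theta_term (q ^ c) (q ^ d) y"
  shows "G summable_on UNIV" "theta (q ^ a) (q ^ b) * theta (q ^ c) (q ^ d) = infsum G UNIV"
  using assms by (simp_all add: G_def theta_def infsum_product_int summable_on_product_int summable_theta_power)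

lemma theta_product_expand':
  assumes "a + b > 0" "c + d > 0"
  defines "G \<equiv> \<lambda>(x, y). theta_term (q ^ a) (q ^ b) x * theta_term (- (q ^ c)) (- (q ^ d)) y"
  shows "G summable_on UNIV" "theta (q ^ a) (q ^ b) * theta (- (q ^ c)) (- (q ^ d)) = infsum G UNIV"
  using assms by (simp_all add: G_def theta_def infsum_product_int summable_on_product_int summable_theta_power)

end

lemma qp_one:
  fixes q :: "'a::{real_normed_field,banach}"
  assumes "norm q < 1"
  shows "qp 1 q = 0"
proof (rule LIMSEQ_unique[OF tendsto_qp[OF assms]])
  have "(\<Prod>n<N. 1 - 1 * q ^ n) = 0" if "N \<ge> 1" for N
    by (rule prod_zero) (use that in \<open>auto intro!: bexI[of _ 0]\<close>)
  then show "(\<lambda>N. \<Prod>n<N. 1 - 1 * q ^ n) \<longlonglongrightarrow> 0"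
    by (intro tendsto_eventually eventually_sequentiallyI[of 1])
qed

text \<open>The certificate used for every coset sum: in the new variables the doubled exponent has
  no mixed term, so the power of q separates into a constant power and two theta terms.\<close>

lemma expo_piece:
  fixes q :: "'a::comm_monoid_mult"
  assumes "(int a + int b) * (x * x) + (int a - int b) * x + ((int c + int d) * (y * y) + (int c - int d) * y)
    = 2 * int k + ((int a' + int b') * (m * m) + (int a' - int b') * m + ((int c' + int d') * (n * n) + (int c' - int d') * n))"
  shows "q ^ expo a b x * q ^ expo c d y = q ^ k * (q ^ expo a' b' m * q ^ expo c' d' n)"
  unfolding power_add[symmetric]
  by (rule pow_eqI) (simp only: of_nat_add distrib_left expo_double assms)

lemma expo_single:
  fixes q :: "'a::comm_monoid_mult"
  assumes "(int a + int b) * (x * x) + (int a - int b) * x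
    = 2 * int k + ((int a' + int b') * (m * m) + (int a' - int b') * m)"
  shows "q ^ expo a b x = q ^ k * q ^ expo a' b' m"
  unfolding power_add[symmetric]
  by (rule pow_eqI) (simp only: of_nat_add distrib_left expo_double assms)

lemma upto_residues: "{0..<2::int} = {0, 1}" "{0..<3::int} = {0, 1, 2}" "{0..<5::int} = {0, 1, 2, 3, 4}"
  by auto

context
  fixes q :: "'a::{real_normed_field,banach}"
  assumes q: "norm q < 1"
begin

text \<open>The sum of \<open>q\<^sup>N\<^sup>(\<^sup>z\<^sup>)\<close> over the Gaussian integers \<open>z\<close> is split by writing \<open>z\<close> as a multiple of \<open>2 - i\<close>
  plus one of five residues: residue 0 gives the summand with \<open>q\<^sup>5\<close>, the units give four equal products.\<close>

lemma theta_phi_5: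
  "theta (q ^ 1) (q ^ 1) ^ 2 = theta (q ^ 5) (q ^ 5) ^ 2 + 4 * q * (theta (q ^ 1) (q ^ 9) * theta (q ^ 3) (q ^ 7))"
proof -
  let ?G = "\<lambda>(x, y). theta_term (q ^ 1) (q ^ 1) x * theta_term (q ^ 1) (q ^ 1) y"
  let ?E = "{(0, 0), (1, 0), (-1, 0), (0, 1), (0, -1)} :: (int \<times> int) set"
  have bij: "bij_betw (\<lambda>(u, v). (u + 2 * v) mod 5) ?E {0..<5}"
    unfolding upto_residues by (auto simp: bij_betw_def)
  define H where "H = (\<lambda>u v. \<Sum>\<^sub>\<infinity>(m, n). ?G (2 * m + n + u, 2 * n - m + v))"
  have "theta (q ^ 1) (q ^ 1) ^ 2 = infsum ?G UNIV"
    unfolding power2_eq_square by (rule theta_product_expand(2)[OF q]) auto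
  also have "\<dots> = (\<Sum>(u, v)\<in>?E. H u v)"
    unfolding H_def by (rule infsum_lattice_5[OF bij theta_product_expand(1)[OF q]]) auto
  also have "\<dots> = H 0 0 + H 1 0 + H (-1) 0 + H 0 1 + H 0 (-1)"
    by (simp add: add.assoc)
  also have "\<dots> = (\<Sum>\<^sub>\<infinity>(m, n). q ^ 0 * (theta_term (q ^ 5) (q ^ 5) m * theta_term (q ^ 5) (q ^ 5) n))
    + (\<Sum>\<^sub>\<infinity>(m, n). q ^ 1 * (theta_term (q ^ 9) (q ^ 1) m * theta_term (q ^ 7) (q ^ 3) n))
    + (\<Sum>\<^sub>\<infinity>(m, n). q ^ 1 * (theta_term (q ^ 1) (q ^ 9) m * theta_term (q ^ 3) (q ^ 7) n))
    + (\<Sum>\<^sub>\<infinity>(m, n). q ^ 1 * (theta_term (q ^ 3) (q ^ 7) m * theta_term (q ^ 9) (q ^ 1) n))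
    + (\<Sum>\<^sub>\<infinity>(m, n). q ^ 1 * (theta_term (q ^ 7) (q ^ 3) m * theta_term (q ^ 1) (q ^ 9) n))"
  proof -
    have 1: "?G (2 * m + n + 0, 2 * n - m + 0) = q ^ 0 * (theta_term (q ^ 5) (q ^ 5) m * theta_term (q ^ 5) (q ^ 5) n)" for m n
      unfolding theta_term_power prod.case by (rule expo_piece) (simp add: algebra_simps)
    have 2: "?G (2 * m + n + 1, 2 * n - m + 0) = q ^ 1 * (theta_term (q ^ 9) (q ^ 1) m * theta_term (q ^ 7) (q ^ 3) n)" for m n
      unfolding theta_term_power prod.case by (rule expo_piece) (simp add: algebra_simps)
    have 3: "?G (2 * m + n + -1, 2 * n - m + 0) = q ^ 1 * (theta_term (q ^ 1) (q ^ 9) m * theta_term (q ^ 3) (q ^ 7) n)" for m n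
      unfolding theta_term_power prod.case by (rule expo_piece) (simp add: algebra_simps)
    have 4: "?G (2 * m + n + 0, 2 * n - m + 1) = q ^ 1 * (theta_term (q ^ 3) (q ^ 7) m * theta_term (q ^ 9) (q ^ 1) n)" for m n
      unfolding theta_term_power prod.case by (rule expo_piece) (simp add: algebra_simps)
    have 5: "?G (2 * m + n + 0, 2 * n - m + -1) = q ^ 1 * (theta_term (q ^ 7) (q ^ 3) m * theta_term (q ^ 1) (q ^ 9) n)" for m n
      unfolding theta_term_power prod.case by (rule expo_piece) (simp add: algebra_simps)
    show ?thesis
      unfolding H_def 1 2 3 4 5 ..
  qed
  finally show ?thesis
    by (simp only: infsum_theta_product[OF q] zero_less_numeral zero_less_one add_pos_pos)
       (simp only: theta_commute[of "q ^ 9"] theta_commute[of "q ^ 7"], simp add: algebra_simps power2_eq_square)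
qed

text \<open>The sublattice of \<open>theta_phi_5\<close> serves again, now with exponents 2x^2 - x +
  2y^2 - y. The coset of \<open>(0, 1)\<close> gives q \<psi>(q^5)^2; the other four are the
  products of the even-odd dissections of f(q, q^4) and f(q^2, q^3).\<close>

lemma theta_psi_5:
  "theta (q ^ 1) (q ^ 3) ^ 2 = q * theta (q ^ 5) (q ^ 15) ^ 2 + theta (q ^ 1) (q ^ 4) * theta (q ^ 2) (q ^ 3)"
proof -
  let ?G = "\<lambda>(x, y). theta_term (q ^ 1) (q ^ 3) x * theta_term (q ^ 1) (q ^ 3) y"
  \<comment> \<open>\<open>(1, 1)\<close> represents the residue 3; the unit \<open>(0, -1)\<close>
    would lead to a theta series with the parameter q^(-1).\<close>
  let ?E = "{(0, 0), (1, 0), (-1, 0), (0, 1), (1, 1)} :: (int \<times> int) set"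
  have bij: "bij_betw (\<lambda>(u, v). (u + 2 * v) mod 5) ?E {0..<5}"
    unfolding upto_residues by (auto simp: bij_betw_def)
  define H where "H = (\<lambda>u v. \<Sum>\<^sub>\<infinity>(m, n). ?G (2 * m + n + u, 2 * n - m + v))"
  have "theta (q ^ 1) (q ^ 3) ^ 2 = infsum ?G UNIV"
    unfolding power2_eq_square by (rule theta_product_expand(2)[OF q]) auto
  also have "\<dots> = (\<Sum>(u, v)\<in>?E. H u v)"
    unfolding H_def by (rule infsum_lattice_5[OF bij theta_product_expand(1)[OF q]]) auto
  also have "\<dots> = H 0 0 + H 1 0 + H (-1) 0 + H 0 1 + H 1 1"
    by (simp add: add.assoc)
  also have "\<dots> = (\<Sum>\<^sub>\<infinity>(m, n). q ^ 0 * (theta_term (q ^ 9) (q ^ 11) m * theta_term (q ^ 7) (q ^ 13) n))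
    + (\<Sum>\<^sub>\<infinity>(m, n). q ^ 1 * (theta_term (q ^ 17) (q ^ 3) m * theta_term (q ^ 11) (q ^ 9) n))
    + (\<Sum>\<^sub>\<infinity>(m, n). q ^ 3 * (theta_term (q ^ 1) (q ^ 19) m * theta_term (q ^ 3) (q ^ 17) n))
    + (\<Sum>\<^sub>\<infinity>(m, n). q ^ 1 * (theta_term (q ^ 5) (q ^ 15) m * theta_term (q ^ 15) (q ^ 5) n))
    + (\<Sum>\<^sub>\<infinity>(m, n). q ^ 2 * (theta_term (q ^ 13) (q ^ 7) m * theta_term (q ^ 19) (q ^ 1) n))"
  proof -
    have 1: "?G (2 * m + n + 0, 2 * n - m + 0) = q ^ 0 * (theta_term (q ^ 9) (q ^ 11) m * theta_term (q ^ 7) (q ^ 13) n)" for m n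
      unfolding theta_term_power prod.case by (rule expo_piece) (simp add: algebra_simps)
    have 2: "?G (2 * m + n + 1, 2 * n - m + 0) = q ^ 1 * (theta_term (q ^ 17) (q ^ 3) m * theta_term (q ^ 11) (q ^ 9) n)" for m n
      unfolding theta_term_power prod.case by (rule expo_piece) (simp add: algebra_simps)
    have 3: "?G (2 * m + n + -1, 2 * n - m + 0) = q ^ 3 * (theta_term (q ^ 1) (q ^ 19) m * theta_term (q ^ 3) (q ^ 17) n)" for m n
      unfolding theta_term_power prod.case by (rule expo_piece) (simp add: algebra_simps)
    have 4: "?G (2 * m + n + 0, 2 * n - m + 1) = q ^ 1 * (theta_term (q ^ 5) (q ^ 15) m * theta_term (q ^ 15) (q ^ 5) n)" for m n
      unfolding theta_term_power prod.case by (rule expo_piece) (simp add: algebra_simps)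
    have 5: "?G (2 * m + n + 1, 2 * n - m + 1) = q ^ 2 * (theta_term (q ^ 13) (q ^ 7) m * theta_term (q ^ 19) (q ^ 1) n)" for m n
      unfolding theta_term_power prod.case by (rule expo_piece) (simp add: algebra_simps)
    show ?thesis
      unfolding H_def 1 2 3 4 5 ..
  qed
  finally have A: "theta (q ^ 1) (q ^ 3) ^ 2 = theta (q ^ 9) (q ^ 11) * theta (q ^ 7) (q ^ 13)
    + q * (theta (q ^ 17) (q ^ 3) * theta (q ^ 11) (q ^ 9)) + q ^ 3 * (theta (q ^ 1) (q ^ 19) * theta (q ^ 3) (q ^ 17))
    + q * theta (q ^ 5) (q ^ 15) ^ 2 + q ^ 2 * (theta (q ^ 13) (q ^ 7) * theta (q ^ 19) (q ^ 1))"
    by (simp only: infsum_theta_product[OF q] zero_less_numeral zero_less_one add_pos_pos)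
       (simp only: theta_commute[of "q ^ 15"], simp add: power2_eq_square)
  have E: "bij_betw (\<lambda>r. r mod 2) {0, 1} {0..<2::int}"
    unfolding upto_residues by (auto simp: bij_betw_def)
  have "theta (q ^ 1) (q ^ 4) = (\<Sum>r\<in>{0,1}. \<Sum>\<^sub>\<infinity>j. theta_term (q ^ 1) (q ^ 4) (2 * j + r))"
    unfolding theta_def by (rule infsum_residues[OF _ E abs_summable_summable[OF summable_theta_power(1)[OF q]]]) auto
  also have "\<dots> = (\<Sum>\<^sub>\<infinity>j. q ^ 0 * theta_term (q ^ 7) (q ^ 13) j) + (\<Sum>\<^sub>\<infinity>j. q ^ 1 * theta_term (q ^ 17) (q ^ 3) j)"
  proof -
    have 1: "theta_term (q ^ 1) (q ^ 4) (2 * j + 0) = q ^ 0 * theta_term (q ^ 7) (q ^ 13) j" for j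
      unfolding theta_term_power by (rule expo_single) (simp add: algebra_simps)
    have 2: "theta_term (q ^ 1) (q ^ 4) (2 * j + 1) = q ^ 1 * theta_term (q ^ 17) (q ^ 3) j" for j
      unfolding theta_term_power by (rule expo_single) (simp add: algebra_simps)
    show ?thesis unfolding 1[symmetric] 2[symmetric] by simp
  qed
  finally have B: "theta (q ^ 1) (q ^ 4) = theta (q ^ 7) (q ^ 13) + q * theta (q ^ 17) (q ^ 3)"
    by (simp add: infsum_cmult_right' theta_def)
  have "theta (q ^ 2) (q ^ 3) = (\<Sum>r\<in>{0,1}. \<Sum>\<^sub>\<infinity>j. theta_term (q ^ 2) (q ^ 3) (2 * j + r))"
    unfolding theta_def by (rule infsum_residues[OF _ E abs_summable_summable[OF summable_theta_power(1)[OF q]]]) auto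
  also have "\<dots> = (\<Sum>\<^sub>\<infinity>j. q ^ 0 * theta_term (q ^ 9) (q ^ 11) j) + (\<Sum>\<^sub>\<infinity>j. q ^ 2 * theta_term (q ^ 19) (q ^ 1) j)"
  proof -
    have 1: "theta_term (q ^ 2) (q ^ 3) (2 * j + 0) = q ^ 0 * theta_term (q ^ 9) (q ^ 11) j" for j
      unfolding theta_term_power by (rule expo_single) (simp add: algebra_simps)
    have 2: "theta_term (q ^ 2) (q ^ 3) (2 * j + 1) = q ^ 2 * theta_term (q ^ 19) (q ^ 1) j" for j
      unfolding theta_term_power by (rule expo_single) (simp add: algebra_simps)
    show ?thesis unfolding 1[symmetric] 2[symmetric] by simp
  qed
  finally have C: "theta (q ^ 2) (q ^ 3) = theta (q ^ 9) (q ^ 11) + q ^ 2 * theta (q ^ 19) (q ^ 1)"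
    by (simp add: infsum_cmult_right' theta_def)
  show ?thesis
    unfolding A B C
    by (simp only: theta_commute[of "q ^ 17"] theta_commute[of "q ^ 19"] theta_commute[of "q ^ 13"] theta_commute[of "q ^ 11"])
       (simp add: algebra_simps power2_eq_square power3_eq_cube)
qed

text \<open>Here \<open>theta (q ^ 4) (q ^ 0)\<close> is 2 \<psi>(q^4), since the terms at n and -1
  - n coincide. Both forms of Gauss's step for theta constants come from this identity.\<close>

lemma theta_phi_2:
  "theta (q ^ 1) (q ^ 1) ^ 2 = theta (q ^ 2) (q ^ 2) ^ 2 + q * theta (q ^ 4) (q ^ 0) ^ 2"
proof -
  let ?G = "\<lambda>(x, y). theta_term (q ^ 1) (q ^ 1) x * theta_term (q ^ 1) (q ^ 1) y"
  have "theta (q ^ 1) (q ^ 1) ^ 2 = infsum ?G UNIV"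
    unfolding power2_eq_square by (rule theta_product_expand(2)[OF q]) auto
  also have "\<dots> = (\<Sum>\<^sub>\<infinity>(m, n). ?G (m + n, m - n)) + (\<Sum>\<^sub>\<infinity>(m, n). ?G (m + n + 1, m - n))"
    by (rule infsum_lattice_2[OF theta_product_expand(1)[OF q]]) auto
  also have "\<dots> = (\<Sum>\<^sub>\<infinity>(m, n). q ^ 0 * (theta_term (q ^ 2) (q ^ 2) m * theta_term (q ^ 2) (q ^ 2) n))
    + (\<Sum>\<^sub>\<infinity>(m, n). q ^ 1 * (theta_term (q ^ 4) (q ^ 0) m * theta_term (q ^ 4) (q ^ 0) n))"
  proof -
    have 1: "?G (m + n, m - n) = q ^ 0 * (theta_term (q ^ 2) (q ^ 2) m * theta_term (q ^ 2) (q ^ 2) n)" for m n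
      unfolding theta_term_power prod.case by (rule expo_piece) (simp add: algebra_simps)
    have 2: "?G (m + n + 1, m - n) = q ^ 1 * (theta_term (q ^ 4) (q ^ 0) m * theta_term (q ^ 4) (q ^ 0) n)" for m n
      unfolding theta_term_power prod.case by (rule expo_piece) (simp add: algebra_simps)
    show ?thesis
      unfolding 1[symmetric] 2[symmetric] by simp
  qed
  finally show ?thesis
    by (simp only: infsum_theta_product[OF q] zero_less_numeral zero_less_one add_pos_pos add_pos_nonneg order.refl)
       (simp add: power2_eq_square)
qed

text \<open>One parameter is -1, so the triple product contains the factor 1 - 1; this removes one
  coset from each quintuple identity.\<close>

lemma theta_zero: "k > 0 \<Longrightarrow> theta (- (q ^ k)) (- (q ^ 0)) = 0"
proof -
  assume "k > 0"
  then have "norm (q ^ k) < 1" using q by (simp add: norm_power power_less_one_iff)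
  moreover from this have "qp 1 (q ^ k) = 0"
    by (rule qp_one)
  ultimately show ?thesis
    using jacobi_triple_product[of "- (q ^ k)" "-1"] by simp
qed

text \<open>Two cases of the quintuple product identity. The form \<open>x\<^sup>2 + 2y\<^sup>2\<close> is multiplied by 3 under
  \<open>(s,t) \<mapsto> (s + 2t, s - t)\<close>; of the three cosets, the one of \<open>(1,0)\<close> contributes 0.\<close>

lemma quintuple_theta:
  "theta (q ^ 4) (q ^ 1) * theta (- (q ^ 3)) (- (q ^ 7)) =
    theta (- (q ^ 10)) (- (q ^ 20)) * (theta (- (q ^ 7)) (- (q ^ 8)) + q * theta (- (q ^ 2)) (- (q ^ 13)))" (is ?A)
  "theta (q ^ 3) (q ^ 2) * theta (- (q ^ 1)) (- (q ^ 9)) =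
    theta (- (q ^ 10)) (- (q ^ 20)) * (theta (- (q ^ 4)) (- (q ^ 11)) - q * theta (- (q ^ 14)) (- (q ^ 1)))" (is ?B)
proof -
  have sg: "sg (s - t) = (sg s * sg t :: 'a)" "sg (s - t + 1) = (- (sg s * sg t) :: 'a)" for s t
    by (auto simp: sg_def)
  have piece: "X * (sg s * sg t * Y) = q ^ k * (sg s * A * (sg t * B))" if "X * Y = q ^ k * (A * B)" for X Y A B :: 'a and s t k
    using arg_cong[OF that, of "\<lambda>x. sg s * sg t * x"] by (simp add: ac_simps)
  let ?G = "\<lambda>(x, y). theta_term (q ^ 4) (q ^ 1) x * theta_term (- (q ^ 3)) (- (q ^ 7)) y"
  let ?E = "{(0, 0), (1, 0), (-1, 0)} :: (int \<times> int) set"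
  have bij: "bij_betw (\<lambda>(u, v). (u - v) mod 3) ?E {0..<3}"
    unfolding upto_residues by (auto simp: bij_betw_def)
  define H where "H = (\<lambda>u v. \<Sum>\<^sub>\<infinity>(s, t). ?G (s + 2 * t + u, s - t + v))"
  have "theta (q ^ 4) (q ^ 1) * theta (- (q ^ 3)) (- (q ^ 7)) = infsum ?G UNIV"
    by (rule theta_product_expand'(2)[OF q]) auto
  also have "\<dots> = (\<Sum>(u, v)\<in>?E. H u v)"
    unfolding H_def by (rule infsum_lattice_3[OF bij theta_product_expand'(1)[OF q]]) auto
  also have "\<dots> = H 0 0 + H 1 0 + H (-1) 0"
    by (simp add: add.assoc)
  also have "\<dots> = (\<Sum>\<^sub>\<infinity>(s, t). q ^ 0 * (theta_term (- (q ^ 7)) (- (q ^ 8)) s * theta_term (- (q ^ 20)) (- (q ^ 10)) t))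
    + (\<Sum>\<^sub>\<infinity>(s, t). q ^ 4 * (theta_term (- (q ^ 12)) (- (q ^ 3)) s * theta_term (- (q ^ 30)) (- (q ^ 0)) t))
    + (\<Sum>\<^sub>\<infinity>(s, t). q ^ 1 * (theta_term (- (q ^ 2)) (- (q ^ 13)) s * theta_term (- (q ^ 10)) (- (q ^ 20)) t))"
  proof -
    have 1: "?G (s + 2 * t + 0, s - t + 0) = q ^ 0 * (theta_term (- (q ^ 7)) (- (q ^ 8)) s * theta_term (- (q ^ 20)) (- (q ^ 10)) t)" for s t
      unfolding theta_term_power theta_term_minus_power prod.case add_0_right sg
      by (rule piece, rule expo_piece) (simp add: algebra_simps)
    have 2: "?G (s + 2 * t + 1, s - t + 0) = q ^ 4 * (theta_term (- (q ^ 12)) (- (q ^ 3)) s * theta_term (- (q ^ 30)) (- (q ^ 0)) t)" for s t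
      unfolding theta_term_power theta_term_minus_power prod.case add_0_right sg
      by (rule piece, rule expo_piece) (simp add: algebra_simps)
    have 3: "?G (s + 2 * t + -1, s - t + 0) = q ^ 1 * (theta_term (- (q ^ 2)) (- (q ^ 13)) s * theta_term (- (q ^ 10)) (- (q ^ 20)) t)" for s t
      unfolding theta_term_power theta_term_minus_power prod.case add_0_right sg
      by (rule piece, rule expo_piece) (simp add: algebra_simps)
    show ?thesis
      unfolding H_def 1 2 3 ..
  qed
  finally show ?A
    by (simp only: infsum_theta_product[OF q] zero_less_numeral zero_less_one add_pos_pos add_pos_nonneg order.refl theta_zero)
       (simp only: theta_commute[of "- (q ^ 20)"], simp add: algebra_simps)
  let ?G = "\<lambda>(x, y). theta_term (q ^ 3) (q ^ 2) x * theta_term (- (q ^ 1)) (- (q ^ 9)) y"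
  \<comment> \<open>\<open>(0, 1)\<close> replaces \<open>(-1, 0)\<close> in its class to keep the
    exponents natural; its odd second coordinate produces the minus sign in
    \<open>- q\<close>.\<close>
  let ?E = "{(0, 0), (1, 0), (0, 1)} :: (int \<times> int) set"
  have bij: "bij_betw (\<lambda>(u, v). (u - v) mod 3) ?E {0..<3}"
    unfolding upto_residues by (auto simp: bij_betw_def)
  define H where "H = (\<lambda>u v. \<Sum>\<^sub>\<infinity>(s, t). ?G (s + 2 * t + u, s - t + v))"
  have "theta (q ^ 3) (q ^ 2) * theta (- (q ^ 1)) (- (q ^ 9)) = infsum ?G UNIV"
    by (rule theta_product_expand'(2)[OF q]) auto
  also have "\<dots> = (\<Sum>(u, v)\<in>?E. H u v)"
    unfolding H_def by (rule infsum_lattice_3[OF bij theta_product_expand'(1)[OF q]]) auto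
  also have "\<dots> = H 0 0 + H 1 0 + H 0 1"
    by (simp add: add.assoc)
  also have "\<dots> = (\<Sum>\<^sub>\<infinity>(s, t). q ^ 0 * (theta_term (- (q ^ 4)) (- (q ^ 11)) s * theta_term (- (q ^ 20)) (- (q ^ 10)) t))
    + (\<Sum>\<^sub>\<infinity>(s, t). q ^ 3 * (theta_term (- (q ^ 9)) (- (q ^ 6)) s * theta_term (- (q ^ 30)) (- (q ^ 0)) t))
    + (\<Sum>\<^sub>\<infinity>(s, t). - q * (theta_term (- (q ^ 14)) (- (q ^ 1)) s * theta_term (- (q ^ 10)) (- (q ^ 20)) t))"
  proof -
    have 1: "?G (s + 2 * t + 0, s - t + 0) = q ^ 0 * (theta_term (- (q ^ 4)) (- (q ^ 11)) s * theta_term (- (q ^ 20)) (- (q ^ 10)) t)" for s t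
      unfolding theta_term_power theta_term_minus_power prod.case add_0_right sg
      by (rule piece, rule expo_piece) (simp add: algebra_simps)
    have 2: "?G (s + 2 * t + 1, s - t + 0) = q ^ 3 * (theta_term (- (q ^ 9)) (- (q ^ 6)) s * theta_term (- (q ^ 30)) (- (q ^ 0)) t)" for s t
      unfolding theta_term_power theta_term_minus_power prod.case add_0_right sg
      by (rule piece, rule expo_piece) (simp add: algebra_simps)
    have 3: "?G (s + 2 * t + 0, s - t + 1) = - q * (theta_term (- (q ^ 14)) (- (q ^ 1)) s * theta_term (- (q ^ 10)) (- (q ^ 20)) t)" for s t
    proof -
      have "q ^ expo 3 2 (s + 2 * t) * (sg s * sg t * q ^ expo 1 9 (s - t + 1)) =
        q ^ 1 * (sg s * q ^ expo 14 1 s * (sg t * q ^ expo 10 20 t))"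
        by (rule piece, rule expo_piece) (simp add: algebra_simps)
      then show ?thesis
        unfolding theta_term_power theta_term_minus_power prod.case add_0_right sg by simp
    qed
    show ?thesis
      unfolding H_def 1 2 3 ..
  qed
  finally show ?B
    by (simp only: infsum_theta_product[OF q] zero_less_numeral zero_less_one add_pos_pos add_pos_nonneg order.refl theta_zero)
       (simp only: theta_commute[of "- (q ^ 20)"], simp add: algebra_simps)
qed

text \<open>The pentagonal exponents are 0, 1 or 2 modulo 5, and the five classes of n are grouped
  accordingly. The two brackets are the sums of the quintuple identities at q^5; the middle theta
  function is the Euler product at q^25.\<close>

lemma pentagonal_dissection:
  "theta (- (q ^ 1)) (- (q ^ 2)) =
    (theta (- (q ^ 35)) (- (q ^ 40)) + q ^ 5 * theta (- (q ^ 65)) (- (q ^ 10)))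
    - q * theta (- (q ^ 25)) (- (q ^ 50))
    - q\<^sup>2 * (theta (- (q ^ 20)) (- (q ^ 55)) - q ^ 5 * theta (- (q ^ 5)) (- (q ^ 70)))"
proof -
  have E: "bij_betw (\<lambda>r. r mod 5) {0, 2, 1, -1, -2} {0..<5::int}"
    unfolding upto_residues by (auto simp: bij_betw_def)
  have sg: "sg (5 * j + 0) = (sg j :: 'a)" "sg (5 * j + 2) = (sg j :: 'a)" "sg (5 * j + 1) = (- sg j :: 'a)"
    "sg (5 * j + -1) = (- sg j :: 'a)" "sg (5 * j + -2) = (sg j :: 'a)" for j
    by (auto simp: sg_def)
  have "theta (- (q ^ 1)) (- (q ^ 2)) = (\<Sum>r\<in>{0, 2, 1, -1, -2}. \<Sum>\<^sub>\<infinity>j. theta_term (- (q ^ 1)) (- (q ^ 2)) (5 * j + r))"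
    unfolding theta_def by (rule infsum_residues[OF _ E abs_summable_summable[OF summable_theta_power(2)[OF q]]]) auto
  also have "\<dots> = (\<Sum>\<^sub>\<infinity>j. theta_term (- (q ^ 35)) (- (q ^ 40)) j) + (\<Sum>\<^sub>\<infinity>j. q ^ 5 * theta_term (- (q ^ 65)) (- (q ^ 10)) j)
    + (\<Sum>\<^sub>\<infinity>j. (- q) * theta_term (- (q ^ 50)) (- (q ^ 25)) j) + (\<Sum>\<^sub>\<infinity>j. (- (q ^ 2)) * theta_term (- (q ^ 20)) (- (q ^ 55)) j)
    + (\<Sum>\<^sub>\<infinity>j. q ^ 7 * theta_term (- (q ^ 5)) (- (q ^ 70)) j)"
  proof -
    have e: "q ^ expo 1 2 (5 * j + 0) = q ^ 0 * q ^ expo 35 40 j" "q ^ expo 1 2 (5 * j + 2) = q ^ 5 * q ^ expo 65 10 j"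
      "q ^ expo 1 2 (5 * j + 1) = q ^ 1 * q ^ expo 50 25 j" "q ^ expo 1 2 (5 * j + -1) = q ^ 2 * q ^ expo 20 55 j"
      "q ^ expo 1 2 (5 * j + -2) = q ^ 7 * q ^ expo 5 70 j" for j
      by (rule expo_single; simp add: algebra_simps)+
    have 1: "theta_term (- (q ^ 1)) (- (q ^ 2)) (5 * j + 0) = theta_term (- (q ^ 35)) (- (q ^ 40)) j" for j
      unfolding theta_term_minus_power sg e by simp
    have 2: "theta_term (- (q ^ 1)) (- (q ^ 2)) (5 * j + 2) = q ^ 5 * theta_term (- (q ^ 65)) (- (q ^ 10)) j" for j
      unfolding theta_term_minus_power sg e by simp
    have 3: "theta_term (- (q ^ 1)) (- (q ^ 2)) (5 * j + 1) = (- q) * theta_term (- (q ^ 50)) (- (q ^ 25)) j" for j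
      unfolding theta_term_minus_power sg e by simp
    have 4: "theta_term (- (q ^ 1)) (- (q ^ 2)) (5 * j + -1) = (- (q ^ 2)) * theta_term (- (q ^ 20)) (- (q ^ 55)) j" for j
      unfolding theta_term_minus_power sg e by simp
    have 5: "theta_term (- (q ^ 1)) (- (q ^ 2)) (5 * j + -2) = q ^ 7 * theta_term (- (q ^ 5)) (- (q ^ 70)) j" for j
      unfolding theta_term_minus_power sg e by simp
    show ?thesis unfolding 1[symmetric] 2[symmetric] 3[symmetric] 4[symmetric] 5[symmetric] by (simp add: add.assoc)
  qed
  also have "\<dots> = theta (- (q ^ 35)) (- (q ^ 40)) + q ^ 5 * theta (- (q ^ 65)) (- (q ^ 10))
    + (- q) * theta (- (q ^ 50)) (- (q ^ 25)) + (- (q ^ 2)) * theta (- (q ^ 20)) (- (q ^ 55))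
    + q ^ 7 * theta (- (q ^ 5)) (- (q ^ 70))"
    unfolding infsum_cmult_right' theta_def ..
  finally show ?thesis
    by (simp add: theta_commute[of "- (q ^ 50)"] algebra_simps flip: power_add)
qed

end

section \<open>Product representations\<close>

text \<open>\<open>qpow q k k\<close> is the Euler product at q^k, the unit in which all theta
  constants below are expressed.\<close>

definition qpow :: "'a::{real_normed_field,banach} \<Rightarrow> nat \<Rightarrow> nat \<Rightarrow> 'a" where
  "qpow q a k = qp (q ^ a) (q ^ k)"

definition qmpow :: "'a::{real_normed_field,banach} \<Rightarrow> nat \<Rightarrow> nat \<Rightarrow> 'a" where
  "qmpow q a k = qp (- (q ^ a)) (q ^ k)"

definition euler_prod :: "'a::{real_normed_field,banach} \<Rightarrow> 'a" where
  "euler_prod q = qp q q"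

lemma lessThan_5: "{..<5::nat} = {0, 1, 2, 3, 4}"
  by auto

context
  fixes q :: "'a::{real_normed_field,banach}"
  assumes q: "norm q < 1"
begin

lemma norm_power_less_one: "k > 0 \<Longrightarrow> norm (q ^ k) < 1"
  using q by (simp add: norm_power power_less_one_iff)

lemma qpow_nonzero: "a > 0 \<Longrightarrow> k > 0 \<Longrightarrow> qpow q a k \<noteq> 0"
  unfolding qpow_def by (intro qp_nonzero' norm_power_less_one)

lemma qmpow_nonzero: "a > 0 \<Longrightarrow> k > 0 \<Longrightarrow> qmpow q a k \<noteq> 0"
  unfolding qmpow_def by (intro qp_nonzero') (simp_all add: norm_power_less_one)

lemma qpow_split: "k > 0 \<Longrightarrow> s > 0 \<Longrightarrow> qpow q a k = (\<Prod>j<s. qpow q (a + j * k) (s * k))"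
  using qp_split[OF norm_power_less_one, of k s "q ^ a"]
  by (simp add: qpow_def mult.commute flip: power_mult power_add)

lemma qmpow_split: "k > 0 \<Longrightarrow> s > 0 \<Longrightarrow> qmpow q a k = (\<Prod>j<s. qmpow q (a + j * k) (s * k))"
  using qp_split[OF norm_power_less_one, of k s "- (q ^ a)"]
  by (simp add: qmpow_def mult.commute flip: power_mult power_add)

lemma qpow_split2: "k > 0 \<Longrightarrow> qpow q a k = qpow q a (2 * k) * qpow q (a + k) (2 * k)"
  using qpow_split[of k 2 a] by (simp add: eval_nat_numeral)

lemma qmpow_split2: "k > 0 \<Longrightarrow> qmpow q a k = qmpow q a (2 * k) * qmpow q (a + k) (2 * k)"
  using qmpow_split[of k 2 a] by (simp add: eval_nat_numeral)

lemma qpow_split5: "k > 0 \<Longrightarrow> qpow q a k = qpow q a (5 * k) * qpow q (a + k) (5 * k) *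
    qpow q (a + 2 * k) (5 * k) * qpow q (a + 3 * k) (5 * k) * qpow q (a + 4 * k) (5 * k)"
  using qpow_split[of k 5 a] by (simp add: lessThan_5 mult.assoc)

lemma qmpow_split5: "k > 0 \<Longrightarrow> qmpow q a k = qmpow q a (5 * k) * qmpow q (a + k) (5 * k) *
    qmpow q (a + 2 * k) (5 * k) * qmpow q (a + 3 * k) (5 * k) * qmpow q (a + 4 * k) (5 * k)"
  using qmpow_split[of k 5 a] by (simp add: lessThan_5 mult.assoc)

lemma qmpow_mult: "k > 0 \<Longrightarrow> qpow q a k * qmpow q a k = qpow q (2 * a) (2 * k)"
  using qp_mult_minus[OF norm_power_less_one, of k "q ^ a"]
  by (simp add: qpow_def qmpow_def mult.commute flip: power_mult)

lemma theta_power: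
  assumes "a + b > 0"
  shows "theta (q ^ a) (q ^ b) = qmpow q a (a + b) * qmpow q b (a + b) * qpow q (a + b) (a + b)"
    and "theta (- (q ^ a)) (- (q ^ b)) = qpow q a (a + b) * qpow q b (a + b) * qpow q (a + b) (a + b)"
  unfolding qpow_def qmpow_def
  using jacobi_triple_product[of "q ^ a" "q ^ b"] jacobi_triple_product[of "- (q ^ a)" "- (q ^ b)"]
    norm_power_less_one[OF assms] q
  by (simp_all add: norm_power power_le_one flip: power_add)

text \<open>Product identities are stated free of division so that \<open>algebra\<close> can
  combine them; nonvanishing factors are cancelled afterwards.\<close>

lemma qmpow_12: "qmpow q 1 2 * (qpow q 1 1 * qpow q 4 4) = qpow q 2 2 ^ 2"
proof -
  have "qpow q 1 1 = qpow q 1 2 * qpow q 2 2" using qpow_split2[of 1 1] by (simp flip: numeral_2_eq_2 numeral_3_eq_3)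
  moreover have "qpow q 2 2 = qpow q 2 4 * qpow q 4 4" using qpow_split2[of 2 2] by (simp flip: numeral_2_eq_2 numeral_3_eq_3)
  moreover have "qpow q 1 2 * qmpow q 1 2 = qpow q 2 4" using qmpow_mult[of 2 1] by simp
  ultimately show ?thesis by algebra
qed

lemma qmpow_510: "qmpow q 5 10 * (qpow q 5 5 * qpow q 20 20) = qpow q 10 10 ^ 2"
proof -
  have "qpow q 5 5 = qpow q 5 10 * qpow q 10 10" using qpow_split2[of 5 5] by (simp flip: numeral_2_eq_2 numeral_3_eq_3)
  moreover have "qpow q 10 10 = qpow q 10 20 * qpow q 20 20" using qpow_split2[of 10 10] by (simp flip: numeral_2_eq_2 numeral_3_eq_3)
  moreover have "qpow q 5 10 * qmpow q 5 10 = qpow q 10 20" using qmpow_mult[of 10 5] by simp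
  ultimately show ?thesis by algebra
qed

lemma phi_product: "theta (q ^ 1) (q ^ 1) * (qpow q 1 1 ^ 2 * qpow q 4 4 ^ 2) = qpow q 2 2 ^ 5"
proof -
  have "theta (q ^ 1) (q ^ 1) = qmpow q 1 2 * qmpow q 1 2 * qpow q 2 2"
    using theta_power(1)[of 1 1] by (simp add: numeral_2_eq_2)
  with qmpow_12 show ?thesis by algebra
qed

lemma psi_product: "theta (q ^ 1) (q ^ 3) * qpow q 1 1 = qpow q 2 2 ^ 2"
proof -
  have "qmpow q 1 2 = qmpow q 1 4 * qmpow q 3 4" using qmpow_split2[of 2 1] by (simp flip: numeral_2_eq_2 numeral_3_eq_3)
  moreover have "theta (q ^ 1) (q ^ 3) = qmpow q 1 4 * qmpow q 3 4 * qpow q 4 4"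
    using theta_power(1)[of 1 3] by (simp flip: numeral_2_eq_2 numeral_3_eq_3)
  ultimately show ?thesis using qmpow_12 by algebra
qed

lemma theta_40_product: "theta (q ^ 4) (q ^ 0) * qpow q 4 4 = 2 * qpow q 8 8 ^ 2"
proof -
  \<comment> \<open>The factor at n = 0 is 1 - (-1) = 2; it is split off from the partial
    products.\<close>
  have "(\<lambda>N. \<Prod>n<Suc N. 1 - (- 1) * (q ^ 4) ^ n) \<longlonglongrightarrow> qp (- 1) (q ^ 4)"
    by (intro LIMSEQ_Suc tendsto_qp norm_power_less_one) auto
  moreover have "(\<lambda>N. 2 * (\<Prod>n<N. 1 - (- (q ^ 4)) * (q ^ 4) ^ n)) \<longlonglongrightarrow> 2 * qp (- (q ^ 4)) (q ^ 4)"
    by (intro tendsto_mult tendsto_const tendsto_qp norm_power_less_one) auto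
  moreover have "(\<Prod>n<Suc N. 1 - (- 1) * (q ^ 4) ^ n) = 2 * (\<Prod>n<N. 1 - (- (q ^ 4)) * (q ^ 4) ^ n)" for N
    by (subst prod.lessThan_Suc_shift) simp
  ultimately have "qmpow q 0 4 = 2 * qmpow q 4 4"
    unfolding qmpow_def by (simp add: LIMSEQ_unique)
  moreover have "theta (q ^ 4) (q ^ 0) = qmpow q 4 4 * qmpow q 0 4 * qpow q 4 4"
    using theta_power(1)[of 4 0] by (simp flip: numeral_2_eq_2 numeral_3_eq_3)
  moreover have "qpow q 4 4 * qmpow q 4 4 = qpow q 8 8" using qmpow_mult[of 4 4] by simp
  ultimately show ?thesis by algebra
qed

text \<open>The residues 1, 3, 7, 9 modulo 10 are the odd ones except 5, so the four products with
  plus signs make up \<open>qmpow q 1 2\<close> divided by \<open>qmpow q 5 10\<close>.\<close>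

lemma phi_5_product:
  "theta (q ^ 1) (q ^ 9) * theta (q ^ 3) (q ^ 7) * (qpow q 1 1 * qpow q 4 4) =
    qpow q 2 2 ^ 2 * qpow q 5 5 * qpow q 20 20"
proof -
  have "theta (q ^ 1) (q ^ 9) = qmpow q 1 10 * qmpow q 9 10 * qpow q 10 10"
    "theta (q ^ 3) (q ^ 7) = qmpow q 3 10 * qmpow q 7 10 * qpow q 10 10"
    using theta_power(1)[of 1 9] theta_power(1)[of 3 7] by (simp_all flip: numeral_2_eq_2 numeral_3_eq_3)
  moreover have "qmpow q 1 2 = qmpow q 1 10 * qmpow q 3 10 * qmpow q 5 10 * qmpow q 7 10 * qmpow q 9 10"
    using qmpow_split5[of 2 1] by (simp flip: numeral_2_eq_2 numeral_3_eq_3)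
  ultimately have "theta (q ^ 1) (q ^ 9) * theta (q ^ 3) (q ^ 7) * qmpow q 5 10 * (qpow q 1 1 * qpow q 4 4) =
     qpow q 10 10 ^ 2 * qpow q 2 2 ^ 2"
    using qmpow_12 by algebra
  then have "qmpow q 5 10 * (theta (q ^ 1) (q ^ 9) * theta (q ^ 3) (q ^ 7) * (qpow q 1 1 * qpow q 4 4)) =
    qmpow q 5 10 * (qpow q 2 2 ^ 2 * qpow q 5 5 * qpow q 20 20)"
    using qmpow_510 by algebra
  then show ?thesis
    using qmpow_nonzero[of 5 10] by simp
qed

lemma psi_5_product:
  "theta (q ^ 1) (q ^ 4) * theta (q ^ 2) (q ^ 3) * (qpow q 1 1 * qpow q 10 10) = qpow q 2 2 * qpow q 5 5 ^ 3"
proof -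
  have "theta (q ^ 1) (q ^ 4) = qmpow q 1 5 * qmpow q 4 5 * qpow q 5 5"
    "theta (q ^ 2) (q ^ 3) = qmpow q 2 5 * qmpow q 3 5 * qpow q 5 5"
    using theta_power(1)[of 1 4] theta_power(1)[of 2 3] by (simp_all flip: numeral_2_eq_2 numeral_3_eq_3)
  moreover have "qmpow q 1 1 = qmpow q 1 5 * qmpow q 2 5 * qmpow q 3 5 * qmpow q 4 5 * qmpow q 5 5"
    using qmpow_split5[of 1 1] by (simp flip: numeral_2_eq_2 numeral_3_eq_3)
  moreover have "qpow q 1 1 * qmpow q 1 1 = qpow q 2 2" "qpow q 5 5 * qmpow q 5 5 = qpow q 10 10"
    using qmpow_mult[of 1 1] qmpow_mult[of 5 5] by simp_all
  ultimately show ?thesis by algebra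
qed

lemma euler_prod_uminus: "euler_prod (- q) * (qpow q 1 1 * qpow q 4 4) = qpow q 2 2 ^ 3"
proof -
  have "euler_prod (- q) = qmpow q 1 2 * qpow q 2 2"
    using qp_split[of "- q" 2 "- q"] q
    by (simp add: euler_prod_def qmpow_def qpow_def eval_nat_numeral)
  with qmpow_12 show ?thesis by algebra
qed

text \<open>With X = f(-q^2, -q^3) and Y = f(-q, -q^4), the two sums are the Euler product at q^5
  times X/Y and Y/X. This is where the Rogers-Ramanujan quotient enters the 5-dissection. The
  simplification rests on (q^a; q^5)(-q^a; q^5) = (q^(2a); q^10).\<close>

lemma quintuple_product:
  "(theta (- (q ^ 7)) (- (q ^ 8)) + q * theta (- (q ^ 2)) (- (q ^ 13))) * theta (- (q ^ 1)) (- (q ^ 4))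
    = qpow q 5 5 * theta (- (q ^ 2)) (- (q ^ 3))" (is ?A)
  "(theta (- (q ^ 4)) (- (q ^ 11)) - q * theta (- (q ^ 14)) (- (q ^ 1))) * theta (- (q ^ 2)) (- (q ^ 3))
    = qpow q 5 5 * theta (- (q ^ 1)) (- (q ^ 4))" (is ?B)
proof -
  have t: "theta (- (q ^ 10)) (- (q ^ 20)) = qpow q 10 10"
    using theta_power(2)[of 10 20] qpow_split[of 10 3 10] by (simp add: eval_nat_numeral ac_simps)
  have X: "theta (- (q ^ 2)) (- (q ^ 3)) = qpow q 2 5 * qpow q 3 5 * qpow q 5 5"
    and Y: "theta (- (q ^ 1)) (- (q ^ 4)) = qpow q 1 5 * qpow q 4 5 * qpow q 5 5"
    using theta_power(2)[of 2 3] theta_power(2)[of 1 4] by (simp_all flip: numeral_2_eq_2 numeral_3_eq_3)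
  have s: "qpow q 1 5 = qpow q 1 10 * qpow q 6 10" "qpow q 2 5 = qpow q 2 10 * qpow q 7 10"
    "qpow q 3 5 = qpow q 3 10 * qpow q 8 10" "qpow q 4 5 = qpow q 4 10 * qpow q 9 10"
    using qpow_split2[of 5 1] qpow_split2[of 5 2] qpow_split2[of 5 3] qpow_split2[of 5 4] by (simp_all flip: numeral_2_eq_2 numeral_3_eq_3)
  have m: "qpow q 1 5 * qmpow q 1 5 = qpow q 2 10" "qpow q 2 5 * qmpow q 2 5 = qpow q 4 10"
    "qpow q 3 5 * qmpow q 3 5 = qpow q 6 10" "qpow q 4 5 * qmpow q 4 5 = qpow q 8 10"
    using qmpow_mult[of 5 1] qmpow_mult[of 5 2] qmpow_mult[of 5 3] qmpow_mult[of 5 4] by simp_all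
  have "theta (q ^ 4) (q ^ 1) = qmpow q 4 5 * qmpow q 1 5 * qpow q 5 5"
    "theta (- (q ^ 3)) (- (q ^ 7)) = qpow q 3 10 * qpow q 7 10 * qpow q 10 10"
    using theta_power(1)[of 4 1] theta_power(2)[of 3 7] by (simp_all flip: numeral_2_eq_2 numeral_3_eq_3)
  then have "qpow q 10 10 * ((theta (- (q ^ 7)) (- (q ^ 8)) + q * theta (- (q ^ 2)) (- (q ^ 13))) * theta (- (q ^ 1)) (- (q ^ 4)))
    = qpow q 10 10 * (qpow q 5 5 * theta (- (q ^ 2)) (- (q ^ 3)))"
    using quintuple_theta(1)[OF q, unfolded t] X Y s(2,3) m(1,4) by algebra
  then show ?A using qpow_nonzero[of 10 10] by simp
  have "theta (q ^ 3) (q ^ 2) = qmpow q 3 5 * qmpow q 2 5 * qpow q 5 5"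
    "theta (- (q ^ 1)) (- (q ^ 9)) = qpow q 1 10 * qpow q 9 10 * qpow q 10 10"
    using theta_power(1)[of 3 2] theta_power(2)[of 1 9] by (simp_all flip: numeral_2_eq_2 numeral_3_eq_3)
  then have "qpow q 10 10 * ((theta (- (q ^ 4)) (- (q ^ 11)) - q * theta (- (q ^ 14)) (- (q ^ 1))) * theta (- (q ^ 2)) (- (q ^ 3)))
    = qpow q 10 10 * (qpow q 5 5 * theta (- (q ^ 1)) (- (q ^ 4)))"
    using quintuple_theta(2)[OF q, unfolded t] X Y s(1,4) m(2,3) by algebra
  then show ?B using qpow_nonzero[of 10 10] by simp
qed

text \<open>Euler's pentagonal number theorem: the triple product consists of the three residue
  classes modulo 3 of the Euler product.\<close>

lemma pentagonal: "theta (- (q ^ 1)) (- (q ^ 2)) = euler_prod q"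
  using theta_power(2)[of 1 2] qpow_split[of 1 3 1]
  by (simp add: euler_prod_def qpow_def eval_nat_numeral)

end

section \<open>The modular equation of degree five\<close>

lemma qpow_power: "qpow (q ^ s) a k = qpow q (s * a) (s * k)"
  by (simp add: qpow_def power_mult)

lemma qpow_uminus_even: "even a \<Longrightarrow> even k \<Longrightarrow> qpow (- q) a k = qpow q a k"
  by (simp add: qpow_def)

lemma qpow_pos: "\<bar>q\<bar> < 1 \<Longrightarrow> a > 0 \<Longrightarrow> k > 0 \<Longrightarrow> qpow q a k > (0::real)"
  unfolding qpow_def by (intro qp_pos) (simp_all add: power_abs power_less_one_iff)

lemma qpow_uminus_1:
  assumes "\<bar>q\<bar> < (1::real)"
  shows "qpow (- q) 1 1 = qpow q 2 2 ^ 3 / (qpow q 1 1 * qpow q 4 4)"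
proof -
  have "qpow (- q) 1 1 = euler_prod (- q)" by (simp add: qpow_def euler_prod_def)
  then show ?thesis
    using euler_prod_uminus[of q] qpow_pos[OF assms, of 1 1] qpow_pos[OF assms, of 4 4] assms
    by (simp add: field_simps)
qed

lemma qpow_uminus_5:
  assumes "\<bar>q\<bar> < (1::real)"
  shows "qpow (- q) 5 5 = qpow q 10 10 ^ 3 / (qpow q 5 5 * qpow q 20 20)"
proof -
  have "qpow (- q) 5 5 = qpow (- (q ^ 5)) 1 1" by (simp add: qpow_def)
  also have "\<dots> = qpow (q ^ 5) 2 2 ^ 3 / (qpow (q ^ 5) 1 1 * qpow (q ^ 5) 4 4)"
    by (rule qpow_uminus_1) (use assms in \<open>simp add: power_abs power_less_one_iff\<close>)
  finally show ?thesis by (simp add: qpow_power)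
qed

context
  fixes q :: real
  assumes q: "\<bar>q\<bar> < 1"
begin

text \<open>In this block q may be negative: the instances at \<open>- q\<close> supply the
  statements about \<open>th4\<close>.\<close>

lemma phi_eq: "theta q q = qpow q 2 2 ^ 5 / (qpow q 1 1 ^ 2 * qpow q 4 4 ^ 2)"
  using phi_product[of q] q qpow_pos[OF q, of 1 1] qpow_pos[OF q, of 4 4] by (simp add: field_simps)

lemma phi_5_eq: "theta q q ^ 2 - theta (q ^ 5) (q ^ 5) ^ 2 =
    4 * q * (qpow q 2 2 ^ 2 * qpow q 5 5 * qpow q 20 20) / (qpow q 1 1 * qpow q 4 4)"
  using theta_phi_5[of q] phi_5_product[of q] q qpow_pos[OF q, of 1 1] qpow_pos[OF q, of 4 4]
  by (simp add: field_simps)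

lemma psi_5_eq: "qpow q 2 2 ^ 4 / qpow q 1 1 ^ 2 - q * qpow q 10 10 ^ 4 / qpow q 5 5 ^ 2 =
    qpow q 2 2 * qpow q 5 5 ^ 3 / (qpow q 1 1 * qpow q 10 10)"
proof -
  have "norm (q ^ 5) < 1" using q by (simp add: power_abs power_less_one_iff)
  from psi_product[OF this] have 5: "theta (q ^ 5) (q ^ 15) = qpow q 10 10 ^ 2 / qpow q 5 5"
    using qpow_pos[OF q, of 5 5] by (simp add: qpow_power field_simps flip: power_mult)
  have 1: "theta (q ^ 1) (q ^ 3) = qpow q 2 2 ^ 2 / qpow q 1 1"
    using psi_product[of q] q qpow_pos[OF q, of 1 1] by (simp add: field_simps)
  have 2: "theta (q ^ 1) (q ^ 4) * theta (q ^ 2) (q ^ 3) = qpow q 2 2 * qpow q 5 5 ^ 3 / (qpow q 1 1 * qpow q 10 10)"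
    using psi_5_product[of q] q qpow_pos[OF q, of 1 1] qpow_pos[OF q, of 10 10] by (simp add: eq_divide_eq)
  show ?thesis
    using theta_psi_5[of q] q unfolding 1 2 5
    by (simp add: power_divide power_mult[symmetric])
qed

lemma phi_2_eq: "theta q q ^ 2 = theta (q ^ 2) (q ^ 2) ^ 2 + 4 * q * qpow q 8 8 ^ 4 / qpow q 4 4 ^ 2"
proof -
  have "theta (q ^ 4) (q ^ 0) = 2 * qpow q 8 8 ^ 2 / qpow q 4 4"
    using theta_40_product[of q] q qpow_pos[OF q, of 4 4] by (simp add: field_simps)
  then show ?thesis
    using theta_phi_2[of q] q by (simp add: power_divide power_mult_distrib power_mult[symmetric])
qed

end

section \<open>Theta constants, Gauss's step, and the relations of degree five\<close>

definition th3 :: "real \<Rightarrow> real" where "th3 q = theta q q"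

definition th4 :: "real \<Rightarrow> real" where "th4 q = theta (- q) (- q)"

text \<open>The square of the second Jacobi theta constant \<open>2q\<^sup>1\<^sup>/\<^sup>4 \<psi>(q\<^sup>2)\<close>, where \<open>\<psi>(q) = theta q (q\<^sup>3)\<close>.\<close>

definition th2sq :: "real \<Rightarrow> real" where
  "th2sq q = 4 * sqrt q * qpow q 4 4 ^ 4 / qpow q 2 2 ^ 2"

text \<open>Here \<open>p = \<lambda>/\<mu>\<close> and \<open>g = \<nu>/\<mu>\<close>, where \<open>\<lambda>\<^sup>2, \<mu>, \<nu>\<close> are the quotients by their values at \<open>q\<^sup>5\<close> of
  \<open>\<theta>\<^sub>2\<^sup>2, \<theta>\<^sub>3, \<theta>\<^sub>4\<close>, and \<open>L\<close> is the square of the modulus at \<open>q\<^sup>5\<close>. The cofactor in the proof comes from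
  dividing by the equation of the curve.\<close>

lemma modular_parametrization:
  fixes p g L :: real
  assumes curve: "(p - 1) * g ^ 2 + (p + 1) ^ 2 * g - p * (p - 1) = 0"
    and L: "L * (p ^ 4 - g ^ 4) = 1 - g ^ 4" and "p > 0" "g > 0"
  shows "L * (p ^ 6 + 10 * p ^ 5 + 15 * p ^ 4 - 20 * p ^ 3 + 15 * p ^ 2 + 10 * p + 1) = 16 * p * (1 + p ^ 4 * L ^ 2)"
proof -
  let ?W = "p ^ 6 + 10 * p ^ 5 + 15 * p ^ 4 - 20 * p ^ 3 + 15 * p ^ 2 + 10 * p + 1"
  \<comment> \<open>The second hypothesis determines L only off p = g; on the curve, p = g would
    force 2p(p^2 + 1) = 0.\<close>
  have nz: "p ^ 4 - g ^ 4 \<noteq> 0"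
  proof
    assume "p ^ 4 - g ^ 4 = 0"
    then have "p = g" using assms(3,4) power_eq_imp_eq_base[of p 4 g] by simp
    with curve have "p * (2 * p ^ 2 + 2) = 0" by (simp add: algebra_simps power2_eq_square)
    then show False using assms(3) by (simp add: add_eq_0_iff) (smt (verit) zero_le_power2)
  qed
  have "(1 - g ^ 4) * (p ^ 4 - g ^ 4) * ?W - 16 * p * ((p ^ 4 - g ^ 4) ^ 2 + p ^ 4 * (1 - g ^ 4) ^ 2)
    = ((p - 1) * g ^ 2 + (p + 1) ^ 2 * g - p * (p - 1)) *
      (p ^ 3 - 5 * p ^ 4 + 10 * p ^ 5 - 10 * p ^ 6 + 5 * p ^ 7 - p ^ 8 - p ^ 2 * g + 2 * p ^ 3 * g
      + p ^ 4 * g - 4 * p ^ 5 * g + p ^ 6 * g + 2 * p ^ 7 * g - p ^ 8 * g + p * g ^ 2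
      + 2 * p ^ 2 * g ^ 2 - 8 * p ^ 3 * g ^ 2 + 7 * p ^ 4 * g ^ 2 - 7 * p ^ 5 * g ^ 2
      + 8 * p ^ 6 * g ^ 2 - 2 * p ^ 7 * g ^ 2 - p ^ 8 * g ^ 2 - g ^ 3 - 6 * p * g ^ 3
      + 6 * p ^ 3 * g ^ 3 + 2 * p ^ 4 * g ^ 3 + 6 * p ^ 5 * g ^ 3 - 6 * p ^ 7 * g ^ 3 - p ^ 8 * g ^ 3
      - g ^ 4 - 2 * p * g ^ 4 + 8 * p ^ 2 * g ^ 4 - 7 * p ^ 3 * g ^ 4 + 7 * p ^ 4 * g ^ 4
      - 8 * p ^ 5 * g ^ 4 + 2 * p ^ 6 * g ^ 4 + p ^ 7 * g ^ 4 - g ^ 5 + 2 * p * g ^ 5 + p ^ 2 * g ^ 5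
      - 4 * p ^ 3 * g ^ 5 + p ^ 4 * g ^ 5 + 2 * p ^ 5 * g ^ 5 - p ^ 6 * g ^ 5 - g ^ 6 + 5 * p * g ^ 6
      - 10 * p ^ 2 * g ^ 6 + 10 * p ^ 3 * g ^ 6 - 5 * p ^ 4 * g ^ 6 + p ^ 5 * g ^ 6)"
    by algebra
  then have "(1 - g ^ 4) * (p ^ 4 - g ^ 4) * ?W = 16 * p * ((p ^ 4 - g ^ 4) ^ 2 + p ^ 4 * (1 - g ^ 4) ^ 2)"
    unfolding curve by simp
  then have "(p ^ 4 - g ^ 4) ^ 2 * (L * ?W) = (p ^ 4 - g ^ 4) ^ 2 * (16 * p * (1 + p ^ 4 * L ^ 2))"
    unfolding L[symmetric] by (simp add: algebra_simps power2_eq_square)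
  then show ?thesis using nz by simp
qed

context
  fixes q :: real
  assumes q0: "0 < q" and q1: "q < 1"
begin

lemma abs_q: "\<bar>q\<bar> < 1" using q0 q1 by simp

lemma F_pos: "k > 0 \<Longrightarrow> qpow q k k > 0"
  by (rule qpow_pos[OF abs_q])

lemma th3_eq: "th3 q = qpow q 2 2 ^ 5 / (qpow q 1 1 ^ 2 * qpow q 4 4 ^ 2)"
  unfolding th3_def by (rule phi_eq[OF abs_q])

lemma th4_eq: "th4 q = qpow q 1 1 ^ 2 / qpow q 2 2"
proof -
  have "th4 q = qpow q 2 2 ^ 5 / (qpow (- q) 1 1 ^ 2 * qpow q 4 4 ^ 2)"
    unfolding th4_def using phi_eq[of "- q"] abs_q by (simp add: qpow_uminus_even)
  also have "qpow (- q) 1 1 = qpow q 2 2 ^ 3 / (qpow q 1 1 * qpow q 4 4)"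
    by (rule qpow_uminus_1[OF abs_q])
  finally show ?thesis
    using F_pos[of 1] F_pos[of 2] F_pos[of 4] by (simp add: field_simps eval_nat_numeral)
qed

lemma th_pos: "th3 q > 0" "th4 q > 0" "th2sq q > 0"
  unfolding th3_eq th4_eq th2sq_def
  using F_pos[of 1] F_pos[of 2] F_pos[of 4] q0 by simp_all

end

text \<open>One arithmetic-geometric mean step applied to (\<theta>_3^2, \<theta>_4^2) squares the
  nome. The sum is \<open>phi_2_eq\<close> at q plus the same at -q, where the \<psi> terms
  cancel.\<close>

lemma agm_th34:
  assumes "0 < q" "q < 1"
  shows "th3 q ^ 2 + th4 q ^ 2 = 2 * th3 (q ^ 2) ^ 2" "th3 q * th4 q = th4 (q ^ 2) ^ 2"
proof -
  have p2: "0 < q ^ 2" "q ^ 2 < 1"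
    using assms by (simp_all add: power_less_one_iff)
  show "th3 q ^ 2 + th4 q ^ 2 = 2 * th3 (q ^ 2) ^ 2"
    using phi_2_eq[of q] phi_2_eq[of "- q"] assms by (simp add: th3_def th4_def qpow_uminus_even)
  show "th3 q * th4 q = th4 (q ^ 2) ^ 2"
    unfolding th3_eq[OF assms] th4_eq[OF assms] th4_eq[OF p2(1,2)] qpow_power
    using F_pos[OF assms, of 1] F_pos[OF assms, of 2] F_pos[OF assms, of 4]
    by (simp add: field_simps eval_nat_numeral)
qed

text \<open>For (\<theta>_3^2, \<theta>_2^2) the mean step goes the other way: from the nome q^2 it
  leads to half the pair at q.\<close>

lemma agm_th32:
  assumes "0 < q" "q < 1"
  shows "th3 (q ^ 2) ^ 2 + th2sq (q ^ 2) = th3 q ^ 2" "4 * (th3 (q ^ 2) ^ 2 * th2sq (q ^ 2)) = th2sq q ^ 2"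
proof -
  have p2: "0 < q ^ 2" "q ^ 2 < 1"
    using assms by (simp_all add: power_less_one_iff)
  have s: "sqrt (q ^ 2) = q" using assms by simp
  show "th3 (q ^ 2) ^ 2 + th2sq (q ^ 2) = th3 q ^ 2"
    using phi_2_eq[of q] assms by (simp add: th3_def th2sq_def qpow_power)
  show "4 * (th3 (q ^ 2) ^ 2 * th2sq (q ^ 2)) = th2sq q ^ 2"
    unfolding th3_eq[OF p2(1,2)] th2sq_def qpow_power s
    using F_pos[OF assms, of 2] F_pos[OF assms, of 4] F_pos[OF assms, of 8] assms
    by (simp add: power_divide power_mult_distrib field_simps power_mult[symmetric] flip: numeral_2_eq_2)
qed

text \<open>With A = \<theta>_3(q^2)^2 and B = \<theta>_2(q^2)^2, the squares of \<theta>_3 and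
  \<theta>_4 at q are A + B and A - B, and \<theta>_2(q)^4 = 4AB.\<close>

lemma jacobi_th:
  assumes "0 < q" "q < 1"
  shows "th3 q ^ 4 = th4 q ^ 4 + th2sq q ^ 2"
  using agm_th34(1)[OF assms] agm_th32[OF assms] by algebra

text \<open>The \<open>f\<close> variables stand for Euler products at powers of q,
  \<open>lam\<close> for \<theta>_2(q)/\<theta>_2(q^5), \<open>a\<close> and \<open>d\<close> for
  \<theta>_3 and \<theta>_4 at q, \<open>A\<close> and \<open>D\<close> for their values at q^5. The
  first two parts say Q/P = \<lambda>\<nu> and V/U = \<lambda>\<mu>, which turns the relations of
  degree 5 into polynomial ones.\<close>

lemma degree_5_products:
  fixes f1 f2 f4 f5 f10 f20 q :: real
  assumes pos: "q > 0" "f1 > 0" "f2 > 0" "f4 > 0" "f5 > 0" "f10 > 0" "f20 > 0"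
  defines "lam \<equiv> f4 ^ 2 * f10 / (q * f2 * f20 ^ 2)"
    and "a \<equiv> f2 ^ 5 / (f1 ^ 2 * f4 ^ 2)" and "A \<equiv> f10 ^ 5 / (f5 ^ 2 * f20 ^ 2)"
    and "d \<equiv> f1 ^ 2 / f2" and "D \<equiv> f5 ^ 2 / f10"
    and "P \<equiv> q * f2 ^ 2 * f5 * f20 / (f1 * f4)" and "Q \<equiv> f10 ^ 2 * f1 * f4 / (f5 * f20)"
    and "U \<equiv> q * f10 ^ 3 * f1 / (f5 * f2)" and "V \<equiv> f2 ^ 3 * f5 / (f1 * f10)"
  shows "P * (lam * (d / D)) = Q" "U * (lam * (a / A)) = V"
    "16 * q * f4 ^ 8 / f2 ^ 4 * d ^ 4 * a ^ 2 * A ^ 2 = 16 * Q ^ 5 * P"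
    "lam * (d / D) ^ 4 * (a / A) = f1 ^ 6 / (q * f5 ^ 6)"
  unfolding lam_def a_def A_def d_def D_def P_def Q_def U_def V_def using pos
  by (simp_all add: divide_simps) algebra+

text \<open>The first and third are \<open>phi_5_eq\<close> at q and -q. The second and fourth are
  \<open>psi_5_eq\<close> at -q and q, multiplied by the quotient of Euler products that turns its
  right side into \<theta>_3(q^5)^2 or \<theta>_4(q^5)^2.\<close>

lemma degree_5_relations:
  assumes "0 < q" "q < 1"
  defines "f1 \<equiv> qpow q 1 1" and "f2 \<equiv> qpow q 2 2" and "f4 \<equiv> qpow q 4 4"
    and "f5 \<equiv> qpow q 5 5" and "f10 \<equiv> qpow q 10 10" and "f20 \<equiv> qpow q 20 20"
  shows "th3 q ^ 2 - th3 (q ^ 5) ^ 2 = 4 * (q * f2 ^ 2 * f5 * f20 / (f1 * f4))"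
    "th3 (q ^ 5) ^ 2 = q * f2 ^ 2 * f5 * f20 / (f1 * f4) + f10 ^ 2 * f1 * f4 / (f5 * f20)"
    "th4 q ^ 2 - th4 (q ^ 5) ^ 2 = - 4 * (q * f10 ^ 3 * f1 / (f5 * f2))"
    "th4 (q ^ 5) ^ 2 = f2 ^ 3 * f5 / (f1 * f10) - q * f10 ^ 3 * f1 / (f5 * f2)"
proof -
  note q = abs_q[OF assms(1,2)]
  have mq: "\<bar>- q\<bar> < 1" using q by simp
  have p5: "0 < q ^ 5" "q ^ 5 < 1"
    using assms by (simp_all add: power_less_one_iff)
  have pos: "f1 > 0" "f2 > 0" "f4 > 0" "f5 > 0" "f10 > 0" "f20 > 0"
    unfolding f1_def f2_def f4_def f5_def f10_def f20_def using F_pos[OF assms(1,2)] by simp_all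
  have m1: "qpow (- q) 1 1 = f2 ^ 3 / (f1 * f4)" and m5: "qpow (- q) 5 5 = f10 ^ 3 / (f5 * f20)"
    unfolding f1_def f2_def f4_def f5_def f10_def f20_def
    using qpow_uminus_1[OF q] qpow_uminus_5[OF q] by simp_all
  have m: "qpow (- q) 2 2 = f2" "qpow (- q) 4 4 = f4" "qpow (- q) 10 10 = f10" "qpow (- q) 20 20 = f20"
    unfolding f2_def f4_def f10_def f20_def by (simp_all add: qpow_uminus_even)
  have A: "th3 (q ^ 5) = f10 ^ 5 / (f5 ^ 2 * f20 ^ 2)" and D: "th4 (q ^ 5) = f5 ^ 2 / f10"
    unfolding th3_eq[OF p5] th4_eq[OF p5] qpow_power by (simp_all add: f5_def f10_def f20_def)
  show "th3 q ^ 2 - th3 (q ^ 5) ^ 2 = 4 * (q * f2 ^ 2 * f5 * f20 / (f1 * f4))"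
    using phi_5_eq[OF q] by (simp add: th3_def f1_def f2_def f4_def f5_def f20_def ac_simps)
  have "(- q) ^ 5 = - (q ^ 5)" by simp
  then show "th4 q ^ 2 - th4 (q ^ 5) ^ 2 = - 4 * (q * f10 ^ 3 * f1 / (f5 * f2))"
    using phi_5_eq[OF mq] pos unfolding m1 m5 m
    by (simp add: th4_def field_simps eval_nat_numeral)
  have 3: "f2 ^ 4 / f1 ^ 2 - q * f10 ^ 4 / f5 ^ 2 = f2 * f5 ^ 3 / (f1 * f10)"
    using psi_5_eq[OF q] by (simp add: f1_def f2_def f5_def f10_def)
  have "f5 ^ 4 / f10 ^ 2 = f2 * f5 ^ 3 / (f1 * f10) * (f1 * f5 / (f2 * f10))"
    using pos by (simp add: field_simps eval_nat_numeral)
  also have "\<dots> = f2 ^ 3 * f5 / (f1 * f10) - q * f10 ^ 3 * f1 / (f5 * f2)"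
    unfolding 3[symmetric] using pos by (simp add: field_simps eval_nat_numeral)
  finally show "th4 (q ^ 5) ^ 2 = f2 ^ 3 * f5 / (f1 * f10) - q * f10 ^ 3 * f1 / (f5 * f2)"
    by (simp add: D power_divide flip: power_mult)
  have 4: "f2 ^ 4 / (f2 ^ 3 / (f1 * f4)) ^ 2 + q * f10 ^ 4 / (f10 ^ 3 / (f5 * f20)) ^ 2
      = f2 * (f10 ^ 3 / (f5 * f20)) ^ 3 / (f2 ^ 3 / (f1 * f4) * f10)"
    using psi_5_eq[OF mq] unfolding m1 m5 m by simp
  have "f10 ^ 10 / (f5 * f20) ^ 4 = f2 * (f10 ^ 3 / (f5 * f20)) ^ 3 / (f2 ^ 3 / (f1 * f4) * f10) * (f2 ^ 2 * f10 ^ 2 / (f1 * f4 * f5 * f20))"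
    using pos by (simp add: field_simps eval_nat_numeral)
  also have "\<dots> = q * f2 ^ 2 * f5 * f20 / (f1 * f4) + f10 ^ 2 * f1 * f4 / (f5 * f20)"
    unfolding 4[symmetric] using pos by (simp add: field_simps eval_nat_numeral)
  finally show "th3 (q ^ 5) ^ 2 = q * f2 ^ 2 * f5 * f20 / (f1 * f4) + f10 ^ 2 * f1 * f4 / (f5 * f20)"
    by (simp add: A power_divide power_mult_distrib flip: power_mult)
qed

theorem modular_equation_5:
  assumes "0 < q" "q < 1"
  defines "k \<equiv> th2sq q / th3 q ^ 2" and "l \<equiv> th2sq (q ^ 5) / th3 (q ^ 5) ^ 2"
    and "m \<equiv> th3 q ^ 2 / th3 (q ^ 5) ^ 2"
  defines "w \<equiv> sqrt (k * l)"
  defines "c \<equiv> (1 - k ^ 2) * (k / w) ^ 5 / ((k / w) ^ 4 - k ^ 2)"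
  shows "k ^ 6 + k ^ 3 * (- 16 + 10 * k\<^sup>2) * w + 15 * k ^ 4 * w\<^sup>2
          - 20 * k ^ 3 * w ^ 3 + 15 * k\<^sup>2 * w ^ 4
          + k * (10 - 16 * k\<^sup>2) * w ^ 5 + w ^ 6 = 0" (is ?ii)
    and "(m - 5) ^ 5 * (m - 1) + 256 * (1 - k ^ 2) * k ^ 2 * m ^ 5 = 0" (is ?i)
    and "m ^ 3 * c = qpow q 1 1 ^ 6 / (q * qpow q 5 5 ^ 6)" (is ?c)
    and "c > 0"
proof -
  define f1 f2 f4 f5 f10 f20
    where "f1 = qpow q 1 1" and "f2 = qpow q 2 2" and "f4 = qpow q 4 4"
    and "f5 = qpow q 5 5" and "f10 = qpow q 10 10" and "f20 = qpow q 20 20"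
  note fdef = f1_def f2_def f4_def f5_def f10_def f20_def
  have pos: "f1 > 0" "f2 > 0" "f4 > 0" "f5 > 0" "f10 > 0" "f20 > 0"
    unfolding fdef using F_pos[OF assms(1,2)] by simp_all
  have p5: "0 < q ^ 5" "q ^ 5 < 1"
    using assms by (simp_all add: power_less_one_iff)
  define a A d D b B where "a = th3 q" and "A = th3 (q ^ 5)" and "d = th4 q" and "D = th4 (q ^ 5)"
    and "b = th2sq q" and "B = th2sq (q ^ 5)"
  note tdef = a_def A_def d_def D_def b_def B_def
  have tpos: "a > 0" "A > 0" "d > 0" "D > 0" "b > 0" "B > 0"
    unfolding tdef using th_pos[OF assms(1,2)] th_pos[OF p5] by simp_all
  have prod: "a = f2 ^ 5 / (f1 ^ 2 * f4 ^ 2)" "A = f10 ^ 5 / (f5 ^ 2 * f20 ^ 2)"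
    "d = f1 ^ 2 / f2" "D = f5 ^ 2 / f10"
    unfolding tdef fdef th3_eq[OF p5] th4_eq[OF p5] th3_eq[OF assms(1,2)] th4_eq[OF assms(1,2)] qpow_power
    by simp_all
  have B: "B = 4 * (q ^ 2 * sqrt q) * f20 ^ 4 / f10 ^ 2" and b: "b = 4 * sqrt q * f4 ^ 4 / f2 ^ 2"
  proof -
    have "sqrt (q ^ 5) = sqrt ((q ^ 2) ^ 2 * q)" by (simp add: eval_nat_numeral)
    also have "\<dots> = q ^ 2 * sqrt q" by (simp only: real_sqrt_mult real_sqrt_abs) simp
    finally show "B = 4 * (q ^ 2 * sqrt q) * f20 ^ 4 / f10 ^ 2"
      unfolding B_def th2sq_def qpow_power by (simp add: f20_def f10_def)
    show "b = 4 * sqrt q * f4 ^ 4 / f2 ^ 2" by (simp add: b_def th2sq_def f4_def f2_def)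
  qed
  have jac: "a ^ 4 = d ^ 4 + b ^ 2" "A ^ 4 = D ^ 4 + B ^ 2"
    unfolding tdef using jacobi_th[OF assms(1,2)] jacobi_th[OF p5] by simp_all
  define lam where "lam = f4 ^ 2 * f10 / (q * f2 * f20 ^ 2)"
  define P Q U V where "P = q * f2 ^ 2 * f5 * f20 / (f1 * f4)" and "Q = f10 ^ 2 * f1 * f4 / (f5 * f20)"
    and "U = q * f10 ^ 3 * f1 / (f5 * f2)" and "V = f2 ^ 3 * f5 / (f1 * f10)"
  note rel = degree_5_relations[OF assms(1,2), folded fdef, folded P_def Q_def U_def V_def, folded tdef]
  note prods = degree_5_products[OF assms(1) pos, folded prod, folded lam_def P_def Q_def U_def V_def]
  have lam0: "lam > 0" unfolding lam_def using pos assms(1) by simp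
  have lamB: "b = lam ^ 2 * B"
    unfolding lam_def B b using pos assms(1) by (simp add: field_simps eval_nat_numeral)
  define \<mu> \<nu> where "\<mu> = a / A" and "\<nu> = d / D"
  have munu: "\<mu> > 0" "\<nu> > 0" "a = \<mu> * A" "d = \<nu> * D" using tpos by (simp_all add: \<mu>_def \<nu>_def)
  have R1: "(\<mu> ^ 2 - 1) * (1 + lam * \<nu>) = 4"
  proof -
    have "(a ^ 2 - A ^ 2) * (1 + lam * \<nu>) = 4 * A ^ 2"
      using rel(1,2) prods(1) unfolding \<nu>_def by algebra
    then have "A ^ 2 * ((\<mu> ^ 2 - 1) * (1 + lam * \<nu>)) = A ^ 2 * 4"
      unfolding munu(3) by algebra
    then show ?thesis using tpos by simp
  qed
  have R2: "(\<nu> ^ 2 - 1) * (1 - lam * \<mu>) = 4"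
  proof -
    have "(d ^ 2 - D ^ 2) * (1 - lam * \<mu>) = 4 * D ^ 2"
      using rel(3,4) prods(2) unfolding \<mu>_def by algebra
    then have "D ^ 2 * ((\<nu> ^ 2 - 1) * (1 - lam * \<mu>)) = D ^ 2 * 4"
      unfolding munu(4) by algebra
    then show ?thesis using tpos by simp
  qed
  \<comment> \<open>Elimination of \<lambda> from \<open>R1\<close> and \<open>R2\<close>; the
    result carries the positive factor \<mu> + \<nu>, which is cancelled.\<close>
  have quart: "\<mu> ^ 2 * \<nu> ^ 2 - 4 * \<mu> * \<nu> + 5 = \<mu> ^ 2 + \<nu> ^ 2"
  proof -
    have "(\<mu> + \<nu>) * (\<mu> ^ 2 * \<nu> ^ 2 - 4 * \<mu> * \<nu> + 5) = (\<mu> + \<nu>) * (\<mu> ^ 2 + \<nu> ^ 2)"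
    proof -
      have X: "5 - \<mu> ^ 2 = lam * \<nu> * (\<mu> ^ 2 - 1)" and Y: "\<nu> ^ 2 - 5 = lam * \<mu> * (\<nu> ^ 2 - 1)"
        using R1 R2 by (simp_all add: algebra_simps)
      have "\<mu> * (\<nu> ^ 2 - 1) * (5 - \<mu> ^ 2) = \<nu> * (\<mu> ^ 2 - 1) * (\<nu> ^ 2 - 5)"
        unfolding X Y by algebra
      then show ?thesis by algebra
    qed
    then show ?thesis using munu by simp
  qed
  \<comment> \<open>By \<open>quart\<close> the first relation acquires the factor \<nu> throughout.
    Once it is cancelled, division by \<mu> leaves only \<mu>^2 besides the ratios p and g.\<close>
  have S: "(lam + \<nu>) * (\<mu> ^ 2 - 1) = 4 * \<mu>"
  proof -
    have "\<nu> * ((lam + \<nu>) * (\<mu> ^ 2 - 1)) = \<nu> * (4 * \<mu>)"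
      using R1 quart by (simp add: algebra_simps power2_eq_square)
    then show ?thesis using munu by simp
  qed
  \<comment> \<open>p will turn out to be \<open>k / w\<close>, the starred modulus, and L to be
    \<open>l ^ 2\<close>. In these ratios \<mu>^2 can be eliminated, which leaves the curve.\<close>
  define p g L where "p = lam / \<mu>" and "g = \<nu> / \<mu>" and "L = B ^ 2 / A ^ 4"
  have pg: "p > 0" "g > 0" "lam = p * \<mu>" "\<nu> = g * \<mu>"
    using munu lam0 by (simp_all add: p_def g_def)
  have S': "(p + g) * (\<mu> ^ 2 - 1) = 4"
  proof -
    have "\<mu> * ((p + g) * (\<mu> ^ 2 - 1)) = \<mu> * 4" using S unfolding pg(3,4) by algebra
    then show ?thesis using munu by simp
  qed
  have curve: "(p - 1) * g ^ 2 + (p + 1) ^ 2 * g - p * (p - 1) = 0"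
  proof -
    have "(\<mu> ^ 2 - 1) * (1 + \<mu> ^ 2 * (p * g)) = 4"
      using R1 unfolding pg(3,4) by (simp add: algebra_simps power2_eq_square)
    then have "(\<mu> ^ 2 - 1) * (1 + \<mu> ^ 2 * (p * g)) = (\<mu> ^ 2 - 1) * (p + g)"
      using S' by (simp only: mult.commute)
    moreover have "\<mu> ^ 2 - 1 \<noteq> 0" using S' by auto
    ultimately have "1 + \<mu> ^ 2 * (p * g) = p + g" by simp
    then have "(p + g) * (1 + \<mu> ^ 2 * (p * g)) = (p + g) ^ 2"
      by (simp add: power2_eq_square)
    moreover have "(p + g) * (1 + \<mu> ^ 2 * (p * g)) = (p + g) * (1 + p * g) + ((p + g) * (\<mu> ^ 2 - 1)) * (p * g)"
      by (simp add: algebra_simps)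
    ultimately have "(p + g) * (1 + p * g) + 4 * (p * g) = (p + g) ^ 2"
      unfolding S' by simp
    then show ?thesis by (simp add: algebra_simps power2_eq_square)
  qed
  \<comment> \<open>Jacobi's quartic identities at q and q^5, divided by a^4, read 1 = g^4 (1 - L) +
    p^4 L.\<close>
  have "A ^ 4 * L = B ^ 2" using tpos by (simp add: L_def)
  moreover have "\<mu> ^ 4 * p ^ 4 * B ^ 2 = b ^ 2" unfolding lamB pg(3) by algebra
  ultimately have "A ^ 4 * \<mu> ^ 4 * (L * (p ^ 4 - g ^ 4)) = A ^ 4 * \<mu> ^ 4 * (1 - g ^ 4)"
    using jac munu(3,4) pg(4) by algebra
  then have L: "L * (p ^ 4 - g ^ 4) = 1 - g ^ 4" using tpos munu by simp
  note W = modular_parametrization[OF curve L pg(1,2)]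
  have l: "l > 0" "l ^ 2 = L" and l': "l = B / A ^ 2"
    using tpos by (simp_all add: l_def L_def power_divide flip: tdef power_mult)
  have k: "k = l * p ^ 2"
  proof -
    have "k = b / a ^ 2" by (simp add: k_def tdef)
    also have "\<dots> = l * p ^ 2" unfolding lamB munu(3) pg(3) l' using tpos munu
      by (simp add: field_simps eval_nat_numeral)
    finally show ?thesis .
  qed
  have w: "w = l * p"
  proof -
    have "k * l = (l * p) ^ 2" unfolding k by algebra
    then show ?thesis unfolding w_def using l pg by simp
  qed
  \<comment> \<open>The left side is l^4 p^6 times the difference of the two sides of
    \<open>W\<close>.\<close>
  show ?ii using W unfolding k w l(2)[symmetric] by algebra
  have k2: "1 - k ^ 2 = d ^ 4 / a ^ 4"
  proof -
    have "k ^ 2 = b ^ 2 / a ^ 4" by (simp add: k_def tdef power_divide flip: power_mult)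
    also have "b ^ 2 = a ^ 4 - d ^ 4" using jac by simp
    finally show ?thesis using tpos by (simp add: diff_divide_distrib)
  qed
  have l2: "1 - l ^ 2 = D ^ 4 / A ^ 4"
  proof -
    have "l ^ 2 = (A ^ 4 - D ^ 4) / A ^ 4" using jac by (simp add: l L_def)
    then show ?thesis using tpos by (simp add: diff_divide_distrib)
  qed
  have kw: "k / w = p" unfolding k w using l pg by (simp add: power2_eq_square)
  have mm: "m = \<mu> ^ 2" by (simp add: m_def \<mu>_def power_divide flip: tdef)
  have c: "c = d ^ 4 / a ^ 4 * p * A ^ 4 / D ^ 4"
  proof -
    have "p ^ 4 - k ^ 2 = p ^ 4 * (1 - l ^ 2)" unfolding k by algebra
    then have "c = d ^ 4 / a ^ 4 * p ^ 5 / (p ^ 4 * (D ^ 4 / A ^ 4))"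
      unfolding c_def kw k2 by (simp only: l2)
    also have "\<dots> = d ^ 4 / a ^ 4 * p * A ^ 4 / D ^ 4"
      using pg tpos by (simp add: field_simps eval_nat_numeral)
    finally show ?thesis .
  qed
  then show "c > 0" using pg tpos by simp
  have "m ^ 3 * c = lam * (d / D) ^ 4 * (a / A)"
    unfolding c mm \<mu>_def p_def using tpos
    by (simp add: field_simps) (simp add: eval_nat_numeral)
  then show ?c unfolding prods(4) by (simp add: fdef)
  \<comment> \<open>Since A^2 = P + Q and a^2 = A^2 + 4P, both m - 1 and m - 5 are single products;
    this singles out (m - 5)^5 (m - 1) as a quotient of Euler products.\<close>
  have mA: "A ^ 2 * (m - 1) = 4 * P" "A ^ 2 * (m - 5) = - 4 * Q"
  proof -
    have "A ^ 2 * m = a ^ 2" using tpos by (simp add: m_def tdef)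
    then show "A ^ 2 * (m - 1) = 4 * P" "A ^ 2 * (m - 5) = - 4 * Q" using rel(1,2) by algebra+
  qed
  have "a ^ 8 * (k ^ 2 * (1 - k ^ 2)) = b ^ 2 * d ^ 4"
  proof -
    have "k ^ 2 = b ^ 2 / a ^ 4" by (simp add: k_def tdef power_divide flip: power_mult)
    then show ?thesis unfolding k2 using tpos by (simp add: field_simps eval_nat_numeral)
  qed
  moreover have "b ^ 2 * d ^ 4 * a ^ 2 * A ^ 2 = 16 * Q ^ 5 * P"
  proof -
    have "b ^ 2 = 16 * q * f4 ^ 8 / f2 ^ 4"
      unfolding b using assms(1) by (simp add: power_divide power_mult_distrib flip: power_mult)
    then show ?thesis using prods(3) by simp
  qed
  moreover have "A ^ 2 * m = a ^ 2" using tpos by (simp add: m_def tdef)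
  ultimately have "a ^ 8 * A ^ 12 * ((m - 5) ^ 5 * (m - 1) + 256 * (1 - k ^ 2) * k ^ 2 * m ^ 5) = 0"
  proof -
    assume 1: "a ^ 8 * (k ^ 2 * (1 - k ^ 2)) = b ^ 2 * d ^ 4"
      and 2: "b ^ 2 * d ^ 4 * a ^ 2 * A ^ 2 = 16 * Q ^ 5 * P" and 3: "A ^ 2 * m = a ^ 2"
    have "A ^ 12 * ((m - 5) ^ 5 * (m - 1)) = (A ^ 2 * (m - 5)) ^ 5 * (A ^ 2 * (m - 1))" by algebra
    also have "\<dots> = - 4096 * Q ^ 5 * P" unfolding mA by algebra
    finally have 4: "A ^ 12 * ((m - 5) ^ 5 * (m - 1)) = - 4096 * Q ^ 5 * P" .
    have "a ^ 8 * A ^ 12 * (256 * (1 - k ^ 2) * k ^ 2 * m ^ 5) =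
      256 * (a ^ 8 * (k ^ 2 * (1 - k ^ 2))) * (A ^ 2 * m) ^ 5 * A ^ 2" by algebra
    also have "\<dots> = 256 * (b ^ 2 * d ^ 4 * a ^ 2 * A ^ 2) * a ^ 8" unfolding 1 3 by algebra
    finally show ?thesis using 4 unfolding 2 by algebra
  qed
  then show ?i using tpos by simp
qed

section \<open>Elliptic integrals and the arithmetic-geometric mean\<close>

text \<open>Gauss's form of the complete integral: homogeneous of degree -1 and invariant under the
  arithmetic-geometric mean step.\<close>

definition ellI :: "real \<Rightarrow> real \<Rightarrow> real" where
  "ellI a b = integral {0..pi/2} (\<lambda>t. 1 / sqrt (a\<^sup>2 * (cos t)\<^sup>2 + b\<^sup>2 * (sin t)\<^sup>2))"

lemma ell_form_pos:
  fixes a b t :: real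
  assumes "a > 0" "b > 0"
  shows "a * (cos t)\<^sup>2 + b * (sin t)\<^sup>2 > 0"
proof -
  have "min a b * ((cos t)\<^sup>2 + (sin t)\<^sup>2) \<le> a * (cos t)\<^sup>2 + b * (sin t)\<^sup>2"
    unfolding distrib_left by (intro add_mono mult_right_mono) auto
  then have "min a b \<le> a * (cos t)\<^sup>2 + b * (sin t)\<^sup>2" by simp
  moreover have "min a b > 0" using assms by simp
  ultimately show ?thesis by (rule less_le_trans[rotated])
qed

lemma continuous_on_ell_integrand:
  assumes "a > 0" "b > 0"
  shows "continuous_on S (\<lambda>t. 1 / sqrt (a\<^sup>2 * (cos t)\<^sup>2 + b\<^sup>2 * (sin t)\<^sup>2))"
proof (intro continuous_intros)
  have "a\<^sup>2 * (cos t)\<^sup>2 + b\<^sup>2 * (sin t)\<^sup>2 > 0" for t :: real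
    using assms by (intro ell_form_pos) auto
  then show "\<forall>t\<in>S. sqrt (a\<^sup>2 * (cos t)\<^sup>2 + b\<^sup>2 * (sin t)\<^sup>2) \<noteq> 0"
    by (metis less_irrefl real_sqrt_gt_zero)
qed

lemma integrable_ell:
  assumes "a > 0" "b > 0"
  shows "(\<lambda>t. 1 / sqrt (a\<^sup>2 * (cos t)\<^sup>2 + b\<^sup>2 * (sin t)\<^sup>2)) integrable_on {u..v}"
  using continuous_on_ell_integrand[OF assms] by (rule integrable_continuous_real)

text \<open>The integrand is even and has period pi.\<close>

lemma ellI_half_period:
  assumes "a > 0" "b > 0"
  shows "integral {0..pi} (\<lambda>t. 1 / sqrt (a\<^sup>2 * (cos t)\<^sup>2 + b\<^sup>2 * (sin t)\<^sup>2)) = 2 * ellI a b"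
proof -
  define f where "f = (\<lambda>t. 1 / sqrt (a\<^sup>2 * (cos t)\<^sup>2 + b\<^sup>2 * (sin t)\<^sup>2))"
  have "integral {0..pi} f = integral {0..pi/2} f + integral {pi/2..pi} f"
    unfolding f_def by (rule Henstock_Kurzweil_Integration.integral_combine[symmetric, OF _ _ integrable_ell[OF assms]]) auto
  also have "integral {pi/2..pi} f = integral {- pi/2 + pi..0 + pi} f" by simp
  also have "\<dots> = integral {- pi/2..0} (f \<circ> (\<lambda>x. x + pi))"
    by (rule integral_shift[symmetric]) (use continuous_on_ell_integrand[OF assms] in \<open>simp add: f_def\<close>)
  also have "f \<circ> (\<lambda>x. x + pi) = (\<lambda>x. f (- x))" by (auto simp: f_def fun_eq_iff)
  also have "integral {- pi/2..0} (\<lambda>x. f (- x)) = integral {0..pi/2} f"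
    using Henstock_Kurzweil_Integration.integral_reflect_real[of "pi/2" 0 f] by simp
  finally show ?thesis by (simp add: f_def ellI_def)
qed

text \<open>Gauss's transformation. The substitution is \<open>u = t + arctan ((b/a) tan t)\<close>, written so that
  it is smooth up to \<open>t = \<pi>/2\<close>; it maps \<open>[0, \<pi>/2]\<close> onto \<open>[0, \<pi>]\<close>.\<close>

lemma ellI_agm:
  assumes "a > 0" "b > 0"
  shows "ellI a b = ellI ((a + b) / 2) (sqrt (a * b))"
proof -
  define c where "c = (a + b) / 2"
  have c: "c > 0" and sab: "sqrt (a * b) > 0" using assms by (simp_all add: c_def)
  define E where "E = (\<lambda>t. a * (cos t)\<^sup>2 + b * (sin t)\<^sup>2)"
  define \<Delta> where "\<Delta> = (\<lambda>t. a\<^sup>2 * (cos t)\<^sup>2 + b\<^sup>2 * (sin t)\<^sup>2)"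
  \<comment> \<open>\<open>h t\<close> is the tangent of t - arctan((b/a) tan t), rewritten with the
    denominator E, which never vanishes; the substitution is 2t minus this angle.\<close>
  define h where "h = (\<lambda>t. (a - b) * sin t * cos t / E t)"
  define g where "g = (\<lambda>t. 2 * t - arctan (h t))"
  define f where "f = (\<lambda>u. 1 / sqrt (c\<^sup>2 * (cos u)\<^sup>2 + (sqrt (a * b))\<^sup>2 * (sin u)\<^sup>2))"
  have E: "E t > 0" for t using ell_form_pos[OF assms] by (simp add: E_def)
  have \<Delta>: "\<Delta> t > 0" for t using ell_form_pos[of "a\<^sup>2" "b\<^sup>2"] assms by (simp add: \<Delta>_def)
  have cs: "(cos t)\<^sup>2 = 1 - (sin t)\<^sup>2" for t :: real by (rule cos_squared_eq)
  have hE: "(E t)\<^sup>2 + ((a - b) * sin t * cos t)\<^sup>2 = \<Delta> t" for t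
    unfolding E_def \<Delta>_def power_mult_distrib cs by algebra
  have h1: "1 + (h t)\<^sup>2 = \<Delta> t / (E t)\<^sup>2" for t
    unfolding hE[symmetric] h_def using E[of t] by (simp add: field_simps)
  have cosA: "cos (arctan (h t)) = E t / sqrt (\<Delta> t)" for t
    using E[of t] by (simp add: cos_arctan h1 real_sqrt_divide)
  have sinA: "sin (arctan (h t)) = (a - b) * sin t * cos t / sqrt (\<Delta> t)" for t
    using E[of t] by (simp add: sin_arctan h1 real_sqrt_divide) (simp add: h_def)
  have cosg: "cos (g t) = (a * (cos t)\<^sup>2 - b * (sin t)\<^sup>2) / sqrt (\<Delta> t)" for t
  proof -
    have "cos (g t) = (cos (2 * t) * E t + sin (2 * t) * ((a - b) * sin t * cos t)) / sqrt (\<Delta> t)"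
      unfolding g_def cos_diff cosA sinA by (simp add: add_divide_distrib)
    also have "cos (2 * t) * E t + sin (2 * t) * ((a - b) * sin t * cos t) = a * (cos t)\<^sup>2 - b * (sin t)\<^sup>2"
      unfolding E_def cos_double sin_double using cs[of t] by algebra
    finally show ?thesis .
  qed
  have sing: "sin (g t) = (a + b) * sin t * cos t / sqrt (\<Delta> t)" for t
  proof -
    have "sin (g t) = (sin (2 * t) * E t - cos (2 * t) * ((a - b) * sin t * cos t)) / sqrt (\<Delta> t)"
      unfolding g_def sin_diff cosA sinA by (simp add: diff_divide_distrib)
    also have "sin (2 * t) * E t - cos (2 * t) * ((a - b) * sin t * cos t) = (a + b) * sin t * cos t"
      unfolding E_def cos_double sin_double using cs[of t] by algebra
    finally show ?thesis .
  qed
  \<comment> \<open>At the new angle the quadratic form is (c E)^2 / \<Delta>, so E cancels against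
    the derivative of the substitution.\<close>
  have fg: "f (g t) = sqrt (\<Delta> t) / (c * E t)" for t
  proof -
    have "c\<^sup>2 * (cos (g t))\<^sup>2 + (sqrt (a * b))\<^sup>2 * (sin (g t))\<^sup>2 =
       (c\<^sup>2 * (a * (cos t)\<^sup>2 - b * (sin t)\<^sup>2)\<^sup>2 + (a * b) * ((a + b) * sin t * cos t)\<^sup>2) / \<Delta> t"
      unfolding cosg sing using \<Delta>[of t] assms by (simp add: power_divide add_divide_distrib)
    also have "c\<^sup>2 * (a * (cos t)\<^sup>2 - b * (sin t)\<^sup>2)\<^sup>2 + (a * b) * ((a + b) * sin t * cos t)\<^sup>2 = (c * E t)\<^sup>2"
      unfolding E_def c_def power_mult_distrib by (simp add: field_simps power2_eq_square)
    finally have "f (g t) = 1 / sqrt ((c * E t)\<^sup>2 / \<Delta> t)" by (simp add: f_def)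
    then show ?thesis
      using c E[of t] by (simp add: real_sqrt_divide)
  qed
  define g' where "g' = (\<lambda>t. 2 * c * E t / \<Delta> t)"
  have der: "(g has_field_derivative g' t) (at t within S)" for t S
  proof -
    have dE: "(E has_field_derivative (2 * (b - a) * sin t * cos t)) (at t within S)"
      unfolding E_def by (auto intro!: derivative_eq_intros simp: algebra_simps)
    have dN: "((\<lambda>t. (a - b) * sin t * cos t) has_field_derivative (a - b) * ((cos t)\<^sup>2 - (sin t)\<^sup>2)) (at t within S)"
      by (auto intro!: derivative_eq_intros simp: algebra_simps power2_eq_square)
    have dh: "(h has_field_derivative ((a - b) * ((cos t)\<^sup>2 - (sin t)\<^sup>2) * E t -
        (a - b) * sin t * cos t * (2 * (b - a) * sin t * cos t)) / (E t)\<^sup>2) (at t within S)"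
      unfolding h_def power2_eq_square[of "E t"]
      using DERIV_divide[OF dN dE] E[of t] by simp
    have "(g has_field_derivative 2 - inverse (1 + (h t)\<^sup>2) * (((a - b) * ((cos t)\<^sup>2 - (sin t)\<^sup>2) * E t -
        (a - b) * sin t * cos t * (2 * (b - a) * sin t * cos t)) / (E t)\<^sup>2)) (at t within S)"
      unfolding g_def by (intro DERIV_diff DERIV_chain2[OF DERIV_arctan dh]) (auto intro!: derivative_eq_intros)
    also have "2 - inverse (1 + (h t)\<^sup>2) * (((a - b) * ((cos t)\<^sup>2 - (sin t)\<^sup>2) * E t -
        (a - b) * sin t * cos t * (2 * (b - a) * sin t * cos t)) / (E t)\<^sup>2) =
      (2 * \<Delta> t - ((a - b) * ((cos t)\<^sup>2 - (sin t)\<^sup>2) * E t -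
        (a - b) * sin t * cos t * (2 * (b - a) * sin t * cos t))) / \<Delta> t"
      unfolding h1 using E[of t] \<Delta>[of t] by (simp add: field_simps)
    also have "2 * \<Delta> t - ((a - b) * ((cos t)\<^sup>2 - (sin t)\<^sup>2) * E t -
        (a - b) * sin t * cos t * (2 * (b - a) * sin t * cos t)) = 2 * c * E t"
      unfolding \<Delta>_def E_def c_def using cs[of t] by algebra
    finally show ?thesis by (simp add: g'_def)
  qed
  have g0: "g 0 = 0" "g (pi/2) = pi" by (simp_all add: g_def h_def)
  have "((\<lambda>t. g' t *\<^sub>R f (g t)) has_integral (integral {g 0..g (pi/2)} f)) {0..pi/2}"
  proof (rule has_integral_substitution)
    \<comment> \<open>A crude range suffices, since f is continuous everywhere: 2t lies in [0, pi]
      and the arctangent between -pi/2 and pi/2.\<close>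
    show "g ` {0..pi/2} \<subseteq> {- pi..2 * pi}"
    proof safe
      fix t assume "t \<in> {0..pi/2}"
      then show "g t \<in> {- pi..2 * pi}"
        using arctan_lbound[of "h t"] arctan_ubound[of "h t"] by (auto simp: g_def)
    qed
    show "continuous_on {- pi..2 * pi} f"
      unfolding f_def by (rule continuous_on_ell_integrand[OF c sab])
  qed (use der g0 in auto)
  moreover have "g' t *\<^sub>R f (g t) = 2 * (1 / sqrt (\<Delta> t))" for t
  proof -
    have "g' t *\<^sub>R f (g t) = 2 * (sqrt (\<Delta> t) / \<Delta> t)"
      unfolding g'_def fg using E[of t] c by simp
    also have "sqrt (\<Delta> t) / \<Delta> t = 1 / sqrt (\<Delta> t)"
      using \<Delta>[of t] by (simp add: divide_eq_eq eq_divide_eq)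
    finally show ?thesis .
  qed
  ultimately have "((\<lambda>t. 2 * (1 / sqrt (\<Delta> t))) has_integral (integral {0..pi} f)) {0..pi/2}"
    by (simp only: g0)
  then have "integral {0..pi/2} (\<lambda>t. 2 * (1 / sqrt (\<Delta> t))) = integral {0..pi} f"
    by (rule integral_unique)
  then have "2 * ellI a b = integral {0..pi} f"
    unfolding ellI_def \<Delta>_def by (simp only: integral_mult_right)
  also have "\<dots> = 2 * ellI c (sqrt (a * b))"
    unfolding f_def by (rule ellI_half_period[OF c sab])
  finally show ?thesis by (simp add: c_def)
qed

lemma ellI_scale:
  assumes "s > 0"
  shows "ellI (s * a) (s * b) = ellI a b / s"
proof -
  have "1 / sqrt ((s * a)\<^sup>2 * (cos t)\<^sup>2 + (s * b)\<^sup>2 * (sin t)\<^sup>2) =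
      1 / s * (1 / sqrt (a\<^sup>2 * (cos t)\<^sup>2 + b\<^sup>2 * (sin t)\<^sup>2))" for t
  proof -
    have "(s * a)\<^sup>2 * (cos t)\<^sup>2 + (s * b)\<^sup>2 * (sin t)\<^sup>2 = s\<^sup>2 * (a\<^sup>2 * (cos t)\<^sup>2 + b\<^sup>2 * (sin t)\<^sup>2)"
      by (simp add: algebra_simps power_mult_distrib)
    then show ?thesis using assms by (simp add: real_sqrt_mult)
  qed
  then show ?thesis
    unfolding ellI_def by (simp only: integral_mult_right) simp
qed

lemma ellK_eq_ellI:
  assumes "a > 0" "0 < b" and "x\<^sup>2 = 1 - b\<^sup>2 / a\<^sup>2"
  shows "ellK x = a * ellI a b"
proof -
  have "1 / sqrt (1 - x\<^sup>2 * (sin t)\<^sup>2) = a * (1 / sqrt (a\<^sup>2 * (cos t)\<^sup>2 + b\<^sup>2 * (sin t)\<^sup>2))" for t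
  proof -
    have "a\<^sup>2 * (cos t)\<^sup>2 + b\<^sup>2 * (sin t)\<^sup>2 = a\<^sup>2 * (1 - x\<^sup>2 * (sin t)\<^sup>2)"
      unfolding assms(3) cos_squared_eq using assms(1) by (simp add: field_simps)
    then show ?thesis using assms(1) by (simp add: real_sqrt_mult)
  qed
  then show ?thesis
    unfolding ellK_def ellI_def by (simp only: integral_mult_right)
qed

lemma ellI_bounds:
  assumes "0 < m" "m \<le> a" "m \<le> b" "a \<le> M" "b \<le> M"
  shows "pi / 2 / M \<le> ellI a b" "ellI a b \<le> pi / 2 / m"
proof -
  have ab: "a > 0" "b > 0" "M > 0" using assms by auto
  have pos: "a\<^sup>2 * (cos t)\<^sup>2 + b\<^sup>2 * (sin t)\<^sup>2 > 0" for t
    using ell_form_pos[of "a\<^sup>2" "b\<^sup>2"] ab by simp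
  have lo: "m \<le> sqrt (a\<^sup>2 * (cos t)\<^sup>2 + b\<^sup>2 * (sin t)\<^sup>2)" for t
  proof (rule real_le_rsqrt)
    have "m\<^sup>2 * ((cos t)\<^sup>2 + (sin t)\<^sup>2) \<le> a\<^sup>2 * (cos t)\<^sup>2 + b\<^sup>2 * (sin t)\<^sup>2"
      unfolding distrib_left using assms by (intro add_mono mult_right_mono power_mono) auto
    then show "m\<^sup>2 \<le> a\<^sup>2 * (cos t)\<^sup>2 + b\<^sup>2 * (sin t)\<^sup>2" by simp
  qed
  have hi: "sqrt (a\<^sup>2 * (cos t)\<^sup>2 + b\<^sup>2 * (sin t)\<^sup>2) \<le> M" for t
  proof (rule real_le_lsqrt)
    have "a\<^sup>2 * (cos t)\<^sup>2 + b\<^sup>2 * (sin t)\<^sup>2 \<le> M\<^sup>2 * ((cos t)\<^sup>2 + (sin t)\<^sup>2)"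
      unfolding distrib_left using assms by (intro add_mono mult_right_mono power_mono) auto
    then show "a\<^sup>2 * (cos t)\<^sup>2 + b\<^sup>2 * (sin t)\<^sup>2 \<le> M\<^sup>2" by simp
  qed (use ab in auto)
  have "integral {0..pi/2} (\<lambda>t. 1 / M) \<le> ellI a b"
    unfolding ellI_def
    by (rule integral_le[OF _ integrable_ell[OF ab(1,2)]])
       (use hi lo assms(1) in \<open>auto intro!: divide_left_mono mult_pos_pos simp: ab pos\<close>)
  then show "pi / 2 / M \<le> ellI a b" by simp
  have "ellI a b \<le> integral {0..pi/2} (\<lambda>t. 1 / m)"
    unfolding ellI_def
    by (rule integral_le[OF integrable_ell[OF ab(1,2)]])
       (use hi lo assms(1) in \<open>auto intro!: divide_left_mono mult_pos_pos simp: ab pos\<close>)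
  then show "ellI a b \<le> pi / 2 / m" by simp
qed

text \<open>The part \<open>sin t / R t\<close> has the antiderivative - arsinh(s cos t / e) / s and
  carries the whole logarithm; the remainder (1 - sin t) / R t lies between 0 and 1.\<close>

lemma ellI_asymptotics:
  assumes "0 < e" "e < 1"
  shows "ln (1 / e) \<le> ellI 1 e" "ellI 1 e \<le> ln (2 / e) / sqrt (1 - e\<^sup>2) + pi / 2"
proof -
  define s where "s = sqrt (1 - e\<^sup>2)"
  have e2: "e\<^sup>2 < 1" using assms by (simp add: power_less_one_iff)
  then have s: "0 < s" "s \<le> 1" "s\<^sup>2 = 1 - e\<^sup>2" by (simp_all add: s_def)
  define R where "R = (\<lambda>t::real. sqrt (1\<^sup>2 * (cos t)\<^sup>2 + e\<^sup>2 * (sin t)\<^sup>2))"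
  have R: "R t > 0" for t
    using ell_form_pos[of 1 "e\<^sup>2" t] assms by (simp add: R_def)
  have Req: "R t = e * sqrt ((s * cos t / e)\<^sup>2 + 1)" for t
  proof -
    have "1\<^sup>2 * (cos t)\<^sup>2 + e\<^sup>2 * (sin t)\<^sup>2 = e\<^sup>2 * ((s * cos t / e)\<^sup>2 + 1)"
      using assms by (simp add: power_divide power_mult_distrib s(3) sin_squared_eq field_simps)
    then show ?thesis using assms by (simp add: R_def real_sqrt_mult)
  qed
  have int: "((\<lambda>t. sin t / R t) has_integral (- arsinh (s * cos (pi/2) / e) / s - (- arsinh (s * cos 0 / e) / s))) {0..pi/2}"
  proof (rule fundamental_theorem_of_calculus)
    fix t assume "t \<in> {0..pi/2}"
    have "((\<lambda>t. - arsinh (s * cos t / e) / s) has_field_derivative sin t / R t) (at t within {0..pi/2})"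
      unfolding Req using assms s(1)
      by (auto intro!: derivative_eq_intros DERIV_chain2[OF arsinh_real_has_field_derivative] simp: field_simps)
    then show "((\<lambda>t. - arsinh (s * cos t / e) / s) has_vector_derivative sin t / R t) (at t within {0..pi/2})"
      by (simp add: has_real_derivative_iff_has_vector_derivative)
  qed simp
  define J where "J = ln ((1 + s) / e) / s"
  have "arsinh (s / e) = ln ((1 + s) / e)"
  proof -
    have "(s / e)\<^sup>2 + 1 = (1 / e)\<^sup>2" using assms by (simp add: power_divide s(3) field_simps)
    then show ?thesis using assms by (simp add: arsinh_real_def add_divide_distrib add.commute)
  qed
  then have J: "((\<lambda>t. sin t / R t) has_integral J) {0..pi/2}"
    using int by (simp add: J_def)
  have I: "((\<lambda>t. 1 / R t) has_integral ellI 1 e) {0..pi/2}"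
    unfolding ellI_def R_def by (intro integrable_integral integrable_ell) (use assms in auto)
  have "J \<le> ellI 1 e"
    by (rule has_integral_le[OF J I]) (intro divide_right_mono sin_le_one less_imp_le R)
  have J0: "0 \<le> ln (1 / e)" "ln (1 / e) \<le> ln ((1 + s) / e)" "ln ((1 + s) / e) \<le> ln (2 / e)"
  proof -
    have "1 / e \<ge> 1" "1 / e \<le> (1 + s) / e" "(1 + s) / e \<le> 2 / e"
      using assms s by (simp_all add: divide_right_mono)
    then show "0 \<le> ln (1 / e)" "ln (1 / e) \<le> ln ((1 + s) / e)" "ln ((1 + s) / e) \<le> ln (2 / e)"
      using assms s by (simp_all del: divide_le_cancel)
  qed
  have "ln (1 / e) \<le> J"
  proof -
    have "ln (1 / e) * s \<le> ln (1 / e)" using J0(1) s by (simp add: mult_left_le)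
    then show ?thesis unfolding J_def using J0(2) s(1) by (simp add: pos_le_divide_eq)
  qed
  with \<open>J \<le> ellI 1 e\<close> show "ln (1 / e) \<le> ellI 1 e" by simp
  have "ellI 1 e - J \<le> integral {0..pi/2} (\<lambda>t. 1)"
  proof (rule has_integral_le[OF has_integral_diff[OF I J]])
    show "((\<lambda>t. 1) has_integral integral {0..pi/2} (\<lambda>t. 1)) {0..pi/2}"
      by (intro integrable_integral) auto
    fix t :: real assume t: "t \<in> {0..pi/2}"
    then have "0 \<le> sin t" "0 \<le> cos t" by (auto intro!: sin_ge_zero cos_ge_zero)
    have "1 - sin t \<le> (1 - sin t) * (1 + sin t)"
      using mult_left_mono[of 1 "1 + sin t" "1 - sin t"] \<open>0 \<le> sin t\<close> by simp
    also have "\<dots> = (cos t)\<^sup>2" by (simp add: cos_squared_eq algebra_simps power2_eq_square)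
    also have "\<dots> \<le> cos t" using \<open>0 \<le> cos t\<close> by (simp add: power2_eq_square mult_left_le)
    also have "cos t \<le> R t"
      unfolding R_def using assms by (intro real_le_rsqrt) simp
    finally show "1 / R t - sin t / R t \<le> 1"
      using R[of t] by (simp add: divide_le_eq flip: diff_divide_distrib)
  qed
  then have "ellI 1 e \<le> J + pi / 2" by simp
  also have "J \<le> ln (2 / e) / s" unfolding J_def using J0 s by (intro divide_right_mono) auto
  finally show "ellI 1 e \<le> ln (2 / e) / sqrt (1 - e\<^sup>2) + pi / 2" by (simp add: s_def)
qed

section \<open>Evaluation of the singular moduli\<close>

text \<open>Weierstrass's inequality: a product of factors 1 - u with u in [0, 1] is at least 1
  minus the sum of the u, here a geometric series. It makes the theta constants tend to 1 as the
  nome tends to 0.\<close>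

lemma qp_self_bounds:
  fixes x :: real
  assumes "0 < x" "x < 1"
  shows "1 - x / (1 - x) \<le> qp x x" "qp x x \<le> 1"
proof -
  have r: "x * x ^ n \<in> {0..1}" for n
    using assms by (auto simp flip: power_Suc intro!: power_le_one)
  have t: "(\<lambda>N. \<Prod>n<N. 1 - x * x ^ n) \<longlonglongrightarrow> qp x x" by (rule tendsto_qp) (use assms in auto)
  have "1 - x / (1 - x) \<le> (\<Prod>n<N. 1 - x * x ^ n)" for N
  proof -
    have "(\<Sum>n<N. x * x ^ n) \<le> (\<Sum>n. x * x ^ n)"
      using assms by (intro sum_le_suminf summable_mult summable_geometric) auto
    also have "\<dots> = x / (1 - x)"
      using assms by (simp add: suminf_mult summable_geometric suminf_geometric)
    finally show ?thesis
      using Weierstrass_prod_ineq[of "{..<N}" "\<lambda>n. x * x ^ n"] r by auto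
  qed
  then show "1 - x / (1 - x) \<le> qp x x" by (intro LIMSEQ_le_const[OF t]) auto
  have "(\<Prod>n<N. 1 - x * x ^ n) \<le> 1" for N
    using r by (intro prod_le_1) auto
  then show "qp x x \<le> 1" by (intro LIMSEQ_le_const2[OF t]) auto
qed

lemma tendsto_qp_self:
  fixes x :: "nat \<Rightarrow> real"
  assumes "x \<longlonglongrightarrow> 0" "\<And>n. 0 < x n" "\<And>n. x n < 1"
  shows "(\<lambda>n. qp (x n) (x n)) \<longlonglongrightarrow> 1"
proof (rule tendsto_sandwich)
  have "(\<lambda>n. 1 - x n / (1 - x n)) \<longlonglongrightarrow> 1 - 0 / (1 - 0)"
    by (intro tendsto_intros assms) auto
  then show "(\<lambda>n. 1 - x n / (1 - x n)) \<longlonglongrightarrow> 1" by simp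
  show "(\<lambda>n. 1 :: real) \<longlonglongrightarrow> 1" by simp
  show "\<forall>\<^sub>F n in sequentially. 1 - x n / (1 - x n) \<le> qp (x n) (x n)"
    "\<forall>\<^sub>F n in sequentially. qp (x n) (x n) \<le> 1"
    using qp_self_bounds[OF assms(2,3)] by simp_all
qed

context
  fixes q :: real
  assumes q0: "0 < q" and q1: "q < 1"
begin

definition nome :: "nat \<Rightarrow> real" where "nome n = q ^ (2 ^ n)"

lemma nome: "0 < nome n" "nome n < 1"
  using q0 q1 by (simp_all add: nome_def power_less_one_iff)

lemma nome_Suc: "nome (Suc n) = nome n ^ 2"
  by (simp add: nome_def mult.commute flip: power_mult)

lemma tendsto_nome: "nome \<longlonglongrightarrow> 0"
proof -
  have "filterlim (\<lambda>n::nat. 2 ^ n :: nat) at_top sequentially"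
    by (rule filterlim_subseq) (simp add: strict_mono_def)
  then show ?thesis
    unfolding nome_def using q0 q1
    by (intro filterlim_compose[OF LIMSEQ_power_zero]) auto
qed

lemma tendsto_nome_qpow:
  assumes "k > 0"
  shows "(\<lambda>n. qpow (nome n) k k) \<longlonglongrightarrow> 1"
  unfolding qpow_def
proof (rule tendsto_qp_self)
  show "(\<lambda>n. nome n ^ k) \<longlonglongrightarrow> 0"
    by (rule tendsto_null_power[OF tendsto_nome assms])
  show "0 < nome n ^ k" "nome n ^ k < 1" for n
    using nome[of n] assms by (simp_all add: power_less_one_iff)
qed

lemma tendsto_nome_th: "(\<lambda>n. th3 (nome n)) \<longlonglongrightarrow> 1" "(\<lambda>n. th4 (nome n)) \<longlonglongrightarrow> 1"
proof -
  have "(\<lambda>n. qpow (nome n) 2 2 ^ 5 / (qpow (nome n) 1 1 ^ 2 * qpow (nome n) 4 4 ^ 2)) \<longlonglongrightarrow> 1 ^ 5 / (1 ^ 2 * 1 ^ 2)"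
    by (intro tendsto_intros tendsto_nome_qpow) auto
  then show "(\<lambda>n. th3 (nome n)) \<longlonglongrightarrow> 1" by (simp add: th3_eq[OF nome])
  have "(\<lambda>n. qpow (nome n) 1 1 ^ 2 / qpow (nome n) 2 2) \<longlonglongrightarrow> 1 ^ 2 / 1"
    by (intro tendsto_intros tendsto_nome_qpow) auto
  then show "(\<lambda>n. th4 (nome n)) \<longlonglongrightarrow> 1" by (simp add: th4_eq[OF nome])
qed

text \<open>The integral is constant along the nomes q^(2^n), while both of its arguments tend to
  1.\<close>

lemma ellI_th34: "ellI (th3 q ^ 2) (th4 q ^ 2) = pi / 2"
proof -
  define a b where "a = (\<lambda>n. th3 (nome n) ^ 2)" and "b = (\<lambda>n. th4 (nome n) ^ 2)"
  have pos: "a n > 0" "b n > 0" for n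
    using th_pos[OF nome[of n]] by (simp_all add: a_def b_def)
  have inv: "ellI (a n) (b n) = ellI (th3 q ^ 2) (th4 q ^ 2)" for n
  proof (induction n)
    case 0
    then show ?case by (simp add: a_def b_def nome_def)
  next
    case (Suc n)
    have "(a n + b n) / 2 = a (Suc n)"
      using agm_th34(1)[OF nome[of n]] by (simp add: a_def b_def nome_Suc)
    moreover have "sqrt (a n * b n) = b (Suc n)"
      using agm_th34(2)[OF nome[of n]] th_pos[OF nome[of n]]
      by (simp add: a_def b_def nome_Suc real_sqrt_mult)
    ultimately show ?case using ellI_agm[OF pos[of n]] Suc by simp
  qed
  have lim: "a \<longlonglongrightarrow> 1" "b \<longlonglongrightarrow> 1"
    using tendsto_power[OF tendsto_nome_th(1), of 2] tendsto_power[OF tendsto_nome_th(2), of 2]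
    by (simp_all add: a_def b_def)
  have "(\<lambda>n. pi / 2 / max (a n) (b n)) \<longlonglongrightarrow> pi / 2 / max 1 1"
    by (intro tendsto_intros lim) auto
  then have "pi / 2 \<le> ellI (th3 q ^ 2) (th4 q ^ 2)"
    using ellI_bounds(1)[of "min (a n) (b n)" "a n" "b n" "max (a n) (b n)" for n] pos
    by (intro LIMSEQ_le_const2) (auto simp: inv)
  moreover have "(\<lambda>n. pi / 2 / min (a n) (b n)) \<longlonglongrightarrow> pi / 2 / min 1 1"
    by (intro tendsto_intros lim) auto
  then have "ellI (th3 q ^ 2) (th4 q ^ 2) \<le> pi / 2"
    using ellI_bounds(2)[of "min (a n) (b n)" "a n" "b n" "max (a n) (b n)" for n] pos
    by (intro LIMSEQ_le_const) (auto simp: inv)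
  ultimately show ?thesis by simp
qed

text \<open>Squaring the nome doubles this integral, because the mean step leads from q^2 back to q.
  Along q^(2^n) the ratio \<open>e n\<close> of the arguments tends to 0, and the logarithmic
  asymptotics divided by 2^n squeeze the value.\<close>

lemma ellI_th32: "ellI (th3 q ^ 2) (th2sq q) = - ln q / 2"
proof -
  define a b where "a = (\<lambda>n. th3 (nome n) ^ 2)" and "b = (\<lambda>n. th2sq (nome n))"
  have pos: "a n > 0" "b n > 0" for n
    using th_pos[OF nome[of n]] by (simp_all add: a_def b_def)
  define J where "J = ellI (th3 q ^ 2) (th2sq q)"
  have inv: "ellI (a n) (b n) = 2 ^ n * J" for n
  proof (induction n)
    case 0
    then show ?case by (simp add: a_def b_def nome_def J_def)
  next
    case (Suc n)
    have "(a (Suc n) + b (Suc n)) / 2 = 1 / 2 * a n"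
      using agm_th32(1)[OF nome[of n]] by (simp add: a_def b_def nome_Suc)
    moreover have "sqrt (a (Suc n) * b (Suc n)) = 1 / 2 * b n"
    proof -
      have "a (Suc n) * b (Suc n) = (1 / 2 * b n) ^ 2"
        using agm_th32(2)[OF nome[of n]] by (simp add: a_def b_def nome_Suc power_divide)
      then show ?thesis using pos(2)[of n] by simp
    qed
    ultimately have "ellI (a (Suc n)) (b (Suc n)) = ellI (1 / 2 * a n) (1 / 2 * b n)"
      using ellI_agm[OF pos[of "Suc n"]] by (simp only:)
    also have "\<dots> = 2 * ellI (a n) (b n)"
      by (subst ellI_scale) auto
    finally show ?case using Suc by simp
  qed
  define e where "e = (\<lambda>n. b n / a n)"
  have e0: "e n > 0" for n using pos[of n] by (simp add: e_def)
  have e1: "e n < 1" for n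
  proof -
    have "b n ^ 2 < a n ^ 2"
      using jacobi_th[OF nome[of n]] th_pos[OF nome[of n]] by (simp add: a_def b_def flip: power_mult)
    then have "b n < a n" using pos[of n] by (simp add: power2_less_imp_less)
    then show ?thesis using pos[of n] by (simp add: e_def)
  qed
  \<comment> \<open>\<open>e n\<close> is \<open>sqrt (nome n)\<close> times a factor tending to 4;
    after division by 2^n the logarithm of that factor disappears, while ln of the nome leaves ln
    q.\<close>
  define r where "r = (\<lambda>n. 4 * qpow (nome n) 4 4 ^ 4 / qpow (nome n) 2 2 ^ 2 / a n)"
  have r0: "r n > 0" for n
    unfolding r_def by (intro divide_pos_pos mult_pos_pos zero_less_power F_pos nome pos) auto
  have er: "e n = sqrt (nome n) * r n" for n
    by (simp add: e_def r_def b_def th2sq_def)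
  have lima: "a \<longlonglongrightarrow> 1"
    using tendsto_power[OF tendsto_nome_th(1), of 2] by (simp add: a_def)
  have "r \<longlonglongrightarrow> 4 * 1 ^ 4 / 1 ^ 2 / 1"
    unfolding r_def by (intro tendsto_intros tendsto_nome_qpow lima) auto
  then have limr: "r \<longlonglongrightarrow> 4" by simp
  have "e \<longlonglongrightarrow> sqrt 0 * 4"
    unfolding er[abs_def] by (intro tendsto_intros tendsto_nome limr)
  then have lime: "e \<longlonglongrightarrow> 0" by simp
  have ln_e: "ln (y / e n) = ln y - (2 ^ n * (ln q / 2) + ln (r n))" if "y > 0" for n y
    using r0[of n] nome[of n] q0 that
    by (simp add: er ln_div ln_mult ln_sqrt nome_def ln_realpow)
  have pw: "(\<lambda>n. (1 / 2 :: real) ^ n) \<longlonglongrightarrow> 0"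
    by (rule LIMSEQ_power_zero) simp
  have Jn: "a n * J = (1 / 2) ^ n * ellI 1 (e n)" for n
  proof -
    have "ellI (a n * 1) (a n * e n) = ellI 1 (e n) / a n"
      by (rule ellI_scale[OF pos(1)])
    then have "2 ^ n * J = ellI 1 (e n) / a n"
      using pos(1)[of n] by (simp add: e_def inv)
    then show ?thesis using pos(1)[of n] by (simp add: field_simps power_divide)
  qed
  have limJ: "(\<lambda>n. a n * J) \<longlonglongrightarrow> 1 * J"
    by (intro tendsto_intros lima)
  have "(\<lambda>n. (1 / 2) ^ n * ln (1 / e n)) \<longlonglongrightarrow> - (ln q / 2)"
  proof -
    have "(\<lambda>n. - (ln q / 2) - (1 / 2) ^ n * ln (r n)) \<longlonglongrightarrow> - (ln q / 2) - 0 * ln 4"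
      by (intro tendsto_intros pw limr) auto
    moreover have "(1 / 2) ^ n * ln (1 / e n) = - (ln q / 2) - (1 / 2) ^ n * ln (r n)" for n
      by (simp add: ln_e[of 1, simplified] power_divide field_simps)
    ultimately show ?thesis by simp
  qed
  from LIMSEQ_le[OF this limJ] have "- (ln q / 2) \<le> J"
    using ellI_asymptotics(1)[OF e0 e1] by (auto simp: Jn)
  moreover have "(\<lambda>n. (1 / 2) ^ n * (ln (2 / e n) / sqrt (1 - (e n)\<^sup>2) + pi / 2)) \<longlonglongrightarrow> - (ln q / 2)"
  proof -
    have "(\<lambda>n. (- (ln q / 2) + (1 / 2) ^ n * (ln 2 - ln (r n))) / sqrt (1 - (e n)\<^sup>2) + (1 / 2) ^ n * (pi / 2))
      \<longlonglongrightarrow> (- (ln q / 2) + 0 * (ln 2 - ln 4)) / sqrt (1 - 0\<^sup>2) + 0 * (pi / 2)"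
      by (intro tendsto_intros pw limr lime) auto
    moreover have "(1 / 2) ^ n * (ln (2 / e n) / sqrt (1 - (e n)\<^sup>2) + pi / 2) =
      (- (ln q / 2) + (1 / 2) ^ n * (ln 2 - ln (r n))) / sqrt (1 - (e n)\<^sup>2) + (1 / 2) ^ n * (pi / 2)" for n
    proof -
      have "(1 / 2) ^ n * ln (2 / e n) = - (ln q / 2) + (1 / 2) ^ n * (ln 2 - ln (r n))"
        by (simp add: ln_e power_divide field_simps)
      then show ?thesis by (simp only: distrib_left times_divide_eq_right)
    qed
    ultimately show ?thesis by simp
  qed
  from LIMSEQ_le[OF limJ this] have "J \<le> - (ln q / 2)"
    using ellI_asymptotics(2)[OF e0 e1] by (auto simp: Jn)
  ultimately show ?thesis by (simp add: J_def)
qed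

end

lemma ellK_strict_mono:
  assumes "0 \<le> x" "x < y" "y < 1"
  shows "ellK x < ellK y"
  unfolding ellK_def
proof (rule integral_less_real)
  have pos: "1 - z\<^sup>2 * (sin t)\<^sup>2 > 0" if "0 \<le> z" "z < 1" for z t :: real
  proof -
    have "z\<^sup>2 * (sin t)\<^sup>2 \<le> z\<^sup>2 * 1" by (intro mult_left_mono) (simp_all add: sin_squared_eq)
    moreover have "z\<^sup>2 < 1" using that by (simp add: power_less_one_iff)
    ultimately show ?thesis by simp
  qed
  have cont: "continuous_on {0..pi/2} (\<lambda>t. 1 / sqrt (1 - z\<^sup>2 * (sin t)\<^sup>2))" if "0 \<le> z" "z < 1" for z :: real
  proof (intro continuous_intros ballI)
    fix t show "sqrt (1 - z\<^sup>2 * (sin t)\<^sup>2) \<noteq> 0" using pos[OF that, of t] by simp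
  qed
  show "continuous_on {0..pi/2} (\<lambda>t. 1 / sqrt (1 - x\<^sup>2 * (sin t)\<^sup>2))"
    "continuous_on {0..pi/2} (\<lambda>t. 1 / sqrt (1 - y\<^sup>2 * (sin t)\<^sup>2))"
    using assms by (intro cont; simp)+
  have "pi / 4 \<in> {0<..<pi/2}" using pi_gt_zero by simp
  then show "{0<..<pi/2} \<noteq> {}" by blast
  fix t :: real assume t: "t \<in> {0<..<pi/2}"
  then have "sin t > 0" by (intro sin_gt_zero) auto
  then have "1 - y\<^sup>2 * (sin t)\<^sup>2 < 1 - x\<^sup>2 * (sin t)\<^sup>2"
    using assms by (simp add: power_strict_mono)
  then show "1 / sqrt (1 - x\<^sup>2 * (sin t)\<^sup>2) < 1 / sqrt (1 - y\<^sup>2 * (sin t)\<^sup>2)"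
    using pos[of y t] pos[of x t] assms by (intro divide_strict_left_mono mult_pos_pos) auto
qed

lemma ellK_pos:
  assumes "0 < x" "x < 1"
  shows "ellK x > 0"
proof -
  have "ellK 0 = pi / 2" by (simp add: ellK_def)
  then show ?thesis using ellK_strict_mono[of 0 x] assms pi_gt_zero by linarith
qed

text \<open>The pair (\<theta>_3^2, \<theta>_4^2) has modulus k and gives K = \<theta>_3^2 pi/2; the
  pair (\<theta>_3^2, \<theta>_2^2) has the complementary modulus and gives K' = - \<theta>_3^2 ln q
  / 2.\<close>

theorem singular_modulus_eq:
  assumes "r > 0"
  defines "q \<equiv> exp (- pi * sqrt r)"
  shows "singular_modulus r = th2sq q / th3 q ^ 2"
    and "0 < th2sq q / th3 q ^ 2" "th2sq q / th3 q ^ 2 < 1"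
proof -
  have q: "0 < q" "q < 1" using assms by (simp_all add: q_def)
  define k where "k = th2sq q / th3 q ^ 2"
  note pos = th_pos[OF q]
  note J = jacobi_th[OF q]
  have k0: "k > 0" using pos by (simp add: k_def)
  have k2: "k ^ 2 = 1 - (th4 q ^ 2)\<^sup>2 / (th3 q ^ 2)\<^sup>2"
  proof -
    have "k ^ 2 = (th3 q ^ 4 - th4 q ^ 4) / th3 q ^ 4"
      using J by (simp add: k_def power_divide flip: power_mult)
    then show ?thesis using pos by (simp add: diff_divide_distrib flip: power_mult)
  qed
  then have "k ^ 2 < 1" using pos by simp
  then have k1: "k < 1" using k0 by (simp add: power_less_one_iff)
  have "ellK k = th3 q ^ 2 * ellI (th3 q ^ 2) (th4 q ^ 2)"
    by (rule ellK_eq_ellI) (use pos k2 in auto)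
  moreover have "ellK (sqrt (1 - k ^ 2)) = th3 q ^ 2 * ellI (th3 q ^ 2) (th2sq q)"
    by (rule ellK_eq_ellI) (use pos \<open>k ^ 2 < 1\<close> in \<open>auto simp: k_def power_divide\<close>)
  moreover have "ln q = - pi * sqrt r" by (simp add: q_def)
  ultimately have "ellK k = th3 q ^ 2 * (pi / 2)" "ellK (sqrt (1 - k ^ 2)) = th3 q ^ 2 * (pi / 2) * sqrt r"
    unfolding ellI_th34[OF q] ellI_th32[OF q] by simp_all
  moreover have "th3 q ^ 2 * (pi / 2) \<noteq> 0" using pos by simp
  ultimately have ratio: "ellK (sqrt (1 - k ^ 2)) / ellK k = sqrt r"
    by (metis nonzero_mult_div_cancel_left)
  \<comment> \<open>Uniqueness for \<open>THE\<close>: as the modulus grows, the numerator decreases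
    and the denominator increases.\<close>
  have mono: "ellK (sqrt (1 - y ^ 2)) / ellK y < ellK (sqrt (1 - x ^ 2)) / ellK x"
    if "0 < x" "x < y" "y < 1" for x y
  proof -
    have "x ^ 2 < y ^ 2" "y ^ 2 < 1" using that by (simp_all add: power_strict_mono power_less_one_iff)
    then have "ellK (sqrt (1 - y ^ 2)) < ellK (sqrt (1 - x ^ 2))" "ellK (sqrt (1 - y ^ 2)) > 0"
      using that by (auto intro!: ellK_strict_mono ellK_pos)
    moreover have "ellK x < ellK y" "ellK x > 0"
      using that by (auto intro!: ellK_strict_mono ellK_pos)
    ultimately show ?thesis by (intro frac_less) auto
  qed
  show "singular_modulus r = th2sq q / th3 q ^ 2"
    unfolding singular_modulus_def k_def[symmetric]
  proof (rule the_equality)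
    fix x assume x: "0 < x \<and> x < 1 \<and> ellK (sqrt (1 - x\<^sup>2)) / ellK x = sqrt r"
    show "x = k"
      using mono[of x k] mono[of k x] x k0 k1 ratio by (cases x k rule: linorder_cases) auto
  qed (use k0 k1 ratio in auto)
  show "0 < th2sq q / th3 q ^ 2" "th2sq q / th3 q ^ 2 < 1" using k0 k1 by (simp_all add: k_def)
qed

section \<open>The Rogers-Ramanujan continued fraction\<close>

context
  fixes q :: real
  assumes q0: "0 < q" and q1: "q < 1"
begin

definition pq :: "nat \<Rightarrow> real" where "pq n = (\<Prod>i<n. 1 - q * q ^ i)"

definition ae :: "nat \<Rightarrow> nat" where "ae r = r * (5 * r + 1) div 2"

lemma ae_double: "2 * ae r = r * (5 * r + 1)"
proof -
  have "even (r * (5 * r + 1))" by auto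
  then show ?thesis unfolding ae_def by (rule dvd_mult_div_cancel)
qed

lemma ae_0 [simp]: "ae 0 = 0" by (simp add: ae_def)

lemma ae_Suc: "ae (Suc r) = ae r + 5 * r + 3"
  using ae_double[of r] ae_double[of "Suc r"] by (simp add: algebra_simps)

lemma ae_ge: "r \<le> ae r"
  by (induction r) (auto simp: ae_Suc)

lemma pq_0 [simp]: "pq 0 = 1" by (simp add: pq_def)

lemma pq_Suc: "pq (Suc n) = pq n * (1 - q ^ Suc n)" by (simp add: pq_def)

lemma pow_le_1: "0 < q ^ n" "q ^ n \<le> 1"
  using q0 q1 by (simp_all add: power_le_one)

lemma qp_self_pos: "0 < qp q q"
  using q0 q1 by (intro qp_pos) auto

lemma pq_bounds: "qp q q \<le> pq n" "pq n \<le> 1"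
proof -
  have dec: "decseq pq"
  proof (rule decseq_SucI)
    fix n
    have "0 \<le> pq n" unfolding pq_def
      by (intro prod_nonneg) (use pow_le_1 in \<open>auto simp flip: power_Suc\<close>)
    then show "pq (Suc n) \<le> pq n"
      unfolding pq_Suc using pow_le_1[of "Suc n"] by (intro mult_left_le) auto
  qed
  have "pq \<longlonglongrightarrow> qp q q"
    unfolding pq_def using q0 q1 by (intro tendsto_qp) auto
  with dec show "qp q q \<le> pq n" by (rule decseq_ge)
  show "pq n \<le> 1" using decseqD[OF dec, of 0 n] by simp
qed

text \<open>The Rogers-Selberg series \<open>J\<^sub>2\<^sub>,\<^sub>i(q\<^sup>m)\<close> for \<open>i = 1, 2\<close>, multiplied by the Euler product.\<close>

definition cf :: "nat \<Rightarrow> nat \<Rightarrow> real" where "cf m r = (-1) ^ r * pq (m + r) / pq r"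

definition term1 :: "nat \<Rightarrow> nat \<Rightarrow> real" where
  "term1 m r = cf m r * q ^ (2 * m * r + ae r + r) * (1 - q ^ (m + 2 * r + 1))"

definition term2 :: "nat \<Rightarrow> nat \<Rightarrow> real" where
  "term2 m r = cf m r * q ^ (2 * m * r + ae r) * (1 - q ^ (2 * (m + 2 * r + 1)))"

definition RS1 :: "nat \<Rightarrow> real" where "RS1 m = (\<Sum>r. term1 m r)"

definition RS2 :: "nat \<Rightarrow> real" where "RS2 m = (\<Sum>r. term2 m r)"

lemma cf_bound: "\<bar>cf m r\<bar> \<le> 1 / qp q q"
proof -
  have "\<bar>cf m r\<bar> = pq (m + r) / pq r"
    using pq_bounds[of r] pq_bounds[of "m + r"] qp_self_pos by (simp add: cf_def abs_mult power_abs)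
  also have "\<dots> \<le> 1 / qp q q"
    using pq_bounds[of r] pq_bounds[of "m + r"] qp_self_pos by (intro frac_le) auto
  finally show ?thesis .
qed

lemma summable_cf:
  assumes "\<And>r. r \<le> e r" "\<And>r. \<bar>h r\<bar> \<le> 1"
  shows "summable (\<lambda>r. cf m r * q ^ e r * h r)"
proof (rule summable_comparison_test')
  show "summable (\<lambda>r. 1 / qp q q * q ^ r)"
    using q0 q1 by (intro summable_mult summable_geometric) auto
  fix r
  have "\<bar>cf m r\<bar> * q ^ e r * \<bar>h r\<bar> \<le> 1 / qp q q * q ^ r * 1"
    using cf_bound[of m r] assms[of r] q0 q1 qp_self_pos
    by (intro mult_mono power_decreasing) auto
  then show "norm (cf m r * q ^ e r * h r) \<le> 1 / qp q q * q ^ r"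
    using q0 by (simp add: abs_mult)
qed

lemma abs_one_minus_pow: "\<bar>1 - q ^ n\<bar> \<le> 1"
  using pow_le_1[of n] by auto

lemma summable_terms: "summable (term1 m)" "summable (term2 m)"
  unfolding term1_def[abs_def] term2_def[abs_def]
  by (intro summable_cf abs_one_minus_pow; use ae_ge in \<open>simp add: trans_le_add2\<close>)+

text \<open>Splitting each term of \<open>J\<^sub>2\<^sub>,\<^sub>i(q\<^sup>m)\<close> in two and shifting one half by this rule produces the terms
  of the series at \<open>q\<^sup>m\<^sup>+\<^sup>1\<close>.\<close>

lemma suminf_regroup:
  fixes \<alpha> \<beta> :: "nat \<Rightarrow> real"
  assumes "summable \<alpha>" "summable \<beta>" "\<alpha> 0 = 0"
  shows "(\<Sum>r. \<alpha> r + \<beta> r) = (\<Sum>r. \<alpha> (Suc r) + \<beta> r)"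
proof -
  have "(\<Sum>r. \<alpha> r) = (\<Sum>r. \<alpha> (Suc r))"
    using suminf_split_head[OF assms(1)] assms(3) by simp
  moreover have "summable (\<lambda>r. \<alpha> (Suc r))" using assms(1) by (simp add: summable_Suc_iff)
  ultimately show ?thesis using assms(1,2) by (simp flip: suminf_add)
qed

lemma cf_shift: "cf m (Suc r) * (1 - q ^ Suc r) = - cf (Suc m) r"
  "cf m r * (1 - q ^ (m + r + 1)) = cf (Suc m) r"
proof -
  have "1 - q ^ Suc r \<noteq> 0" using pq_bounds(1)[of "Suc r"] qp_self_pos by (auto simp: pq_Suc)
  then show "cf m (Suc r) * (1 - q ^ Suc r) = - cf (Suc m) r"
    by (simp add: cf_def pq_Suc[of r] power_Suc[of "-1"] del: power_Suc)
  show "cf m r * (1 - q ^ (m + r + 1)) = cf (Suc m) r"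
    using pq_Suc[of "m + r"] by (simp add: cf_def)
qed

lemma RS1_eq: "RS1 m = RS2 (Suc m)"
proof -
  \<comment> \<open>With N = m + 2r + 1 the split is 1 - q^N = (1 - q^r) + q^r (1 - q^(m+r+1)); each
    part completes a factor in \<open>cf_shift\<close>.\<close>
  define \<alpha> where "\<alpha> = (\<lambda>r. cf m r * q ^ (2 * m * r + ae r + r) * (1 - q ^ r))"
  define \<beta> where "\<beta> = (\<lambda>r. cf m r * q ^ (2 * m * r + ae r + 2 * r) * (1 - q ^ (m + r + 1)))"
  have ab: "\<alpha> (Suc r) + \<beta> r = term2 (Suc m) r" for r
  proof -
    have "\<alpha> (Suc r) = (cf m (Suc r) * (1 - q ^ Suc r)) * q ^ (2 * m * Suc r + ae (Suc r) + Suc r)"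
      by (simp add: \<alpha>_def)
    moreover have "\<beta> r = (cf m r * (1 - q ^ (m + r + 1))) * q ^ (2 * m * r + ae r + 2 * r)"
      by (simp add: \<beta>_def)
    moreover have "2 * m * Suc r + ae (Suc r) + Suc r = (2 * Suc m * r + ae r) + 2 * (Suc m + 2 * r + 1)"
      "2 * m * r + ae r + 2 * r = 2 * Suc m * r + ae r"
      by (simp_all add: ae_Suc algebra_simps)
    ultimately show ?thesis
      unfolding cf_shift term2_def by (simp only: power_add) (simp add: algebra_simps)
  qed
  have "term1 m r = \<alpha> r + \<beta> r" for r
    by (simp add: term1_def \<alpha>_def \<beta>_def algebra_simps power_add mult_2 mult_2_right)
  then have "RS1 m = (\<Sum>r. \<alpha> r + \<beta> r)" by (simp add: RS1_def)
  also have "\<dots> = (\<Sum>r. \<alpha> (Suc r) + \<beta> r)"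
  proof (rule suminf_regroup)
    show "summable \<alpha>" "summable \<beta>" unfolding \<alpha>_def \<beta>_def
      by (intro summable_cf abs_one_minus_pow; simp)+
  qed (simp add: \<alpha>_def)
  also have "\<dots> = (\<Sum>r. term2 (Suc m) r)"
    by (simp only: ab)
  finally show ?thesis by (simp add: RS2_def)
qed

lemma RS2_minus_RS1: "RS2 m - RS1 m = q ^ (m + 1) * RS1 (Suc m)"
proof -
  \<comment> \<open>With N = m + 2r + 1, the difference 1 - q^(2N) - q^r (1 - q^N) equals (1 - q^r)
    + q^(m+3r+1) (1 - q^(m+r+1)).\<close>
  define \<alpha> where "\<alpha> = (\<lambda>r. cf m r * q ^ (2 * m * r + ae r) * (1 - q ^ r))"
  define \<beta> where "\<beta> = (\<lambda>r. cf m r * q ^ (2 * m * r + ae r + m + 3 * r + 1) * (1 - q ^ (m + r + 1)))"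
  have ab: "\<alpha> (Suc r) + \<beta> r = q ^ (m + 1) * term1 (Suc m) r" for r
  proof -
    have "\<alpha> (Suc r) = (cf m (Suc r) * (1 - q ^ Suc r)) * q ^ (2 * m * Suc r + ae (Suc r))"
      by (simp add: \<alpha>_def)
    moreover have "\<beta> r = (cf m r * (1 - q ^ (m + r + 1))) * q ^ (2 * m * r + ae r + m + 3 * r + 1)"
      by (simp add: \<beta>_def)
    moreover have "2 * m * Suc r + ae (Suc r) = (m + 1) + (2 * Suc m * r + ae r + r) + (Suc m + 2 * r + 1)"
      "2 * m * r + ae r + m + 3 * r + 1 = (m + 1) + (2 * Suc m * r + ae r + r)"
      by (simp_all add: ae_Suc algebra_simps)
    ultimately show ?thesis
      unfolding cf_shift term1_def by (simp only: power_add) (simp add: algebra_simps)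
  qed
  have "term2 m r - term1 m r = \<alpha> r + \<beta> r" for r
    by (simp add: term1_def term2_def \<alpha>_def \<beta>_def algebra_simps power_add mult_2 eval_nat_numeral)
  then have "RS2 m - RS1 m = (\<Sum>r. \<alpha> r + \<beta> r)"
    unfolding RS1_def RS2_def suminf_diff[OF summable_terms(2,1)] by simp
  also have "\<dots> = (\<Sum>r. \<alpha> (Suc r) + \<beta> r)"
  proof (rule suminf_regroup)
    show "summable \<alpha>" "summable \<beta>" unfolding \<alpha>_def \<beta>_def
      by (intro summable_cf abs_one_minus_pow; use ae_ge in \<open>simp add: trans_le_add2\<close>)+
  qed (simp add: \<alpha>_def)
  also have "\<dots> = (\<Sum>r. q ^ (m + 1) * term1 (Suc m) r)"
    by (simp only: ab)
  also have "\<dots> = q ^ (m + 1) * RS1 (Suc m)"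
    unfolding RS1_def by (rule suminf_mult[OF summable_terms(1)])
  finally show ?thesis .
qed

text \<open>Divided by \<open>RS2 (Suc m)\<close>, this is one level of the continued fraction for
  the ratios of consecutive values.\<close>

lemma RS2_rec: "RS2 m = RS2 (Suc m) + q ^ Suc m * RS2 (Suc (Suc m))"
  using RS2_minus_RS1[of m] by (simp add: RS1_eq)

text \<open>The term at r = 0 stays above \<open>B\<close>, because \<open>pq m\<close> is at least
  the Euler product and the other factor at least 1 - q^2; all later terms carry q^(2m).\<close>

lemma RS2_eventually_pos: "\<exists>M. \<forall>m\<ge>M. RS2 m > 0"
proof -
  define K where "K = 1 / qp q q * (q / (1 - q))"
  define B where "B = (1 - q ^ 2) * qp q q"
  have "B > 0" using qp_self_pos q0 q1 by (simp add: B_def power_less_one_iff)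
  have "(\<lambda>m. K * (q\<^sup>2) ^ m) \<longlonglongrightarrow> K * 0"
    using q0 q1 by (intro tendsto_intros LIMSEQ_power_zero) (simp add: power_less_one_iff)
  then have "\<forall>\<^sub>F m in sequentially. K * (q\<^sup>2) ^ m < B"
    using \<open>B > 0\<close> by (intro order_tendstoD) auto
  then obtain M where M: "\<And>m. m \<ge> M \<Longrightarrow> K * (q\<^sup>2) ^ m < B"
    by (auto simp: eventually_sequentially)
  have "RS2 m > 0" if "m \<ge> M" for m
  proof -
    have "RS2 m = term2 m 0 + (\<Sum>r. term2 m (Suc r))"
      unfolding RS2_def using suminf_split_head[OF summable_terms(2)] by simp
    moreover have "B \<le> term2 m 0"
    proof -
      have "q ^ (2 * (m + 1)) \<le> q ^ 2" using q0 q1 by (intro power_decreasing) auto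
      then have "(1 - q ^ 2) * qp q q \<le> (1 - q ^ (2 * (m + 1))) * pq m"
        using pq_bounds[of m] qp_self_pos pow_le_1[of "2 * (m + 1)"] by (intro mult_mono) auto
      then show ?thesis by (simp add: B_def term2_def cf_def mult.commute)
    qed
    moreover have "\<bar>\<Sum>r. term2 m (Suc r)\<bar> \<le> K * (q\<^sup>2) ^ m"
    proof -
      have bd: "norm (term2 m (Suc r)) \<le> 1 / qp q q * ((q\<^sup>2) ^ m * q ^ Suc r)" for r
      proof -
        have "\<bar>cf m (Suc r)\<bar> * q ^ (2 * m * Suc r + ae (Suc r)) * \<bar>1 - q ^ (2 * (m + 2 * Suc r + 1))\<bar>
          \<le> 1 / qp q q * q ^ (2 * m + Suc r) * 1"
        proof (intro mult_mono cf_bound abs_one_minus_pow power_decreasing)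
          show "2 * m + Suc r \<le> 2 * m * Suc r + ae (Suc r)"
            by (intro add_mono ae_ge) simp
        qed (use q0 q1 qp_self_pos in auto)
        moreover have "norm (term2 m (Suc r)) = \<bar>cf m (Suc r)\<bar> * q ^ (2 * m * Suc r + ae (Suc r)) * \<bar>1 - q ^ (2 * (m + 2 * Suc r + 1))\<bar>"
          by (simp only: term2_def real_norm_def abs_mult power_abs abs_of_pos[OF q0])
        ultimately show ?thesis
          by (simp only: power_add power_mult mult_1_right mult.assoc)
      qed
      have sg: "summable (\<lambda>r. 1 / qp q q * ((q\<^sup>2) ^ m * q ^ Suc r))"
        using q0 q1 by (intro summable_mult) (simp add: summable_geometric)
      have "norm (\<Sum>r. term2 m (Suc r)) \<le> (\<Sum>r. 1 / qp q q * ((q\<^sup>2) ^ m * q ^ Suc r))"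
        by (rule norm_suminf_le[OF bd sg])
      also have "\<dots> = 1 / qp q q * ((q\<^sup>2) ^ m * (q * (1 / (1 - q))))"
        using q0 q1 by (simp add: suminf_mult suminf_divide summable_mult summable_geometric suminf_geometric)
      finally show ?thesis by (simp add: K_def mult.commute)
    qed
    ultimately show ?thesis using M[OF that] by linarith
  qed
  then show ?thesis by blast
qed

text \<open>The recurrence has positive coefficients, so positivity descends from large m.\<close>

lemma RS2_pos: "RS2 m > 0"
proof -
  obtain M where M: "\<And>m. m \<ge> M \<Longrightarrow> RS2 m > 0" using RS2_eventually_pos by blast
  show ?thesis
  proof (induction "M - m" arbitrary: m rule: less_induct)
    case less
    show ?case
    proof (cases "m \<ge> M")
      case False
      then have "M - Suc m < M - m" "M - Suc (Suc m) < M - m" by auto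
      then have "RS2 (Suc m) > 0" "RS2 (Suc (Suc m)) > 0" using less by auto
      then show ?thesis unfolding RS2_rec[of m] using q0 by (intro add_pos_pos mult_pos_pos) auto
    qed (use M in auto)
  qed
qed

section \<open>Convergence of the continued fraction and its theta quotient\<close>

lemma RR_denom_ge_1: "RR_denom q m n \<ge> 1"
proof (induction n arbitrary: m)
  case (Suc n)
  then have "RR_denom q (Suc m) n > 0" using less_le_trans[OF zero_less_one] by blast
  then show ?case using q0 by simp
qed simp

text \<open>The ratios of consecutive \<open>RS2\<close> obey the recursion of the convergents, and
  both are at least 1; so each further level multiplies the error by at most a positive power of
  q.\<close>

lemma RR_denom_approx: "\<bar>RR_denom q (Suc m) n - RS2 m / RS2 (Suc m)\<bar> \<le> q ^ n"
proof -
  define s where "s = (\<lambda>m. RS2 m / RS2 (Suc m))"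
  have s: "s m = 1 + q ^ Suc m / s (Suc m)" for m
    unfolding s_def by (subst RS2_rec) (use RS2_pos[of "Suc m"] RS2_pos[of "Suc (Suc m)"] in \<open>simp add: field_simps\<close>)
  have s0: "s m > 0" for m unfolding s_def using RS2_pos by simp
  have s1: "s m \<ge> 1" for m
    using s[of m] s0[of "Suc m"] q0 by simp
  have "\<bar>RR_denom q (Suc m) n - s m\<bar> \<le> q ^ n" for m
  proof (induction n arbitrary: m)
    case 0
    have "q ^ Suc m / s (Suc m) \<le> 1 / 1" using s1[of "Suc m"] pow_le_1[of "Suc m"] by (intro frac_le) auto
    moreover have "q ^ Suc m / s (Suc m) \<ge> 0" using s0[of "Suc m"] q0 by simp
    ultimately show ?case by (subst s) simp
  next
    case (Suc n)
    define D where "D = RR_denom q (Suc (Suc m)) n"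
    have D: "D \<ge> 1" unfolding D_def by (rule RR_denom_ge_1)
    have "RR_denom q (Suc m) (Suc n) - s m = q ^ Suc m * ((s (Suc m) - D) / (D * s (Suc m)))"
      by (subst s) (use D s1[of "Suc m"] in \<open>simp add: D_def[symmetric] field_simps\<close>)
    then have "\<bar>RR_denom q (Suc m) (Suc n) - s m\<bar> = q ^ Suc m * (\<bar>D - s (Suc m)\<bar> / (D * s (Suc m)))"
      using D s0[of "Suc m"] q0 by (simp add: abs_mult abs_minus_commute)
    also have "\<dots> \<le> q * (q ^ n / 1)"
    proof (intro mult_mono frac_le)
      show "q ^ Suc m \<le> q" using power_decreasing[of 1 "Suc m" q] q0 q1 by simp
      show "\<bar>D - s (Suc m)\<bar> \<le> q ^ n" unfolding D_def by (rule Suc)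
      show "1 \<le> D * s (Suc m)" using mult_mono[of 1 D 1 "s (Suc m)"] D s1[of "Suc m"] by simp
    qed (use q0 D s0[of "Suc m"] in auto)
    finally show ?case by simp
  qed
  then show ?thesis by (simp add: s_def)
qed

lemma rogers_ramanujan_RS: "rogers_ramanujan q = q powr (1/5) * RS2 1 / RS2 0"
proof -
  have "(\<lambda>n. RR_denom q 1 n - RS2 0 / RS2 1) \<longlonglongrightarrow> 0"
  proof (rule Lim_null_comparison)
    show "\<forall>\<^sub>F n in sequentially. norm (RR_denom q 1 n - RS2 0 / RS2 1) \<le> q ^ n"
      using RR_denom_approx[of 0] by simp
    show "(\<lambda>n. q ^ n) \<longlonglongrightarrow> 0" using q0 q1 by (intro LIMSEQ_power_zero) auto
  qed
  then have "(\<lambda>n. RR_denom q 1 n) \<longlonglongrightarrow> RS2 0 / RS2 1" by (simp add: LIM_zero_iff)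
  then have "(\<lambda>n. q powr (1/5) / RR_denom q 1 n) \<longlonglongrightarrow> q powr (1/5) / (RS2 0 / RS2 1)"
    by (intro tendsto_intros) (use RS2_pos[of 0] RS2_pos[of 1] in auto)
  then show ?thesis unfolding rogers_ramanujan_def by (simp add: limI)
qed

text \<open>The indices -r and r + 1 are paired, matching one Rogers-Selberg term, whose last factor
  is a difference.\<close>

lemma theta_as_series:
  assumes "a + b > 0"
  shows "theta (- (q ^ a)) (- (q ^ b)) = (\<Sum>r. (-1) ^ r * (q ^ expo a b (- int r) - q ^ expo a b (int r + 1)))"
proof -
  let ?t = "theta_term (- (q ^ a)) (- (q ^ b))"
  have S: "?t summable_on UNIV"
    by (rule abs_summable_summable[OF summable_theta_power(2)]) (use q0 q1 assms in auto)
  have U: "UNIV = range (\<lambda>r. - int r) \<union> range (\<lambda>r. int r + 1)"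
  proof (intro set_eqI iffI UNIV_I)
    fix x :: int
    show "x \<in> range (\<lambda>r. - int r) \<union> range (\<lambda>r. int r + 1)"
    proof (cases "x \<le> 0")
      case True
      then have "x = - int (nat (- x))" by simp
      then show ?thesis by blast
    next
      case False
      then have "x = int (nat (x - 1)) + 1" by simp
      then show ?thesis by blast
    qed
  qed
  have dis: "range (\<lambda>r. - int r) \<inter> range (\<lambda>r. int r + 1) = {}" by auto
  have i1: "inj (\<lambda>r. - int r)" and i2: "inj (\<lambda>r. int r + 1)" by (auto intro: injI)
  have s1: "?t summable_on range (\<lambda>r. - int r)" and s2: "?t summable_on range (\<lambda>r. int r + 1)"
    using S by (auto intro: summable_on_subset)
  have "theta (- (q ^ a)) (- (q ^ b)) = infsum ?t (range (\<lambda>r. - int r) \<union> range (\<lambda>r. int r + 1))"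
    unfolding theta_def U[symmetric] ..
  also have "\<dots> = infsum ?t (range (\<lambda>r. - int r)) + infsum ?t (range (\<lambda>r. int r + 1))"
    by (rule infsum_Un_disjoint[OF s1 s2 dis])
  also have "\<dots> = infsum (\<lambda>r. ?t (- int r)) UNIV + infsum (\<lambda>r. ?t (int r + 1)) UNIV"
    by (simp only: infsum_reindex[OF i1] infsum_reindex[OF i2] o_def)
  also have "\<dots> = infsum (\<lambda>r. ?t (- int r) + ?t (int r + 1)) UNIV"
  proof (rule infsum_add[symmetric])
    show "(\<lambda>r. ?t (- int r)) summable_on UNIV" "(\<lambda>r. ?t (int r + 1)) summable_on UNIV"
      using s1 s2 by (simp_all only: summable_on_reindex[OF i1] summable_on_reindex[OF i2] o_def)
  qed
  also have "\<dots> = (\<Sum>r. ?t (- int r) + ?t (int r + 1))"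
  proof -
    have "(\<lambda>r. ?t (- int r) + ?t (int r + 1)) summable_on UNIV"
      using s1 s2 by (intro summable_on_add) (simp_all only: summable_on_reindex[OF i1] summable_on_reindex[OF i2] o_def)
    then show ?thesis using has_sum_imp_sums[OF has_sum_infsum] sums_unique by blast
  qed
  also have "(\<lambda>r. ?t (- int r) + ?t (int r + 1)) =
      (\<lambda>r. (-1) ^ r * (q ^ expo a b (- int r) - q ^ expo a b (int r + 1)))"
  proof
    fix r :: nat
    have "sg (- int r) = ((-1) ^ r :: real)" "sg (int r + 1) = (- ((-1) ^ r) :: real)"
      by (simp_all add: sg_def minus_one_power_iff)
    then show "?t (- int r) + ?t (int r + 1) = (-1) ^ r * (q ^ expo a b (- int r) - q ^ expo a b (int r + 1))"
      unfolding theta_term_minus_power by (simp add: right_diff_distrib)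
  qed
  finally show ?thesis .
qed

lemma expo_nat: "2 * int n = (int a + int b) * (x * x) + (int a - int b) * x \<Longrightarrow> expo a b x = n"
  using expo_double[of a b x] by simp

lemma RS2_0: "RS2 0 = theta (- (q ^ 2)) (- (q ^ 3))"
proof -
  have ae: "2 * int (ae r) = int r * (5 * int r + 1)" for r
  proof -
    have "int (2 * ae r) = int (r * (5 * r + 1))" by (simp only: ae_double)
    then show ?thesis by (simp only: of_nat_mult of_nat_add of_nat_numeral of_nat_1)
  qed
  have e1: "expo 2 3 (- int r) = ae r" for r
    by (rule expo_nat) (unfold ae, simp add: algebra_simps)
  have e2: "expo 2 3 (int r + 1) = ae r + 2 * (2 * r + 1)" for r
    by (rule expo_nat) (unfold of_nat_add distrib_left ae, simp add: algebra_simps)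
  have t: "term2 0 = (\<lambda>r. (-1) ^ r * (q ^ ae r - q ^ (ae r + 2 * (2 * r + 1))))"
  proof
    fix r
    have "pq r \<noteq> 0" using pq_bounds(1)[of r] qp_self_pos by simp
    then show "term2 0 r = (-1) ^ r * (q ^ ae r - q ^ (ae r + 2 * (2 * r + 1)))"
      unfolding power_add[of q "ae r" "2 * (2 * r + 1)"] by (simp add: term2_def cf_def right_diff_distrib)
  qed
  show ?thesis
    unfolding RS2_def t using theta_as_series[of 2 3] by (simp only: e1 e2)
qed

lemma RS2_1: "RS2 1 = theta (- (q ^ 1)) (- (q ^ 4))"
proof -
  have ae: "2 * int (ae r) = int r * (5 * int r + 1)" for r
  proof -
    have "int (2 * ae r) = int (r * (5 * r + 1))" by (simp only: ae_double)
    then show ?thesis by (simp only: of_nat_mult of_nat_add of_nat_numeral of_nat_1)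
  qed
  have e1: "expo 1 4 (- int r) = ae r + r" for r
    by (rule expo_nat) (unfold of_nat_add distrib_left ae, simp add: algebra_simps)
  have e2: "expo 1 4 (int r + 1) = ae r + r + (2 * r + 1)" for r
    by (rule expo_nat) (unfold of_nat_add distrib_left ae, simp add: algebra_simps)
  have t: "term1 0 = (\<lambda>r. (-1) ^ r * (q ^ (ae r + r) - q ^ (ae r + r + (2 * r + 1))))"
  proof
    fix r
    have "pq r \<noteq> 0" using pq_bounds(1)[of r] qp_self_pos by simp
    then show "term1 0 r = (-1) ^ r * (q ^ (ae r + r) - q ^ (ae r + r + (2 * r + 1)))"
      unfolding power_add[of q "ae r + r" "2 * r + 1"] by (simp add: term1_def cf_def right_diff_distrib)
  qed
  have "RS2 1 = RS1 0" using RS1_eq[of 0] by simp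
  then show ?thesis
    unfolding RS1_def t using theta_as_series[of 1 4] by (simp only: e1 e2)
qed

end

section \<open>Ramanujan's identity by fifth roots of unity\<close>

lemma qp_of_real:
  fixes a q :: real
  assumes "\<bar>q\<bar> < 1"
  shows "qp (complex_of_real a) (of_real q) = of_real (qp a q)"
proof (rule LIMSEQ_unique)
  show "(\<lambda>N. \<Prod>n<N. 1 - complex_of_real a * of_real q ^ n) \<longlonglongrightarrow> qp (of_real a) (of_real q)"
    by (rule tendsto_qp) (use assms in simp)
  have "(\<lambda>N. complex_of_real (\<Prod>n<N. 1 - a * q ^ n)) \<longlonglongrightarrow> of_real (qp a q)"
    by (intro tendsto_of_real tendsto_qp) (use assms in simp)
  then show "(\<lambda>N. \<Prod>n<N. 1 - complex_of_real a * of_real q ^ n) \<longlonglongrightarrow> of_real (qp a q)"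
    by simp
qed

lemma qpow_of_real:
  fixes q :: real
  assumes "\<bar>q\<bar> < 1" "k > 0"
  shows "qpow (complex_of_real q) a k = of_real (qpow q a k)"
  unfolding qpow_def of_real_power[symmetric]
  by (rule qp_of_real) (use assms in \<open>simp add: power_abs power_less_one_iff\<close>)

lemma prod_lessThan_5: "(\<Prod>j<5. f j) = f 0 * f 1 * f 2 * f 3 * f (4::nat)"
  by (simp add: eval_nat_numeral ac_simps)

text \<open>z is a primitive fifth root of unity, given by its cyclotomic equation, so the five
  factors 1 - z^j x multiply to 1 - x^5.\<close>

lemma qp_fifth_roots:
  fixes z Q :: "'a::{real_normed_field,banach}"
  assumes z: "1 + z + z ^ 2 + z ^ 3 + z ^ 4 = 0" and Q: "norm Q < 1"
  shows "(\<Prod>j<5. qp (z ^ j * a) Q) = qp (a ^ 5) (Q ^ 5)"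
proof (rule LIMSEQ_unique)
  show "(\<lambda>N. \<Prod>j<5. \<Prod>n<N. 1 - z ^ j * a * Q ^ n) \<longlonglongrightarrow> (\<Prod>j<5. qp (z ^ j * a) Q)"
    by (intro tendsto_prod tendsto_qp Q)
  have root: "(\<Prod>j<5. 1 - z ^ j * x) = 1 - x ^ 5" for x
    unfolding prod_lessThan_5 using z by algebra
  have "(\<Prod>j<5. \<Prod>n<N. 1 - z ^ j * a * Q ^ n) = (\<Prod>n<N. 1 - a ^ 5 * (Q ^ 5) ^ n)" for N
  proof -
    have "(\<Prod>j<5. \<Prod>n<N. 1 - z ^ j * a * Q ^ n) = (\<Prod>n<N. \<Prod>j<5. 1 - z ^ j * (a * Q ^ n))"
      by (subst prod.swap) (simp only: mult.assoc)
    also have "\<dots> = (\<Prod>n<N. 1 - (a * Q ^ n) ^ 5)"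
      by (simp only: root)
    finally show ?thesis
      by (simp add: power_mult_distrib power_mult[symmetric] mult.commute)
  qed
  moreover have "norm (Q ^ 5) < 1" using Q by (simp add: norm_power power_less_one_iff)
  ultimately show "(\<lambda>N. \<Prod>j<5. \<Prod>n<N. 1 - z ^ j * a * Q ^ n) \<longlonglongrightarrow> qp (a ^ 5) (Q ^ 5)"
    by (simp add: tendsto_qp)
qed

text \<open>With q = y^5, the factors with exponents prime to 5 multiply over j to f(q)/f(q^5);
  those with exponents divisible by 5 do not depend on j and contribute f(q)^5.\<close>

lemma euler_prod_fifth_roots:
  fixes z y :: "'a::{real_normed_field,banach}"
  assumes z: "1 + z + z ^ 2 + z ^ 3 + z ^ 4 = 0" and y: "norm y < 1"
  shows "(\<Prod>j<5. euler_prod (z ^ j * y)) * qpow (y ^ 5) 5 5 = qpow (y ^ 5) 1 1 ^ 6"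
proof -
  define Q where "Q = y ^ 5"
  have z5: "z ^ 5 = 1" using z by algebra
  have nz: "norm z = 1"
    using z5 norm_power[of z 5] power_eq_1_iff[of "norm z" 5] by simp
  have Q: "norm Q < 1" using y by (simp add: Q_def norm_power power_less_one_iff)
  have e: "euler_prod (z ^ j * y) = (\<Prod>i<5. qp ((z ^ Suc i) ^ j * y ^ Suc i) Q)" for j
  proof -
    have "norm (z ^ j * y) < 1" using y nz by (simp add: norm_mult norm_power)
    from qp_split[OF this, of 5 "z ^ j * y"]
    have "euler_prod (z ^ j * y) = (\<Prod>i<5. qp (z ^ j * y * (z ^ j * y) ^ i) ((z ^ j * y) ^ 5))"
      by (simp add: euler_prod_def)
    moreover have "(z ^ j * y) ^ 5 = Q"
    proof -
      have "(z ^ j) ^ 5 = (z ^ 5) ^ j" by (simp only: power_mult[symmetric] mult.commute)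
      then show ?thesis using z5 by (simp add: Q_def power_mult_distrib)
    qed
    moreover have "z ^ j * y * (z ^ j * y) ^ i = (z ^ Suc i) ^ j * y ^ Suc i" for i
      by (simp add: power_mult_distrib power_mult[symmetric] ac_simps)
    ultimately show ?thesis by simp
  qed
  have "(\<Prod>j<5. euler_prod (z ^ j * y)) = (\<Prod>i<5. \<Prod>j<5. qp ((z ^ Suc i) ^ j * y ^ Suc i) Q)"
    unfolding e by (rule prod.swap)
  also have "\<dots> = qp (y ^ 5) (Q ^ 5) * qp ((y ^ 2) ^ 5) (Q ^ 5) * qp ((y ^ 3) ^ 5) (Q ^ 5) * qp ((y ^ 4) ^ 5) (Q ^ 5) * qp Q Q ^ 5"
  proof -
    have z': "1 + z ^ 2 + (z ^ 2) ^ 2 + (z ^ 2) ^ 3 + (z ^ 2) ^ 4 = 0"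
      "1 + z ^ 3 + (z ^ 3) ^ 2 + (z ^ 3) ^ 3 + (z ^ 3) ^ 4 = 0"
      "1 + z ^ 4 + (z ^ 4) ^ 2 + (z ^ 4) ^ 3 + (z ^ 4) ^ 4 = 0"
      using z by algebra+
    define F where "F = (\<lambda>i. \<Prod>j<5. qp ((z ^ Suc i) ^ j * y ^ Suc i) Q)"
    have s: "Suc 0 = 1" "Suc 1 = 2" "Suc 2 = 3" "Suc 3 = 4" "Suc 4 = 5" by simp_all
    have F0: "F 0 = qp (y ^ 5) (Q ^ 5)"
      using qp_fifth_roots[OF z Q, of y] by (simp add: F_def)
    have F1: "F 1 = qp ((y ^ 2) ^ 5) (Q ^ 5)" unfolding F_def s by (rule qp_fifth_roots[OF z'(1) Q])
    have F2: "F 2 = qp ((y ^ 3) ^ 5) (Q ^ 5)" unfolding F_def s by (rule qp_fifth_roots[OF z'(2) Q])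
    have F3: "F 3 = qp ((y ^ 4) ^ 5) (Q ^ 5)" unfolding F_def s by (rule qp_fifth_roots[OF z'(3) Q])
    have F4: "F 4 = qp Q Q ^ 5" unfolding F_def s z5 by (simp add: Q_def)
    have "(\<Prod>i<5. F i) = qp (y ^ 5) (Q ^ 5) * qp ((y ^ 2) ^ 5) (Q ^ 5) * qp ((y ^ 3) ^ 5) (Q ^ 5) * qp ((y ^ 4) ^ 5) (Q ^ 5) * qp Q Q ^ 5"
      unfolding prod_lessThan_5[of F] F0 F1 F2 F3 F4 ..
    then show ?thesis by (simp only: F_def)
  qed
  also have "\<dots> = qpow Q 1 5 * qpow Q 2 5 * qpow Q 3 5 * qpow Q 4 5 * qpow Q 1 1 ^ 5"
    by (simp add: qpow_def Q_def mult.commute flip: power_mult)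
  finally have "(\<Prod>j<5. euler_prod (z ^ j * y)) * qpow Q 5 5 =
      qpow Q 1 5 * qpow Q 2 5 * qpow Q 3 5 * qpow Q 4 5 * qpow Q 5 5 * qpow Q 1 1 ^ 5"
    by simp
  also have "qpow Q 1 5 * qpow Q 2 5 * qpow Q 3 5 * qpow Q 4 5 * qpow Q 5 5 = qpow Q 1 1"
    using qpow_split5[OF Q, of 1 1] by (simp flip: numeral_2_eq_2 numeral_3_eq_3)
  finally show ?thesis by (simp add: Q_def eval_nat_numeral)
qed

text \<open>Write 1 - x - x^2 = (1 - \<alpha>x)(1 - \<beta>x) with \<alpha> + \<beta> = 1 and
  \<alpha>\<beta> = -1. The product is (1 - \<alpha>^5 x^5)(1 - \<beta>^5 x^5), and 11 is the Lucas
  number \<alpha>^5 + \<beta>^5.\<close>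

lemma quadratic_fifth_roots:
  fixes z x :: "'a::field"
  assumes z: "1 + z + z ^ 2 + z ^ 3 + z ^ 4 = 0"
  shows "(\<Prod>j<5. 1 - z ^ j * x - (z ^ j * x) ^ 2) = 1 - 11 * x ^ 5 - x ^ 10"
  unfolding prod_lessThan_5 using z by algebra

lemma fifth_root_of_unity: "\<exists>z::complex. 1 + z + z ^ 2 + z ^ 3 + z ^ 4 = 0"
proof -
  define z where "z = cis (2 * pi / 5)"
  have "z ^ 5 = 1" using Complex.DeMoivre[of "2 * pi / 5" 5] by (simp add: z_def)
  then have "(z - 1) * (1 + z + z ^ 2 + z ^ 3 + z ^ 4) = 0" by algebra
  moreover have "z \<noteq> 1"
  proof
    assume "z = 1"
    then have "cos (2 * pi / 5) = 1" by (metis cis.sel(1) one_complex.sel(1) z_def)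
    moreover have "cos (2 * pi / 5) < cos 0" by (rule cos_monotone_0_pi) auto
    ultimately show False by simp
  qed
  ultimately show ?thesis by auto
qed

text \<open>The 5-dissection gives \<open>euler_prod u = f5 (\<rho> - u - u\<^sup>2/\<rho>)\<close> with \<open>\<rho> = q\<^sup>1\<^sup>/\<^sup>5/R(q)\<close> for each of the five
  complex fifth roots \<open>u\<close> of \<open>q\<close>; the identity is the product of these five equations.\<close>

lemma rogers_ramanujan_identity:
  assumes "0 < q" "q < 1"
  shows "rogers_ramanujan q powi (-5) - 11 - rogers_ramanujan q ^ 5 = qpow q 1 1 ^ 6 / (q * qpow q 5 5 ^ 6)"
proof -
  have q: "\<bar>q\<bar> < 1" using assms by simp
  define X Y f5 where "X = theta (- (q ^ 2)) (- (q ^ 3))" and "Y = theta (- (q ^ 1)) (- (q ^ 4))"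
    and "f5 = qpow q 5 5"
  define y where "y = q powr (1/5)"
  define R where "R = rogers_ramanujan q"
  have y: "y > 0" "y ^ 5 = q" using assms by (simp_all add: y_def powr_powr flip: powr_realpow)
  have y1: "y < 1"
  proof (rule ccontr)
    assume "\<not> y < 1"
    then have "1 \<le> y ^ 5" by simp
    then show False using y(2) assms by simp
  qed
  have XY: "X > 0" "Y > 0"
    unfolding X_def Y_def using RS2_pos[OF assms, of 0] RS2_pos[OF assms, of 1]
    by (simp_all only: RS2_0[OF assms] RS2_1[OF assms])
  have R: "R = y * Y / X"
    unfolding R_def rogers_ramanujan_RS[OF assms] RS2_0[OF assms] RS2_1[OF assms]
    by (simp add: y_def X_def Y_def)
  then have R0: "R > 0" using y XY by simp
  have f5: "f5 > 0" unfolding f5_def by (rule F_pos[OF assms]) simp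
  define \<rho> where "\<rho> = X / Y"
  have rho: "\<rho> > 0" using XY by (simp add: \<rho>_def)
  obtain z :: complex where z: "1 + z + z ^ 2 + z ^ 3 + z ^ 4 = 0"
    using fifth_root_of_unity by blast
  have z5: "z ^ 5 = 1" using z by algebra
  have nz: "norm z = 1"
    using z5 norm_power[of z 5] power_eq_1_iff[of "norm z" 5] by simp
  define Q where "Q = complex_of_real q"
  have Q: "norm Q < 1" using q by (simp add: Q_def)
  \<comment> \<open>The product formulas at Q and at q carry the real values X and Y over to the
    complex theta functions.\<close>
  have "theta (- (Q ^ 2)) (- (Q ^ 3)) = qpow Q 2 5 * qpow Q 3 5 * qpow Q 5 5"
    "theta (- (Q ^ 1)) (- (Q ^ 4)) = qpow Q 1 5 * qpow Q 4 5 * qpow Q 5 5"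
    using theta_power(2)[OF Q, of 2 3] theta_power(2)[OF Q, of 1 4] by simp_all
  moreover have "X = qpow q 2 5 * qpow q 3 5 * qpow q 5 5" "Y = qpow q 1 5 * qpow q 4 5 * qpow q 5 5"
    unfolding X_def Y_def using theta_power(2)[of q 2 3] theta_power(2)[of q 1 4] q by simp_all
  ultimately have cX: "theta (- (Q ^ 2)) (- (Q ^ 3)) = of_real X" and cY: "theta (- (Q ^ 1)) (- (Q ^ 4)) = of_real Y"
    by (simp_all only: Q_def qpow_of_real[OF q] of_real_mult zero_less_numeral)
  have cf5: "qpow Q 5 5 = of_real f5" by (simp add: Q_def f5_def qpow_of_real q)
  have eul: "euler_prod u = of_real f5 * (of_real \<rho> - u - u ^ 2 / of_real \<rho>)" if u: "u ^ 5 = Q" "norm u < 1" for u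
  proof -
    define C0 C2 where "C0 = theta (- (Q ^ 7)) (- (Q ^ 8)) + Q * theta (- (Q ^ 2)) (- (Q ^ 13))"
      and "C2 = theta (- (Q ^ 4)) (- (Q ^ 11)) - Q * theta (- (Q ^ 14)) (- (Q ^ 1))"
    have p: "u ^ (5 * n) = Q ^ n" for n by (simp add: power_mult u(1))
    have pw: "u ^ 5 = Q" "u ^ 10 = Q ^ 2" "u ^ 20 = Q ^ 4" "u ^ 25 = Q ^ 5" "u ^ 35 = Q ^ 7" "u ^ 40 = Q ^ 8"
      "u ^ 50 = Q ^ 10" "u ^ 55 = Q ^ 11" "u ^ 65 = Q ^ 13" "u ^ 70 = Q ^ 14"
      using p[of 1] p[of 2] p[of 4] p[of 5] p[of 7] p[of 8] p[of 10] p[of 11] p[of 13] p[of 14] by simp_all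
    have "euler_prod u = C0 - u * theta (- (Q ^ 5)) (- (Q ^ 10)) - u\<^sup>2 * C2"
      unfolding pentagonal[OF u(2), symmetric] pentagonal_dissection[OF u(2)] pw C0_def C2_def
      by (simp only: theta_commute[of "- (Q ^ 13)"] theta_commute[of "- (Q ^ 14)"] power_one_right)
    moreover have "theta (- (Q ^ 5)) (- (Q ^ 10)) = of_real f5"
    proof -
      have "norm (Q ^ 5) < 1" using Q by (simp add: norm_power power_less_one_iff)
      moreover have "(Q ^ 5) ^ 1 = Q ^ 5" "(Q ^ 5) ^ 2 = Q ^ 10" by (simp_all flip: power_mult)
      moreover have "euler_prod (Q ^ 5) = qpow Q 5 5" by (simp add: euler_prod_def qpow_def)
      ultimately show ?thesis using pentagonal[of "Q ^ 5"] by (simp only: cf5)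
    qed
    \<comment> \<open>The quintuple product is applied at Q, the same for all five u; hence the
      outer parts of the dissection are \<rho> and 1/\<rho> times the Euler product, whichever root
      u is.\<close>
    moreover have "C0 * of_real Y = of_real f5 * of_real X" "C2 * of_real X = of_real f5 * of_real Y"
      unfolding C0_def C2_def by (rule quintuple_product[OF Q, unfolded cX cY cf5])+
    then have "C0 = of_real f5 * of_real \<rho>" "C2 = of_real f5 / of_real \<rho>"
      using XY by (simp_all add: \<rho>_def eq_divide_eq)
    ultimately show ?thesis by (simp add: right_diff_distrib mult.commute)
  qed
  define P where "P = (\<Prod>j<5. euler_prod (z ^ j * of_real y))"
  have "P = (\<Prod>j<5. of_real (f5 * \<rho>) * (1 - z ^ j * of_real R - (z ^ j * of_real R) ^ 2))"
    unfolding P_def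
  proof (rule prod.cong[OF refl])
    fix j
    have "(z ^ j * of_real y) ^ 5 = Q"
    proof -
      have "(z ^ j) ^ 5 = (z ^ 5) ^ j" by (simp only: power_mult[symmetric] mult.commute)
      then show ?thesis using z5 y(2) by (simp add: Q_def power_mult_distrib flip: of_real_power)
    qed
    moreover have "norm (z ^ j * complex_of_real y) < 1" using y y1 nz by (simp add: norm_mult norm_power)
    ultimately have "euler_prod (z ^ j * of_real y) =
      of_real f5 * (of_real \<rho> - z ^ j * of_real y - (z ^ j * of_real y) ^ 2 / of_real \<rho>)"
      by (rule eul)
    moreover have "y = R * \<rho>" using XY by (simp add: R \<rho>_def)
    moreover have "complex_of_real \<rho> \<noteq> 0" using rho by simp
    then have "of_real f5 * (of_real \<rho> - z ^ j * of_real (R * \<rho>) - (z ^ j * of_real (R * \<rho>)) ^ 2 / of_real \<rho>) =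
        of_real (f5 * \<rho>) * (1 - z ^ j * of_real R - (z ^ j * of_real R) ^ 2)"
      by (simp add: power2_eq_square algebra_simps)
    ultimately show "euler_prod (z ^ j * of_real y) = of_real (f5 * \<rho>) * (1 - z ^ j * of_real R - (z ^ j * of_real R) ^ 2)"
      by simp
  qed
  also have "\<dots> = of_real (f5 * \<rho>) ^ 5 * (\<Prod>j<5. 1 - z ^ j * of_real R - (z ^ j * of_real R) ^ 2)"
    by (simp add: prod.distrib)
  also have "(\<Prod>j<5. 1 - z ^ j * of_real R - (z ^ j * of_real R) ^ 2) = 1 - 11 * complex_of_real R ^ 5 - of_real R ^ 10"
    by (rule quadratic_fifth_roots[OF z])
  finally have P1: "P = of_real ((f5 * \<rho>) ^ 5 * (1 - 11 * R ^ 5 - R ^ 10))" by simp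
  have "P * qpow (complex_of_real y ^ 5) 5 5 = qpow (complex_of_real y ^ 5) 1 1 ^ 6"
    unfolding P_def by (rule euler_prod_fifth_roots[OF z]) (use y y1 in simp)
  moreover have "complex_of_real y ^ 5 = of_real q" using y(2) by (simp flip: of_real_power)
  ultimately have "complex_of_real ((f5 * \<rho>) ^ 5 * (1 - 11 * R ^ 5 - R ^ 10) * f5) = of_real (qpow q 1 1 ^ 6)"
    unfolding P1 by (simp add: qpow_of_real q f5_def)
  then have "(f5 * \<rho>) ^ 5 * (1 - 11 * R ^ 5 - R ^ 10) * f5 = qpow q 1 1 ^ 6"
    by (simp only: of_real_eq_iff)
  moreover have "\<rho> ^ 5 * R ^ 5 = q"
  proof -
    have "\<rho> * R = y" using XY by (simp add: R \<rho>_def)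
    then show ?thesis using y(2) by (simp flip: power_mult_distrib)
  qed
  moreover have "R ^ 5 * ((f5 * \<rho>) ^ 5 * W * f5) = (\<rho> ^ 5 * R ^ 5) * f5 ^ 6 * W" for W
    by (simp add: power_mult_distrib eval_nat_numeral)
  ultimately have "q * f5 ^ 6 * (1 - 11 * R ^ 5 - R ^ 10) = R ^ 5 * qpow q 1 1 ^ 6"
    by metis
  then have "(1 - 11 * R ^ 5 - R ^ 10) * (q * f5 ^ 6) = qpow q 1 1 ^ 6 * R ^ 5"
    by (simp only: mult.commute)
  then have "(1 - 11 * R ^ 5 - R ^ 10) / R ^ 5 = qpow q 1 1 ^ 6 / (q * f5 ^ 6)"
    using R0 f5 assms by (subst frac_eq_eq) auto
  moreover have "(1 - 11 * R ^ 5 - R ^ 10) / R ^ 5 = R powi (-5) - 11 - R ^ 5"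
    using R0 by (simp add: power_int_minus divide_eq_eq left_diff_distrib flip: power_add)
  ultimately show "rogers_ramanujan q powi (-5) - 11 - rogers_ramanujan q ^ 5 = qpow q 1 1 ^ 6 / (q * qpow q 5 5 ^ 6)"
    by (simp add: R_def f5_def)
qed

section \<open>The two equations for the singular moduli\<close>

theorem theorem2p3:
  fixes r q k k' w c :: real
  assumes "r > 0"
    and "q = exp (- pi * sqrt r)"
    and "k = singular_modulus r"
    and "k' = compl_singular_modulus r"
    and "w = modulus_w r"
    and "c = modulus_c r"
  shows "(3125 * c\<^sup>2
          - 6250 * c powr (5/3) * RR_G q
          + 4375 * c powr (4/3) * RR_G q ^ 2
          - 1500 * c * RR_G q ^ 3
          + 275 * c powr (2/3) * RR_G q ^ 4
          + 2 * c powr (1/3) * (- 13 + 128 * k'\<^sup>2 * k\<^sup>2) * RR_G q ^ 5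
          + RR_G q ^ 6 = 0)
       \<and> (k ^ 6 + k ^ 3 * (- 16 + 10 * k\<^sup>2) * w + 15 * k ^ 4 * w\<^sup>2
          - 20 * k ^ 3 * w ^ 3 + 15 * k\<^sup>2 * w ^ 4
          + k * (10 - 16 * k\<^sup>2) * w ^ 5 + w ^ 6 = 0)"
proof -
  have q: "0 < q" "q < 1" using assms(1,2) by simp_all
  \<comment> \<open>sqrt(25r) = 5 sqrt r, so the modulus at 25r has the nome q^5.\<close>
  have q5: "exp (- pi * sqrt (25 * r)) = q ^ 5"
  proof -
    have "q ^ 5 = exp (5 * (- pi * sqrt r))" unfolding assms(2) by (simp flip: exp_of_nat_mult)
    then show ?thesis by (simp add: real_sqrt_mult)
  qed
  define l where "l = singular_modulus (25 * r)"
  define m where "m = th3 q ^ 2 / th3 (q ^ 5) ^ 2"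
  have k: "k = th2sq q / th3 q ^ 2" and k01: "0 < k" "k < 1"
    unfolding assms(2,3) by (simp_all only: singular_modulus_eq[OF assms(1)])
  have l: "l = th2sq (q ^ 5) / th3 (q ^ 5) ^ 2"
  proof -
    have "25 * r > 0" using assms(1) by simp
    from singular_modulus_eq(1)[OF this] show ?thesis by (simp only: q5 l_def)
  qed
  have w: "w = sqrt (k * l)" by (simp only: assms(3,5) modulus_w_def l_def)
  have k2: "k'\<^sup>2 = 1 - k\<^sup>2"
  proof -
    have "k\<^sup>2 \<le> 1" using k01 by (simp add: power_le_one)
    moreover have "k' = sqrt (1 - k\<^sup>2)" by (simp only: assms(3,4) compl_singular_modulus_def)
    ultimately show ?thesis by simp
  qed
  have c: "c = (1 - k ^ 2) * (k / w) ^ 5 / ((k / w) ^ 4 - k ^ 2)"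
    unfolding assms(6) modulus_c_def modulus_star_def k2[symmetric] assms(5)
    by (simp only: assms(3,4))
  note M = modular_equation_5[OF q, folded k l m_def, folded w, folded c]
  have m0: "m > 0"
    unfolding m_def using q by (intro divide_pos_pos zero_less_power th_pos) (simp_all add: power_less_one_iff)
  \<comment> \<open>Positivity of c makes t a true cube root: every fractional power of c is a
    natural power of t, and the exponent 1/3 in \<open>RR_G\<close> inverts cubing exactly.\<close>
  define t where "t = c powr (1/3)"
  have t0: "t > 0" using M(4) by (simp add: t_def)
  have pow_t: "t ^ n = c powr (1 / 3 * real n)" for n
    unfolding powr_realpow[OF t0, symmetric] by (simp only: t_def powr_powr)
  have ct: "c = t ^ 3"
    using pow_t[of 3] M(4) by simp
  have ct5: "c powr (5/3) = t ^ 5" "c powr (4/3) = t ^ 4" "c powr (2/3) = t ^ 2"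
    using pow_t[of 5] pow_t[of 4] pow_t[of 2] by simp_all
  have "rogers_ramanujan q powi (-5) - 11 - rogers_ramanujan q ^ 5 = m ^ 3 * c"
    by (rule trans[OF rogers_ramanujan_identity[OF q] M(3)[symmetric]])
  then have "RR_G q = (m ^ 3 * c) powr (1/3)"
    by (simp only: RR_G_def)
  also have "m ^ 3 * c = (m * t) powr real 3"
  proof -
    have "m ^ 3 * c = (m * t) ^ 3" by (simp only: ct power_mult_distrib)
    also have "\<dots> = (m * t) powr real 3"
      by (rule powr_realpow[symmetric]) (use m0 t0 in simp)
    finally show ?thesis .
  qed
  also have "\<dots> powr (1/3) = m * t"
    unfolding powr_powr using m0 t0 by simp
  finally have G: "RR_G q = m * t" .
  have "3125 * c\<^sup>2 - 6250 * c powr (5/3) * RR_G q + 4375 * c powr (4/3) * RR_G q ^ 2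
          - 1500 * c * RR_G q ^ 3 + 275 * c powr (2/3) * RR_G q ^ 4
          + 2 * c powr (1/3) * (- 13 + 128 * k'\<^sup>2 * k\<^sup>2) * RR_G q ^ 5 + RR_G q ^ 6
      = t ^ 6 * ((m - 5) ^ 5 * (m - 1) + 256 * (1 - k ^ 2) * k ^ 2 * m ^ 5)"
    unfolding G ct5 t_def[symmetric] k2 unfolding ct by algebra
  also have "\<dots> = 0" by (simp only: M(2) mult_zero_right)
  finally show ?thesis using M(1) by (rule conjI)
qed

end
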